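(* Let $d\ge2$, let $\Gamma$ be a Zariski dense subgroup of $SL_d(\mathbb{R})$, and let $\mu$ be a probability measure with an exponential moment whose support generates $\Gamma$. Let $(X_n)_{n\ge1}$ be independent random variables with law $\mu$ and $S_n=X_n\cdots X_1$. Then for every proper algebraic subvariety $\mathcal{V}$ of $\mathbb{R}^d$ and every non zero vector $x$ of $\mathbb{R}^d$, $$\limsup_{n\to\infty}\big[\mathbb{P}(S_nx\in\mathcal{V})\big]^{1/n}<1 .$$
   Context: A probability measure $\mu$ on $SL_d(\mathbb{R})$ has an exponential moment if $\int\|g\|^\tau d\mu(g)<\infty$ for some $\tau>0$, for some (equivalently any) norm on $M_d(\mathbb{R})$. A proper algebraic subvariety of $\mathbb{R}^d$ is the set of common zeros in $\mathbb{R}^d$ of a family of real polynomials in $d$ variables, distinct from $\mathbb{R}^d$. "The support of $\mu$ generates $\Gamma$" means that the subgroup generated by the support of $\mu$ is $\Gamma$. *)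

theory Defs
  imports "HOL-Probability.Probability" "HOL-Algebra.Generated_Groups"
begin

definition SL :: "(real^'d^'d) monoid" where
  "SL = \<lparr>carrier = {A. det A = 1}, monoid.mult = (**), one = mat 1\<rparr>"

definition SL_borel :: "(real^'d^'d) measure" where
  "SL_borel = restrict_space borel (carrier SL)"

lemma group_SL: "group (SL :: (real^'d^'d) monoid)"
proof (rule groupI)
  fix A :: "real^'d^'d"
  assume "A \<in> carrier SL"
  then have A: "det A = 1"
    by (simp add: SL_def)
  then obtain B where B: "B ** A = mat 1"
    by (metis invertible_det_nz invertible_left_inverse zero_neq_one)
  have "det B = 1"
    using arg_cong[OF B, of det] A by (simp add: det_mul)
  with B show "\<exists>B\<in>carrier SL. B \<otimes>\<^bsub>SL\<^esub> A = \<one>\<^bsub>SL\<^esub>"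
    by (auto simp: SL_def)
qed (auto simp: SL_def det_mul matrix_mul_assoc)

text \<open>
  On a Euclidean space, \<^const>\<open>real_polynomial_function\<close> describes exactly the functions given by
  real polynomials in the coordinates; on square matrices these are the polynomials in the entries.
\<close>

definition algebraic_set :: "'a::real_normed_vector set \<Rightarrow> bool" where
  "algebraic_set V \<longleftrightarrow>
     (\<exists>F. (\<forall>p\<in>F. real_polynomial_function p) \<and> V = {x. \<forall>p\<in>F. p x = 0})"

definition zariski_closure :: "'a::real_normed_vector set \<Rightarrow> 'a set" where
  "zariski_closure S = \<Inter> {V. algebraic_set V \<and> S \<subseteq> V}"

definition zariski_dense_in :: "'a::real_normed_vector set \<Rightarrow> 'a set \<Rightarrow> bool" where
  "zariski_dense_in S T \<longleftrightarrow> S \<subseteq> T \<and> T \<subseteq> zariski_closure S"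

text \<open>
  Topological support, in the subspace topology of \<^term>\<open>space \<mu>\<close>.
\<close>

definition measure_support :: "'a::topological_space measure \<Rightarrow> 'a set" where
  "measure_support \<mu> =
     {x \<in> space \<mu>. \<forall>U. open U \<longrightarrow> x \<in> U \<longrightarrow> emeasure \<mu> (U \<inter> space \<mu>) > 0}"

definition exponential_moment :: "(real^'d^'d) measure \<Rightarrow> bool" where
  "exponential_moment \<mu> \<longleftrightarrow> (\<exists>\<tau>>0. (\<integral>\<^sup>+ g. ennreal (norm g powr \<tau>) \<partial>\<mu>) < \<infinity>)"

text \<open>
  The left random walk $X_n \cdots X_1$; the value \<open>X 0\<close> is never used.
\<close>

primrec left_walk :: "(nat \<Rightarrow> 'w \<Rightarrow> real^'d^'d) \<Rightarrow> nat \<Rightarrow> 'w \<Rightarrow> real^'d^'d" where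
  "left_walk X 0 \<omega> = mat 1"
| "left_walk X (Suc n) \<omega> = X (Suc n) \<omega> ** left_walk X n \<omega>"

end

theory Submission
  imports Defs "Jordan_Normal_Form.Determinant" "HOL-Library.Function_Algebras"
begin

text \<open>
  Pulling back along \<open>g \<mapsto> g *v x\<close>, it is enough to bound the probability that the walk on the special
  linear group lies in the zero set of a nonzero finite-dimensional space \<open>F\<close> of polynomial functions.
  By Cauchy--Schwarz, the square of this probability is at most the probability that two independent
  translates of \<open>F\<close> coincide, plus that of lying in the zero set of the larger space which they span
  otherwise, so that induction on the codimension of \<open>F\<close> applies. If \<open>F\<close> is invariant, its zero set is
  empty; otherwise a nonconstant Pluecker coordinate of \<open>F\<close> reduces the coincidence to the walk
  returning to a given line of functions modulo constants. That probability decays exponentially by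
  Kesten's argument in \<open>\<ell>\<^sup>2\<close> of the set of lines: without a spectral gap there would be a finitely
  additive probability on lines invariant under a subgroup of full measure, which is Zariski dense,
  and Furstenberg's argument would then yield a function with bounded translates.
\<close>

text \<open>A coincidence of two translates of \<open>F\<close> concerns subspaces, whereas Kesten's
  argument is about lines. Determinants of evaluations take the place of exterior powers: they are
  again polynomial functions on the group, so one kind of representation, polynomial functions
  modulo constants, serves every dimension. Constants are divided out because no other polynomial
  function on the group has bounded translates; afterwards every nonzero vector has an unbounded
  orbit, and this is what the absence of a spectral gap contradicts.

  A missing gap is an average over the step law, so it yields invariance only under a subgroup of
  full measure. The lines form a discrete set without any countability; hence Kesten's bound is
  proved on finite sets of lines and reached by approximation, and the limiting probability is
  merely finitely additive. It may vanish on a subspace and still concentrate near it. Furstenberg's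
  argument is therefore run with the masses of conic neighbourhoods.\<close>

subsection \<open>Determinants indexed by initial segments\<close>

text \<open>The order is a number and not a type, because it will be the dimension of a function
  space that varies within the arguments.\<close>

definition ldet :: "nat \<Rightarrow> (nat \<Rightarrow> nat \<Rightarrow> real) \<Rightarrow> real" where
  "ldet n A = Determinant.det (Matrix.mat n n (\<lambda>(i, j). A i j))"

lemma ldet_expand:
  "ldet n A = (\<Sum>p | p permutes {0..<n}. of_int (sign p) * (\<Prod>i = 0..<n. A i (p i)))"
proof -
  have "(\<Prod>i = 0..<n. Matrix.mat n n (\<lambda>(i, j). A i j) $$ (i, p i)) = (\<Prod>i = 0..<n. A i (p i))"
    if "p permutes {0..<n}" for p
    using permutes_in_image[OF that] by (intro prod.cong) auto
  then show ?thesis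
    unfolding ldet_def by (subst det_def'[where n = n]) (auto intro!: sum.cong)
qed

lemma ldet_cong:
  assumes "\<And>i j. i < n \<Longrightarrow> j < n \<Longrightarrow> A i j = B i j"
  shows "ldet n A = ldet n B"
  unfolding ldet_def using assms by (intro arg_cong[where f = Determinant.det] eq_matI) auto

lemma ldet_mult: "ldet n (\<lambda>i j. \<Sum>k<n. A i k * B k j) = ldet n A * ldet n B"
proof -
  let ?M = "\<lambda>A. Matrix.mat n n (\<lambda>(i, j). A i j :: real)"
  have "?M (\<lambda>i j. \<Sum>k<n. A i k * B k j) = ?M A * ?M B"
    by (rule eq_matI) (auto simp: scalar_prod_def atLeast0LessThan)
  then show ?thesis
    unfolding ldet_def by (simp add: Determinant.det_mult[where n = n])
qed

text \<open>A permutation that fixes every index except \<open>i\<close> fixes \<open>i\<close> as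
  well, so each permutation other than the identity picks an off-diagonal zero in a row different
  from \<open>i\<close>.\<close>

lemma ldet_row:
  assumes "i < n" and "\<And>k l. k < n \<Longrightarrow> l < n \<Longrightarrow> k \<noteq> i \<Longrightarrow> A k l = (if k = l then 1 else 0)"
  shows "ldet n A = A i i"
proof -
  have "(\<Prod>k = 0..<n. A k (p k)) = 0" if p: "p permutes {0..<n}" "p \<noteq> id" for p
  proof -
    have "\<exists>k<n. k \<noteq> i \<and> p k \<noteq> k"
    proof (rule ccontr)
      assume "\<not> ?thesis"
      then have fx: "p k = k" if "k < n" "k \<noteq> i" for k using that by blast
      have out: "p k = k" if "\<not> k < n" for k using p(1) that by (simp add: permutes_def)
      have "inj p" using p(1) permutes_inj by blast
      then have "p i = i" using fx out by (metis inj_eq)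
      then show False using fx out p(2) by (metis eq_id_iff)
    qed
    then obtain k where k: "k < n" "k \<noteq> i" "p k \<noteq> k" by blast
    then have "A k (p k) = 0" using assms(2)[of k "p k"] permutes_in_image[OF p(1), of k] by auto
    with k show ?thesis by (intro prod_zero) auto
  qed
  then have "ldet n A = (\<Sum>p \<in> {id}. of_int (sign p) * (\<Prod>k = 0..<n. A k (p k)))"
    unfolding ldet_expand
    by (intro sum.mono_neutral_right) (auto simp: finite_permutations permutes_id)
  also have "\<dots> = (\<Prod>k = 0..<n. A k k)" by simp
  also have "\<dots> = A i i * (\<Prod>k \<in> {0..<n} - {i}. A k k)" using assms(1) by (intro prod.remove) auto
  also have "(\<Prod>k \<in> {0..<n} - {i}. A k k) = 1" using assms(2) by (intro prod.neutral) auto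
  finally show ?thesis by simp
qed

lemma ldet_one: "ldet n (\<lambda>i j. if i = j then 1 else 0) = 1"
proof (cases "n = 0")
  case True
  then show ?thesis by (simp add: ldet_expand)
next
  case False
  then show ?thesis using ldet_row[of 0 n "\<lambda>i j. if i = j then 1 else 0"] by simp
qed

lemma ldet_scale: "ldet n (\<lambda>i j. c * A i j) = c ^ n * ldet n A"
  unfolding ldet_expand by (simp add: prod.distrib sum_distrib_left algebra_simps)

lemma ldet_zero_kernel:
  assumes "ldet n A = 0"
  obtains v i where "i < n" "v i \<noteq> 0" "\<And>i. i < n \<Longrightarrow> (\<Sum>k<n. A i k * v k) = 0"
proof -
  let ?M = "Matrix.mat n n (\<lambda>(i, j). A i j)"
  obtain v where v: "v \<in> carrier_vec n" "v \<noteq> 0\<^sub>v n" "?M *\<^sub>v v = 0\<^sub>v n"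
    using assms det_0_iff_vec_prod_zero[of ?M n] by (auto simp: ldet_def)
  then obtain i where i: "i < n" "vec_index v i \<noteq> 0" by fastforce
  have "(\<Sum>k<n. A i k * (vec_index v k)) = 0" if "i < n" for i
  proof -
    have "vec_index (?M *\<^sub>v v) i = 0" using v(3) that by simp
    then show ?thesis using that v(1) by (simp add: scalar_prod_def atLeast0LessThan)
  qed
  with i that[of i "vec_index v"] show ?thesis by blast
qed

hide_const (open) Matrix.mat Matrix.row Matrix.col Matrix.vec Determinant.det Matrix.vec_index

lemma ldet_tendsto:
  assumes "\<And>i j. i < n \<Longrightarrow> j < n \<Longrightarrow> (\<lambda>m. A m i j) \<longlonglongrightarrow> B i j"
  shows "(\<lambda>m. ldet n (A m)) \<longlonglongrightarrow> ldet n B"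
  unfolding ldet_expand
proof (intro tendsto_sum tendsto_mult tendsto_prod tendsto_const)
  fix p i assume "p \<in> {p. p permutes {0..<n}}" "i \<in> {0..<n}"
  then show "(\<lambda>m. A m i (p i)) \<longlonglongrightarrow> B i (p i)"
    using permutes_in_image[of p "{0..<n}" i] by (intro assms) auto
qed

lemma ldet_polynomial:
  assumes "\<And>i j. i < n \<Longrightarrow> j < n \<Longrightarrow> real_polynomial_function (\<lambda>x. A x i j)"
  shows "real_polynomial_function (\<lambda>x. ldet n (A x))"
  unfolding ldet_expand
proof (rule real_polynomial_function_sum, simp add: finite_permutations,
    rule real_polynomial_function.intros(4), rule real_polynomial_function.intros(2),
    rule real_polynomial_function_prod)
  fix p i assume "p \<in> {p. p permutes {0..<n}}" "i \<in> {0..<n}"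
  then show "real_polynomial_function (\<lambda>x. A x i (p i))"
    using permutes_in_image[of p "{0..<n}" i] by (intro assms) auto
qed (auto simp: finite_permutations)

subsection \<open>Finite-dimensional spaces of real functions\<close>

text \<open>Pointwise operations make \<open>span\<close>, \<open>dim\<close> and
  \<open>subspace\<close> available for functions on an arbitrary set of points.\<close>

instantiation "fun" :: (type, real_vector) real_vector
begin

definition scaleR_fun :: "real \<Rightarrow> ('a \<Rightarrow> 'b) \<Rightarrow> 'a \<Rightarrow> 'b" where
  "scaleR_fun c f = (\<lambda>x. c *\<^sub>R f x)"

instance
  by standard (auto simp: scaleR_fun_def fun_eq_iff scaleR_add_right scaleR_add_left)

end

lemma scaleR_fun_apply [simp]: "(c *\<^sub>R f) x = c *\<^sub>R f x"
  by (simp add: scaleR_fun_def)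

lemma sum_fun_apply: "(\<Sum>i\<in>I. f i) x = (\<Sum>i\<in>I. f i x)"
  by (induction I rule: infinite_finite_induct) auto

definition fd :: "('x \<Rightarrow> real) set \<Rightarrow> bool" where
  "fd L \<longleftrightarrow> subspace L \<and> (\<exists>B. finite B \<and> L \<subseteq> span B)"

text \<open>
  A frame consists of points \<open>t i\<close> and the Lagrange basis \<open>e i\<close> of \<open>L\<close> dual to the evaluations at
  these points, so that evaluations serve as coordinates on \<open>L\<close>.
\<close>

definition frame :: "('x \<Rightarrow> real) set \<Rightarrow> nat \<Rightarrow> (nat \<Rightarrow> 'x) \<Rightarrow> (nat \<Rightarrow> 'x \<Rightarrow> real) \<Rightarrow> bool" where
  "frame L n t e \<longleftrightarrow> subspace L \<and> (\<forall>i<n. e i \<in> L)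
     \<and> (\<forall>i<n. \<forall>j<n. e i (t j) = (if i = j then 1 else 0))
     \<and> (\<forall>f\<in>L. \<forall>x. f x = (\<Sum>i<n. f (t i) * e i x))"

lemma frameD:
  assumes "frame L n t e"
  shows "subspace L" "\<And>i. i < n \<Longrightarrow> e i \<in> L"
    "\<And>i j. i < n \<Longrightarrow> j < n \<Longrightarrow> e i (t j) = (if i = j then 1 else 0)"
    "\<And>f x. f \<in> L \<Longrightarrow> f x = (\<Sum>i<n. f (t i) * e i x)"
  using assms unfolding frame_def by blast+

text \<open>Interpolation in Newton's manner: a new generator is replaced by its interpolation error
  at the old nodes, a point where this error is nonzero becomes the next node, and the old basis
  functions are corrected so as to vanish there.\<close>

lemma frame_exists_span:
  assumes "finite B"
  shows "\<exists>n t e. frame (span B :: ('x \<Rightarrow> real) set) n t e"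
  using assms
proof (induction B rule: finite_induct)
  case empty
  have "frame (span {} :: ('x \<Rightarrow> real) set) 0 undefined undefined"
    by (auto simp: frame_def subspace_def)
  then show ?case by blast
next
  case (insert b B)
  then obtain n t e where fr: "frame (span B) n t e" by blast
  have eB: "\<And>i. i < n \<Longrightarrow> e i \<in> span B"
    and del: "\<And>i j. i < n \<Longrightarrow> j < n \<Longrightarrow> e i (t j) = (if i = j then 1 else 0)"
    and rep: "\<And>f x. f \<in> span B \<Longrightarrow> f x = (\<Sum>i<n. f (t i) * e i x)"
    using frameD[OF fr] by blast+
  show ?case
  proof (cases "b \<in> span B")
    case True
    then show ?thesis using fr by (metis span_redundant)
  next
    case False
    define h where "h = b - (\<Sum>i<n. b (t i) *\<^sub>R e i)"
    have hx: "h x = b x - (\<Sum>i<n. b (t i) * e i x)" for x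
      by (simp add: h_def sum_fun_apply)
    have spB: "(\<Sum>i<n. b (t i) *\<^sub>R e i) \<in> span B" using eB by (intro span_sum span_scale) auto
    have "h \<noteq> 0" using False spB by (auto simp: h_def)
    then obtain s where s: "h s \<noteq> 0" by (auto simp: fun_eq_iff)
    have ht: "h (t j) = 0" if "j < n" for j
      using that by (simp add: hx del if_distrib sum.delta cong: if_cong)
    have mono: "span B \<subseteq> span (insert b B)" by (rule span_mono) auto
    have hsp: "h \<in> span (insert b B)" unfolding h_def
      using spB mono by (intro span_diff) (auto intro: span_base)
    define t' where "t' = t(n := s)"
    define e' where "e' = (\<lambda>i. if i < n then e i - (e i s / h s) *\<^sub>R h else (1 / h s) *\<^sub>R h)"
    have e'1: "e' i x = e i x - e i s / h s * h x" if "i < n" for i x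
      using that by (simp add: e'_def)
    have e'2: "e' n x = h x / h s" for x by (simp add: e'_def)
    have e'in: "e' i \<in> span (insert b B)" for i
    proof (cases "i < n")
      case True
      then have "e i \<in> span (insert b B)" using eB mono by blast
      then show ?thesis using True hsp by (simp add: e'_def span_diff span_scale)
    next
      case False
      then show ?thesis using hsp by (simp add: e'_def span_scale)
    qed
    have del': "e' i (t' j) = (if i = j then 1 else 0)" if "i < Suc n" "j < Suc n" for i j
      using that s by (auto simp: e'1 e'2 t'_def del ht less_Suc_eq)
    have rep': "f x = (\<Sum>i<Suc n. f (t' i) * e' i x)" if f: "f \<in> span (insert b B)" for f x
    proof -
      obtain c where c: "f - c *\<^sub>R b \<in> span B" using f by (auto simp: span_breakdown_eq)
      \<comment> \<open>\<open>u\<close> is \<open>f\<close> with its multiple of \<open>b\<close>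
        replaced by the interpolant of \<open>b\<close>. Thus \<open>f\<close> is \<open>u\<close>
        plus \<open>c\<close> times \<open>h\<close>, and at the old nodes \<open>f\<close> and
        \<open>u\<close> agree.\<close>
      define u where "u = f - c *\<^sub>R b + c *\<^sub>R (\<Sum>i<n. b (t i) *\<^sub>R e i)"
      have u: "u \<in> span B" unfolding u_def using c spB by (intro span_add span_scale)
      have fu: "f x = u x + c * h x" for x
        by (simp add: u_def hx sum_fun_apply algebra_simps)
      have "(\<Sum>i<Suc n. f (t' i) * e' i x) = (\<Sum>i<n. u (t i) * (e i x - e i s / h s * h x)) + f s * h x / h s"
        by (simp add: t'_def e'1 e'2 fu ht)
      also have "\<dots> = (\<Sum>i<n. u (t i) * e i x) - (\<Sum>i<n. u (t i) * e i s) * h x / h s + f s * h x / h s"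
        by (simp add: algebra_simps sum_subtractf sum_distrib_left sum_divide_distrib)
      also have "\<dots> = u x - u s * h x / h s + (u s + c * h s) * h x / h s"
        using rep[OF u, of x] rep[OF u, of s] fu by simp
      also have "\<dots> = f x" using s by (simp add: fu field_simps)
      finally show ?thesis by simp
    qed
    have "frame (span (insert b B)) (Suc n) t' e'"
      unfolding frame_def using e'in del' rep' by (auto simp: subspace_span)
    then show ?thesis by blast
  qed
qed

lemma frame_basis:
  assumes "frame L n t e"
  shows "L = span (e ` {..<n})" "independent (e ` {..<n})" "card (e ` {..<n}) = n"
proof -
  have sub: "subspace L" and eL: "\<And>i. i < n \<Longrightarrow> e i \<in> L"
    and del: "\<And>i j. i < n \<Longrightarrow> j < n \<Longrightarrow> e i (t j) = (if i = j then 1 else 0)"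
    and rep: "\<And>f x. f \<in> L \<Longrightarrow> f x = (\<Sum>i<n. f (t i) * e i x)"
    using frameD[OF assms] by blast+
  have "f \<in> span (e ` {..<n})" if "f \<in> L" for f
  proof -
    have "f = (\<Sum>i<n. f (t i) *\<^sub>R e i)" 
      by (rule ext) (simp only: sum_fun_apply scaleR_fun_apply real_scaleR_def, rule rep[OF that])
    also have "\<dots> \<in> span (e ` {..<n})" by (intro span_sum span_scale span_base) auto
    finally show ?thesis .
  qed
  moreover have "span (e ` {..<n}) \<subseteq> L" using eL by (intro span_minimal sub) auto
  ultimately show "L = span (e ` {..<n})" by blast
  have inj: "inj_on e {..<n}"
  proof (rule inj_onI)
    fix i j assume ij: "i \<in> {..<n}" "j \<in> {..<n}" "e i = e j"
    then have "e i (t i) = e j (t i)" by simp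
    then show "i = j" using ij(1,2) del[of i i] del[of j i] by (metis lessThan_iff zero_neq_one)
  qed
  then show "card (e ` {..<n}) = n" by (simp add: card_image)
  show "independent (e ` {..<n})"
  proof (rule independent_if_scalars_zero)
    fix c f assume c: "(\<Sum>f\<in>e ` {..<n}. c f *\<^sub>R f) = 0" and f: "f \<in> e ` {..<n}"
    then obtain j where j: "j < n" "f = e j" by auto
    have "(\<Sum>i<n. c (e i) *\<^sub>R e i) = 0" using c inj by (simp add: sum.reindex)
    then have "(\<Sum>i<n. c (e i) *\<^sub>R e i) (t j) = 0" by simp
    then have "(\<Sum>i<n. c (e i) * e i (t j)) = 0" by (simp add: sum_fun_apply)
    then show "c f = 0" using j by (simp add: del if_distrib sum.delta' cong: if_cong)
  qed auto
qed

lemma fd_span: "finite B \<Longrightarrow> fd (span B)"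
  by (auto simp: fd_def subspace_span)

lemma frame_dim: "frame L n t e \<Longrightarrow> dim L = n"
  using frame_basis[of L n t e] by (metis dim_span_eq_card_independent)

lemma fd_subspace: "fd L' \<Longrightarrow> L \<subseteq> L' \<Longrightarrow> subspace L \<Longrightarrow> fd L"
  by (meson fd_def subset_trans)

lemma fd_basis:
  assumes "fd L"
  obtains B where "finite B" "independent B" "L = span B" "card B = dim L"
proof -
  obtain C where C: "finite C" "L \<subseteq> span C" "subspace L" using assms by (auto simp: fd_def)
  obtain B where B: "B \<subseteq> L" "independent B" "L \<subseteq> span B" "card B = dim L"
    using real_vector.basis_exists[of L] by metis
  have "finite B" using real_vector.independent_span_bound[OF C(1) B(2)] B(1) C(2) by blast
  moreover have "L = span B" using B C(3) by (metis span_minimal subset_antisym)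
  ultimately show ?thesis using that B by blast
qed

lemma fd_frame:
  assumes "fd L"
  obtains t e where "frame L (dim L) t e"
  using fd_basis[OF assms] frame_exists_span frame_dim by metis

lemma fd_dim_eq:
  assumes "fd L'" "L \<subseteq> L'" "subspace L" "dim L' \<le> dim L"
  shows "L = L'"
proof (rule ccontr)
  assume "L \<noteq> L'"
  then obtain f where f: "f \<in> L'" "f \<notin> L" using assms(2) by blast
  obtain B where B: "finite B" "independent B" "L = span B" "card B = dim L"
    using fd_basis[OF fd_subspace[OF assms(1-3)]] by metis
  obtain C where C: "finite C" "L' = span C" "card C = dim L'" using fd_basis[OF assms(1)] by metis
  have "independent (insert f B)" using B f by (simp add: independent_insertI)
  moreover have "insert f B \<subseteq> span C"
    using f assms(2) B C span_superset by (metis insert_subset subset_trans)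
  ultimately have "card (insert f B) \<le> card C" using real_vector.independent_span_bound C(1) by blast
  moreover have "f \<notin> B" using f B by (auto intro: span_base)
  ultimately show False using B C assms(4) by simp
qed

lemma linear_comp_op: "linear (\<lambda>f x. f (h x) :: real)"
  by (rule linearI) (auto simp: fun_eq_iff)

lemma span_comp:
  assumes "\<And>f. f \<in> B \<Longrightarrow> (\<lambda>x. f (h x)) \<in> span C" and "f \<in> span B"
  shows "(\<lambda>x. f (h x) :: real) \<in> span C"
proof -
  have "(\<lambda>f x. f (h x)) ` span B = span ((\<lambda>f x. f (h x)) ` B)"
    by (rule linear_span_image[OF linear_comp_op, symmetric])
  also have "\<dots> \<subseteq> span C" using assms(1) by (intro span_minimal subspace_span) auto
  finally show ?thesis using assms(2) by blast
qed

lemma linear_times_left: "linear (\<lambda>f x. f x * g x :: real)"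
  by (rule linearI) (auto simp: fun_eq_iff algebra_simps)

lemma span_mult:
  assumes "f \<in> span A" "g \<in> span B"
  shows "(\<lambda>x. f x * g x :: real) \<in> span {\<lambda>x. a x * b x | a b. a \<in> A \<and> b \<in> B}"
    (is "_ \<in> span ?C")
proof -
  have 1: "(\<lambda>x. a x * g x) \<in> span ?C" if "a \<in> A" for a
  proof -
    have "(\<lambda>h x. h x * a x) ` span B = span ((\<lambda>h x. h x * a x) ` B)"
      by (rule linear_span_image[OF linear_times_left, symmetric])
    also have "\<dots> \<subseteq> span ?C"
      using that by (intro span_mono) (force simp: mult.commute)
    finally show ?thesis using assms(2) by (force simp: mult.commute)
  qed
  have "(\<lambda>h x. h x * g x) ` span A = span ((\<lambda>h x. h x * g x) ` A)"
    by (rule linear_span_image[OF linear_times_left, symmetric])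
  also have "\<dots> \<subseteq> span ?C" using 1 by (intro span_minimal subspace_span) auto
  finally show ?thesis using assms(1) by blast
qed

hide_fact (open) Matrix.vec_eq_iff Matrix.row_def Matrix.mat_def Matrix.col_def

subsection \<open>Polynomial functions on the special linear group\<close>

lemma poly_curve_bounded_const:
  assumes p: "real_polynomial_function (p :: real \<Rightarrow> real)" and b: "\<And>s. \<bar>p s\<bar> \<le> K"
  shows "p s = p 0"
proof -
  obtain a n where p_eq: "p = (\<lambda>x. \<Sum>i\<le>n. a i * x ^ i)"
    using p real_polynomial_function_iff_sum by blast
  define q where "q = (\<Sum>i\<le>n. monom (a i) i)"
  have q: "poly q = p" by (auto simp: q_def p_eq poly_sum poly_monom)
  have "degree q = 0"
  proof (rule ccontr)
    assume "degree q \<noteq> 0"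
    then have "degree q > 0" by simp
    then have "filterlim (poly q) at_infinity at_infinity"
      by (rule filterlim_poly_at_infinity)
    then have "filterlim (poly q) at_infinity at_top"
      by (metis filterlim_mono at_top_le_at_infinity order_refl)
    then have "filterlim (\<lambda>x. norm (poly q x)) at_top at_top"
      by (rule filterlim_at_infinity_imp_norm_at_top)
    then have "eventually (\<lambda>x. norm (poly q x) \<ge> K + 1) at_top"
      unfolding filterlim_at_top by blast
    then have "\<exists>x. norm (poly q x) \<ge> K + 1"
      using eventually_happens'[of "at_top :: real filter"] trivial_limit_at_top_linorder by blast
    then obtain x where x: "norm (poly q x) \<ge> K + 1" ..
    have "norm (poly q x) \<le> K" using b[of x] unfolding q real_norm_def .
    with x show False by linarith
  qed
  then obtain c where "q = [:c:]" using degree_0_id by metis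
  then show ?thesis unfolding q[symmetric] by simp
qed

text \<open>Irreducibility of the real line; it is carried over to the special linear group along
  curves.\<close>

lemma poly_curve_common_nonzero:
  assumes p: "real_polynomial_function (p :: real \<Rightarrow> real)" and q: "real_polynomial_function q"
    and "p s \<noteq> 0" "q t \<noteq> 0"
  shows "\<exists>r. p r \<noteq> 0 \<and> q r \<noteq> 0"
proof -
  have conv: "\<exists>P. poly P = p" if p: "real_polynomial_function p" for p :: "real \<Rightarrow> real"
  proof -
    obtain a n where "p = (\<lambda>x. \<Sum>i\<le>n. a i * x ^ i)"
      using p real_polynomial_function_iff_sum by blast
    then have "poly (\<Sum>i\<le>n. monom (a i) i) = p" by (auto simp: poly_sum poly_monom)
    then show ?thesis by blast
  qed
  obtain P Q where PQ: "poly P = p" "poly Q = q" using conv p q by blast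
  then have "P \<noteq> 0" "Q \<noteq> 0" using assms(3,4) by auto
  then have "P * Q \<noteq> 0" by simp
  then have "poly (P * Q) \<noteq> poly 0" using poly_eq_poly_eq_iff by blast
  then obtain r where "poly (P * Q) r \<noteq> 0" by (auto simp: fun_eq_iff)
  then show ?thesis using PQ by (intro exI[of _ r]) auto
qed

section \<open>Generation of the special linear group by transvections\<close>

lemma linear_matrix_mult: "linear (\<lambda>x. A ** x ** (B :: real^'d^'d))" for A :: "real^'d^'d"
  by (rule linearI)
    (simp_all add: vec_eq_iff matrix_matrix_mult_def sum.distrib sum_distrib_left algebra_simps)

definition transv :: "'d \<Rightarrow> 'd \<Rightarrow> real \<Rightarrow> real^'d^'d" where
  "transv m n s = (\<chi> i j. if i = m \<and> j = n then s else if i = j then 1 else 0)"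

lemma transv_mult_nth:
  assumes "m \<noteq> n"
  shows "(transv m n s ** A) $ i $ j = (if i = m then A $ m $ j + s * A $ n $ j else A $ i $ j)"
proof (cases "i = m")
  case True
  have "(\<Sum>k\<in>UNIV. (if m = m \<and> k = n then s else if m = k then 1 else 0) * A $ k $ j)
     = (\<Sum>k\<in>UNIV. (if k = n then s * A $ k $ j else 0) + (if k = m then A $ k $ j else 0))"
    using assms by (intro sum.cong) auto
  then show ?thesis using True by (simp add: transv_def matrix_matrix_mult_def sum.distrib)
next
  case False
  have "(\<Sum>k\<in>UNIV. (if i = m \<and> k = n then s else if i = k then 1 else 0) * A $ k $ j)
     = (\<Sum>k\<in>UNIV. (if k = i then A $ k $ j else 0))"
    using False by (intro sum.cong) auto
  then show ?thesis using False by (simp add: transv_def matrix_matrix_mult_def)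
qed

lemma transv_zero: "m \<noteq> n \<Longrightarrow> transv m n 0 = mat 1"
  by (auto simp: transv_def mat_def vec_eq_iff)

lemma transv_add: "m \<noteq> n \<Longrightarrow> transv m n s ** transv m n t = transv m n (s + t)"
  by (auto simp: vec_eq_iff transv_mult_nth) (auto simp: transv_def)

lemma det_transv:
  assumes "m \<noteq> n"
  shows "det (transv m n s) = 1"
proof -
  have "transv m n s = (\<chi> k. if k = m then row m (mat 1) + s *s row n (mat 1) else row k (mat 1))"
    using assms by (auto simp: transv_def vec_eq_iff row_def mat_def)
  then show ?thesis using det_row_operation[OF assms, of "mat 1" s] by simp
qed

text \<open>The curve is affine in \<open>s\<close>, since two-sided multiplication is
  linear.\<close>

lemma polynomial_transv_curve:
  fixes A B :: "real^'d^'d" and p :: "real^'d^'d \<Rightarrow> real"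
  assumes "real_polynomial_function p"
  shows "real_polynomial_function (\<lambda>s. p (A ** transv m n s ** B))"
proof -
  define E :: "real^'d^'d" where "E = (\<chi> i j. if i = m \<and> j = n then 1 else 0)"
  define T0 :: "real^'d^'d" where "T0 = (\<chi> i j. if i = m \<and> j = n then 0 else if i = j then 1 else 0)"
  have "transv m n s = T0 + s *\<^sub>R E" for s
    by (auto simp: transv_def T0_def E_def vec_eq_iff)
  then have "(\<lambda>s. A ** transv m n s ** B) = (\<lambda>s. A ** T0 ** B + s *\<^sub>R (A ** E ** B))"
    using linear_add[OF linear_matrix_mult[where A = A and B = B]] linear_scale[OF linear_matrix_mult[where A = A and B = B]]
    by (simp add: fun_eq_iff)
  moreover have "polynomial_function (\<lambda>s. A ** T0 ** B + s *\<^sub>R (A ** E ** B))"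
    by (intro polynomial_function_add polynomial_function_const polynomial_function_bounded_linear
        bounded_linear_scaleR_left)
  ultimately have "polynomial_function (\<lambda>s. A ** transv m n s ** B)" by simp
  from real_polynomial_function_compose[OF this assms] show ?thesis by (simp add: o_def)
qed

text \<open>Products of transvections, which will turn out to exhaust the special linear group.\<close>

inductive_set elem :: "(real^'d^'d) set" where
  one: "mat 1 \<in> elem"
| step: "A \<in> elem \<Longrightarrow> m \<noteq> n \<Longrightarrow> transv m n s ** A \<in> elem"

lemma elem_mult: "A \<in> elem \<Longrightarrow> B \<in> elem \<Longrightarrow> A ** B \<in> elem"
  by (induction A rule: elem.induct) (auto simp: matrix_mul_assoc[symmetric] intro: elem.step)

lemma elem_transv: "m \<noteq> n \<Longrightarrow> transv m n s \<in> elem"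
  using elem.step[OF elem.one] by (metis matrix_mul_rid)

definition dg :: "('d \<Rightarrow> real) \<Rightarrow> real^'d^'d" where
  "dg c = (\<chi> i j. if i = j then c i else 0)"

lemma dg_mult_nth: "(dg c ** A) $ i $ j = c i * A $ i $ j"
proof -
  have "(\<Sum>k\<in>UNIV. (if i = k then c i else 0) * A $ k $ j) = (\<Sum>k\<in>UNIV. if k = i then c i * A $ k $ j else 0)"
    by (intro sum.cong) auto
  then show ?thesis by (simp add: dg_def matrix_matrix_mult_def)
qed

lemma dg_transv:
  assumes "m \<noteq> n" "\<And>i. c i \<noteq> 0"
  shows "dg c ** transv m n s = transv m n (s * c m / c n) ** dg c"
  unfolding vec_eq_iff dg_mult_nth transv_mult_nth[OF assms(1)]
  using assms by (simp add: transv_def dg_def)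

text \<open>Invertible diagonal matrices normalise the products of transvections, which lets
  diagonal factors be collected on the right.\<close>

lemma dg_elem:
  assumes "A \<in> elem" "\<And>i. c i \<noteq> 0"
  shows "\<exists>B\<in>elem. dg c ** A = B ** dg c"
  using assms(1)
proof (induction A rule: elem.induct)
  case one
  then show ?case by (intro bexI[of _ "mat 1"]) (auto intro: elem.one)
next
  case (step A m n s)
  then obtain B where B: "B \<in> elem" "dg c ** A = B ** dg c" by blast
  have "dg c ** (transv m n s ** A) = transv m n (s * c m / c n) ** B ** dg c"
    by (simp only: matrix_mul_assoc dg_transv[where c = c, OF step(2) assms(2)])
      (simp only: matrix_mul_assoc[symmetric] B(2))
  then show ?case using elem.step[OF B(1) step(2)] by blast
qed

lemma dg_dg: "dg c ** dg d = dg (\<lambda>i. c i * d i)"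
  unfolding vec_eq_iff dg_mult_nth by (simp add: dg_def)

lemma det_dg: "det (dg c) = (\<Prod>i\<in>UNIV. c i)"
  unfolding dg_def by (subst det_diagonal) auto

text \<open>Steinberg's element for the coordinates \<open>m\<close> and \<open>n\<close>: for
  \<open>a \<noteq> 0\<close> and \<open>m \<noteq> n\<close> it is a monomial matrix exchanging the
  two coordinates with factors \<open>a\<close> and \<open>- 1 / a\<close>.\<close>

definition weyl :: "'d::finite \<Rightarrow> 'd \<Rightarrow> real \<Rightarrow> real^'d^'d" where
  "weyl m n a = transv m n a ** (transv n m (- 1 / a) ** transv m n a)"

lemma elem_weyl: "m \<noteq> n \<Longrightarrow> weyl m n a \<in> elem"
  unfolding weyl_def by (intro elem_mult elem_transv) auto

lemma weyl_mult_nth: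
  assumes "m \<noteq> n" "a \<noteq> 0"
  shows "(weyl m n a ** C) $ i $ j
    = (if i = m then a * C $ n $ j else if i = n then - C $ m $ j / a else C $ i $ j)"
proof -
  note 1 = transv_mult_nth[OF assms(1)] and 2 = transv_mult_nth[OF assms(1)[symmetric]]
  have w: "weyl m n a ** C = transv m n a ** (transv n m (- 1 / a) ** (transv m n a ** C))"
    unfolding weyl_def by (simp only: matrix_mul_assoc)
  show ?thesis
    unfolding w 1 2 using assms by (cases "i = m"; cases "i = n") (simp_all add: field_simps)
qed

text \<open>Steinberg's formula: in \<open>weyl m n a\<close> times \<open>weyl m n (- 1)\<close>
  the two exchanges of coordinates cancel and a diagonal matrix remains.\<close>

lemma elem_hyperbolic:
  fixes m n :: "'d::finite"
  assumes "m \<noteq> n" "a \<noteq> 0"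
  shows "dg (\<lambda>i. if i = m then a else if i = n then 1 / a else 1) \<in> (elem :: (real^'d^'d) set)"
proof -
  have w: "(weyl m n (- 1) ** C) $ i $ j
    = (if i = m then - C $ n $ j else if i = n then C $ m $ j else C $ i $ j)" for C :: "real^'d^'d" and i j
    using weyl_mult_nth[OF assms(1), of "- 1" C i j] by simp
  have eq: "weyl m n a ** (weyl m n (- 1) ** mat 1)
      = (dg (\<lambda>i. if i = m then a else if i = n then 1 / a else 1) :: real^'d^'d)"
    unfolding vec_eq_iff weyl_mult_nth[OF assms] w using assms by (simp add: dg_def mat_def)
  then show ?thesis
    using elem_mult[OF elem_weyl[OF assms(1), of a] elem_weyl[OF assms(1), of "- 1"]] by simp
qed

lemma elem_dg:
  assumes "(\<Prod>i\<in>UNIV. c i) = 1"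
  shows "(dg c :: real^'d^'d) \<in> elem"
proof -
  have "\<And>c. (\<Prod>i\<in>UNIV. c i) = 1 \<Longrightarrow> (\<forall>i. i \<notin> S \<longrightarrow> c i = 1) \<Longrightarrow> (dg c :: real^'d^'d) \<in> elem"
    if "finite S" for S :: "'d set"
    using that
  proof (induction S rule: finite_induct)
    case empty
    then have "dg c = mat 1" by (auto simp: dg_def mat_def vec_eq_iff)
    then show ?case by (simp add: elem.one)
  next
    case (insert m S)
    show ?case
    proof (cases "\<exists>n. n \<in> S")
      case False
      then have "(\<Prod>i\<in>UNIV. c i) = c m"
        using insert.prems by (subst prod.remove[of _ m]) (auto intro!: prod.neutral)
      then have "dg c = mat 1" using insert.prems False by (auto simp: dg_def mat_def vec_eq_iff)
      then show ?thesis by (simp add: elem.one)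
    next
      case True
      then obtain n where n: "n \<in> S" "m \<noteq> n" using insert by blast
      have nz: "c i \<noteq> 0" for i using insert.prems(1) prod_zero[of UNIV c] by force
      \<comment> \<open>The entry at \<open>m\<close> is moved into a hyperbolic factor, which
        compensates at \<open>n\<close>. The remaining \<open>d\<close> is 1 at \<open>m\<close> and
        again has product 1, so the induction hypothesis applies.\<close>
      define h where "h = (\<lambda>i. if i = m then c m else if i = n then 1 / c m else 1)"
      define d where "d = (\<lambda>i. if i = m then 1 else if i = n then c m * c n else c i)"
      have hd: "c = (\<lambda>i. h i * d i)" using n nz[of m] by (auto simp: h_def d_def fun_eq_iff)
      have h: "dg h \<in> elem" unfolding h_def by (rule elem_hyperbolic[OF n(2) nz])
      have "det (dg h :: real^'d^'d) = 1"
        unfolding det_dg h_def using n nz[of m]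
        by (subst prod.remove[of _ m], simp, simp, subst prod.remove[of _ n]) (auto intro!: prod.neutral)
      then have "prod h UNIV = 1" by (simp add: det_dg)
      then have "prod d UNIV = 1" using insert.prems(1) unfolding hd by (simp add: prod.distrib)
      then have "dg d \<in> elem" using insert.IH[of d] insert.prems(2) n by (auto simp: d_def)
      then show ?thesis using elem_mult[OF h] dg_dg hd by metis
    qed
  qed
  from this[of UNIV] assms show ?thesis by simp
qed

text \<open>Gaussian elimination, as an induction over elementary matrices. The diagonal matrix is
  kept as a separate right factor until the determinant is known to be 1.\<close>

lemma invertible_elem_dg:
  fixes A :: "real^'d^'d"
  shows "det A \<noteq> 0 \<longrightarrow> (\<exists>B c. B \<in> elem \<and> A = B ** dg c)"
proof (induction A rule: induct_matrix_elementary)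
  case (1 A B)
  show ?case
  proof
    assume "det (A ** B) \<noteq> 0"
    then have "det A \<noteq> 0" "det B \<noteq> 0" by (auto simp: det_mul)
    then obtain A' c B' d where h: "A' \<in> elem" "A = A' ** dg c" "B' \<in> elem" "B = B' ** dg d" using 1 by blast
    have "c i \<noteq> 0" for i
      using \<open>det A \<noteq> 0\<close> h(2) by (auto simp: det_mul det_dg)
    then obtain B'' where B'': "B'' \<in> elem" "dg c ** B' = B'' ** dg c" using dg_elem[OF h(3)] by blast
    have "A ** B = (A' ** B'') ** dg (\<lambda>i. c i * d i)"
      using h B'' by (metis matrix_mul_assoc dg_dg)
    then show "\<exists>B' c. B' \<in> elem \<and> A ** B = B' ** dg c" using elem_mult[OF h(1) B''(1)] by blast
  qed
next
  case (2 A i)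
  then show ?case by (metis det_zero_row(2) row_def vec_lambda_eta)
next
  case (3 A)
  then have "A = mat 1 ** dg (\<lambda>i. A $ i $ i)" by (auto simp: dg_def vec_eq_iff)
  then show ?case using elem.one by blast
next
  case (4 m n)
  have "(\<chi> i j. mat 1 $ i $ Transposition.transpose m n j :: real^'d^'d)
      = weyl m n 1 ** dg (\<lambda>i. if i = m then - 1 else 1)"
    using 4 unfolding vec_eq_iff weyl_mult_nth[OF 4, of 1, simplified]
    by (auto simp: dg_def mat_def Transposition.transpose_def)
  then show ?case using elem_weyl[OF 4] by blast
next
  case (5 m n c)
  have "(\<chi> i j. if i = m \<and> j = n then c else of_bool (i = j)) = transv m n c ** dg (\<lambda>_. 1)"
    using 5 by (auto simp: vec_eq_iff transv_mult_nth dg_def)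
  then show ?case using elem_transv[OF 5] by blast
qed

lemma SL_elem:
  fixes A :: "real^'d^'d"
  assumes "det A = 1"
  shows "A \<in> elem"
proof -
  obtain B c where B: "B \<in> elem" "A = B ** dg c" using invertible_elem_dg[of A] assms by auto
  have "det B = 1" using B(1) by (induction B rule: elem.induct) (auto simp: det_mul det_transv)
  then have "(\<Prod>i\<in>UNIV. c i) = 1" using assms B by (simp add: det_mul det_dg)
  then show ?thesis using B elem_mult elem_dg by blast
qed

text \<open>Multiplying by one transvection at a time turns claims about the group into claims about
  polynomials in one real parameter.\<close>

lemma SL_induct [consumes 1, case_names one step]:
  fixes A :: "real^'d^'d"
  assumes "det A = 1" "P (mat 1)"
    and "\<And>A m n s. det A = 1 \<Longrightarrow> P A \<Longrightarrow> m \<noteq> n \<Longrightarrow> P (transv m n s ** A)"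
  shows "P A"
proof -
  have "A \<in> elem \<Longrightarrow> det A = 1 \<and> P A" for A
    by (induction A rule: elem.induct) (auto simp: det_mul det_transv assms)
  then show ?thesis using SL_elem[OF assms(1)] by blast
qed

lemma polynomial_lmult:
  fixes A B :: "real^'d^'d" and p :: "real^'d^'d \<Rightarrow> real"
  assumes "real_polynomial_function p"
  shows "real_polynomial_function (\<lambda>x. p (A ** x ** B))"
proof -
  have "bounded_linear (\<lambda>x. A ** x ** B)"
    using linear_matrix_mult[of A B] by (simp add: linear_conv_bounded_linear)
  then show ?thesis
    using real_polynomial_function_compose[OF polynomial_function_bounded_linear assms] by (simp add: o_def)
qed

text \<open>The special linear group is irreducible in the Zariski topology: two points can be joined to
  one another through finitely many polynomial curves.\<close>

lemma SL_irreducible: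
  fixes p q :: "real^'d^'d \<Rightarrow> real"
  assumes p: "real_polynomial_function p" and q: "real_polynomial_function q"
    and a: "det a = 1" "p a \<noteq> 0" and b: "det b = 1" "q b \<noteq> 0"
  shows "\<exists>c. det c = 1 \<and> p c \<noteq> 0 \<and> q c \<noteq> 0"
proof -
  have *: "\<exists>c. det c = 1 \<and> p (c ** a) \<noteq> 0 \<and> q (c ** a) \<noteq> 0"
    if "det x = 1" "real_polynomial_function p" "real_polynomial_function q" "p a \<noteq> 0" "q (x ** a) \<noteq> 0" for x p q
    using that
  proof (induction x arbitrary: p q rule: SL_induct)
    case one
    then show ?case by (intro exI[of _ "mat 1"]) auto
  next
    case (step A m n s)
    \<comment> \<open>The first polynomial is nonzero at parameter 0, the second one at
      \<open>s\<close>. A common parameter \<open>r\<close> reduces the claim to the translates of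
      both by \<open>transv m n r\<close>, to which the induction hypothesis applies.\<close>
    have "\<exists>r. p (mat 1 ** transv m n r ** a) \<noteq> 0 \<and> q (mat 1 ** transv m n r ** (A ** a)) \<noteq> 0"
    proof (rule poly_curve_common_nonzero)
      show "p (mat 1 ** transv m n 0 ** a) \<noteq> 0" using step by (simp add: transv_zero)
      show "q (mat 1 ** transv m n s ** (A ** a)) \<noteq> 0" using step by (simp add: matrix_mul_assoc)
    qed (rule polynomial_transv_curve, rule step)+
    then obtain r where r: "p (transv m n r ** a) \<noteq> 0" "q (transv m n r ** (A ** a)) \<noteq> 0" by auto
    have "real_polynomial_function (\<lambda>x. p (transv m n r ** x))" "real_polynomial_function (\<lambda>x. q (transv m n r ** x))"
      using polynomial_lmult[OF step(4), of "transv m n r" "mat 1"]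
        polynomial_lmult[OF step(5), of "transv m n r" "mat 1"] by simp_all
    from step.IH[OF this r] obtain c where
      "det c = 1" "p (transv m n r ** (c ** a)) \<noteq> 0" "q (transv m n r ** (c ** a)) \<noteq> 0" by blast
    then show ?case using step.hyps
      by (intro exI[of _ "transv m n r ** c"]) (auto simp: det_mul det_transv matrix_mul_assoc)
  qed
  have "invertible a" using a(1) by (simp add: invertible_det_nz)
  then obtain a' where a': "a' ** a = mat 1" unfolding invertible_def by blast
  define x where "x = b ** a'"
  have xa: "x ** a = b" unfolding x_def by (simp add: matrix_mul_assoc[symmetric] a')
  have "det x * det a = det b" unfolding xa[symmetric] by (simp add: det_mul)
  then have "det x = 1" using a b by simp
  then obtain c where "det c = 1" "p (c ** a) \<noteq> 0" "q (c ** a) \<noteq> 0" using *[of x p q] p q a(2) xa b(2) by auto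
  then show ?thesis using a by (intro exI[of _ "c ** a"]) (auto simp: det_mul)
qed

lemma SL_irreducible_finite:
  fixes p :: "'i \<Rightarrow> real^'d^'d \<Rightarrow> real"
  assumes "finite I" "\<And>i. i \<in> I \<Longrightarrow> real_polynomial_function (p i)"
    "\<And>i. i \<in> I \<Longrightarrow> \<exists>a. det a = 1 \<and> p i a \<noteq> 0"
  shows "\<exists>c. det c = 1 \<and> (\<Prod>i\<in>I. p i c) \<noteq> 0"
  using assms
proof (induction I rule: finite_induct)
  case empty
  then show ?case by (intro exI[of _ "mat 1"]) auto
next
  case (insert i I)
  then obtain c a where c: "det c = 1" "(\<Prod>i\<in>I. p i c) \<noteq> 0" and a: "det a = 1" "p i a \<noteq> 0"
    by (metis insertCI)
  have "real_polynomial_function (\<lambda>c. \<Prod>i\<in>I. p i c)" using insert by auto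
  then obtain x where "det x = 1" "p i x \<noteq> 0" "(\<Prod>i\<in>I. p i x) \<noteq> 0"
    using SL_irreducible[where p = "p i" and q = "\<lambda>c. \<Prod>i\<in>I. p i c"] insert.prems(1) a c by blast
  then show ?case using insert.hyps by auto
qed

section \<open>Finite-dimensional spaces of polynomial functions stable under translation\<close>

no_notation Matrix.vec_index (infixl "$" 100)

text \<open>Functions on the special linear group are extended by zero.\<close>

definition rs :: "(real^'d^'d \<Rightarrow> real) \<Rightarrow> real^'d^'d \<Rightarrow> real" where
  "rs f = (\<lambda>x. if det x = 1 then f x else 0)"

text \<open>Left translations provide the representation; right translations keep the functions
  \<open>\<lambda>g. f (g ** y)\<close> inside, from which the Pluecker coordinates are
  built.\<close>

definition polysp :: "(real^'d^'d \<Rightarrow> real) set \<Rightarrow> bool" where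
  "polysp P \<longleftrightarrow> fd P \<and> (\<forall>f\<in>P. \<exists>p. real_polynomial_function p \<and> f = rs p)
    \<and> (\<forall>f\<in>P. \<forall>a b. det a = 1 \<longrightarrow> det b = 1 \<longrightarrow> (\<lambda>x. f (a ** x ** b)) \<in> P)"

text \<open>Two-sided multiplication is linear in \<open>x\<close>, so it preserves the span of the
  linear forms. Sums are covered by unions of generating sets and products by pairwise products of
  generators, so stability propagates along the construction of \<open>p\<close>.\<close>

lemma biinvariant_span_exists:
  fixes p :: "real^'d^'d \<Rightarrow> real"
  assumes "real_polynomial_function p"
  shows "\<exists>B. finite B \<and> p \<in> span B \<and> (\<forall>f\<in>B. real_polynomial_function f)
    \<and> (\<forall>f\<in>B. \<forall>a b. (\<lambda>x. f (a ** x ** b)) \<in> span B)"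
  using assms
proof (induction p rule: real_polynomial_function.induct)
  case (linear f)
  define c where "c = (\<lambda>b (x :: real^'d^'d). x \<bullet> b)"
  define B where "B = c ` Basis"
  have lin: "g \<in> span B" if g: "linear g" for g
  proof -
    have "g = (\<Sum>b\<in>Basis. g b *\<^sub>R c b)"
    proof
      fix x :: "real^'d^'d"
      have "g x = g (\<Sum>b\<in>Basis. (x \<bullet> b) *\<^sub>R b)" by (simp only: euclidean_representation)
      also have "\<dots> = (\<Sum>b\<in>Basis. (x \<bullet> b) * g b)"
        by (simp add: linear_sum[OF g] linear_scale[OF g])
      finally show "g x = (\<Sum>b\<in>Basis. g b *\<^sub>R c b) x"
        by (simp add: sum_fun_apply c_def mult.commute)
    qed
    also have "\<dots> \<in> span B"
      unfolding B_def by (intro span_sum span_scale span_base) auto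
    finally show ?thesis .
  qed
  have cl: "linear (c b)" for b unfolding c_def
    by (intro bounded_linear.linear bounded_linear_inner_left)
  have "(\<lambda>x. f (a ** x ** b)) \<in> span B" if "f \<in> B" for f a b
    using that linear_compose[OF linear_matrix_mult[of a b] cl]
    by (intro lin) (auto simp: B_def o_def)
  moreover have "f \<in> span B" using linear by (intro lin bounded_linear.linear)
  moreover have "finite B" by (simp add: B_def)
  moreover have "real_polynomial_function f" if "f \<in> B" for f
    using that cl by (auto simp: B_def linear_conv_bounded_linear intro: real_polynomial_function.intros(1))
  ultimately show ?case by blast
next
  case (const c)
  have "(\<lambda>x. c) = c *\<^sub>R (\<lambda>x :: real^'d^'d. 1 :: real)" by auto
  then have "(\<lambda>x. c) \<in> span {\<lambda>x :: real^'d^'d. 1 :: real}"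
    by (metis insertI1 span_base span_scale)
  then show ?case
    by (intro exI[of _ "{\<lambda>x. 1}"]) (auto intro: span_base)
next
  case (add f g)
  then obtain B C where B: "finite B" "f \<in> span B" "\<forall>f\<in>B. real_polynomial_function f"
      "\<forall>f\<in>B. \<forall>a b. (\<lambda>x. f (a ** x ** b)) \<in> span B"
    and C: "finite C" "g \<in> span C" "\<forall>f\<in>C. real_polynomial_function f"
      "\<forall>f\<in>C. \<forall>a b. (\<lambda>x. f (a ** x ** b)) \<in> span C"
    by blast
  have mono: "span B \<subseteq> span (B \<union> C)" "span C \<subseteq> span (B \<union> C)" by (rule span_mono, simp)+
  then have "f + g \<in> span (B \<union> C)" using B(2) C(2) by (intro span_add) auto
  then have "(\<lambda>x. f x + g x) \<in> span (B \<union> C)" by (simp add: plus_fun_def)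
  moreover have "\<forall>f\<in>B \<union> C. \<forall>a b. (\<lambda>x. f (a ** x ** b)) \<in> span (B \<union> C)"
    using B(4) C(4) mono by blast
  ultimately show ?case using B C by (intro exI[of _ "B \<union> C"]) auto
next
  case (mult f g)
  then obtain B C where B: "finite B" "f \<in> span B" "\<forall>f\<in>B. real_polynomial_function f"
      "\<forall>f\<in>B. \<forall>a b. (\<lambda>x. f (a ** x ** b)) \<in> span B"
    and C: "finite C" "g \<in> span C" "\<forall>f\<in>C. real_polynomial_function f"
      "\<forall>f\<in>C. \<forall>a b. (\<lambda>x. f (a ** x ** b)) \<in> span C"
    by blast
  let ?D = "{\<lambda>x. u x * v x | u v. u \<in> B \<and> v \<in> C}"
  have "?D = (\<lambda>(u, v) x. u x * v x) ` (B \<times> C)" by auto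
  then have "finite ?D" using B(1) C(1) by simp
  moreover have "(\<lambda>x. f x * g x) \<in> span ?D" by (rule span_mult[OF B(2) C(2)])
  moreover have "real_polynomial_function h" if "h \<in> ?D" for h
    using that B(3) C(3) by auto
  moreover have "(\<lambda>x. h (a ** x ** b)) \<in> span ?D" if h: "h \<in> ?D" for h a b
  proof -
    obtain u v where uv: "h = (\<lambda>x. u x * v x)" "u \<in> B" "v \<in> C" using h by blast
    have "(\<lambda>x. u (a ** x ** b)) \<in> span B" "(\<lambda>x. v (a ** x ** b)) \<in> span C" using B(4) C(4) uv by auto
    from span_mult[OF this] show ?thesis by (simp add: uv)
  qed
  ultimately show ?case by (intro exI[of _ ?D]) auto
qed

lemma linear_rs: "linear rs"
  by (rule linearI) (auto simp: rs_def fun_eq_iff)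

lemma real_polynomial_function_span:
  assumes "f \<in> span B" "\<And>f. f \<in> B \<Longrightarrow> real_polynomial_function f"
  shows "real_polynomial_function f"
  using assms(1)
proof (induction f rule: span_induct_alt)
  case base
  then show ?case by (simp add: zero_fun_def real_polynomial_function.intros(2))
next
  case (step c x y)
  then have "real_polynomial_function (\<lambda>z. c * x z + y z)"
    using assms(2) by (intro real_polynomial_function.intros(2,3,4))
  then show ?case by (simp add: plus_fun_def scaleR_fun_def)
qed

lemma polysp_rs_span:
  assumes B: "finite B" "\<And>f. f \<in> B \<Longrightarrow> real_polynomial_function f"
    and inv: "\<And>f a b. f \<in> B \<Longrightarrow> (\<lambda>x. f (a ** x ** b)) \<in> span B"
  shows "polysp (rs ` span B)"
proof -
  have eq: "rs ` span B = span (rs ` B)" by (rule linear_span_image[OF linear_rs, symmetric])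
  have "fd (rs ` span B)" unfolding eq using B(1) by (intro fd_span) auto
  moreover have "(\<lambda>x. rs f (a ** x ** b)) \<in> rs ` span B" if "f \<in> span B" "det a = 1" "det b = 1" for f a b
  proof -
    have "(\<lambda>x. rs f (a ** x ** b)) = rs (\<lambda>x. f (a ** x ** b))"
      using that by (auto simp: rs_def det_mul)
    then show ?thesis using span_comp[where h = "\<lambda>x. a ** x ** b" and B = B and C = B, OF inv that(1)] by simp
  qed
  ultimately show ?thesis
    unfolding polysp_def using real_polynomial_function_span[OF _ B(2)] by blast
qed

text \<open>The constant function is adjoined so that the whole space has no common zero, which is
  where the induction on the codimension starts; it also accounts for empty products.\<close>

lemma polysp_exists:
  assumes "real_polynomial_function p"
  obtains P where "polysp P" "rs p \<in> P" "rs (\<lambda>_. 1) \<in> P"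
proof -
  obtain B where B: "finite B" "p \<in> span B" "\<forall>f\<in>B. real_polynomial_function f"
    "\<forall>f\<in>B. \<forall>a b. (\<lambda>x. f (a ** x ** b)) \<in> span B"
    using biinvariant_span_exists[OF assms] by blast
  let ?C = "insert (\<lambda>_. 1) B"
  have mono: "span B \<subseteq> span ?C" by (intro span_mono) auto
  have "polysp (rs ` span ?C)"
  proof (rule polysp_rs_span)
    fix f a b assume "f \<in> ?C"
    then show "(\<lambda>x. f (a ** x ** b)) \<in> span ?C"
      using B(4) mono by (auto intro: span_base)
  qed (use B in auto)
  moreover have "rs p \<in> rs ` span ?C" "rs (\<lambda>_. 1) \<in> rs ` span ?C"
    using B(2) mono by (auto intro: span_base)
  ultimately show ?thesis using that by blast
qed

lemma polyspD:
  assumes "polysp P"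
  shows "fd P"
    and "\<And>f. f \<in> P \<Longrightarrow> \<exists>p. real_polynomial_function p \<and> f = rs p"
    and "\<And>f a b. f \<in> P \<Longrightarrow> det a = 1 \<Longrightarrow> det b = 1 \<Longrightarrow> (\<lambda>x. f (a ** x ** b)) \<in> P"
    and "\<And>f x. f \<in> P \<Longrightarrow> det x \<noteq> 1 \<Longrightarrow> f x = 0"
proof -
  show "fd P" "\<And>f. f \<in> P \<Longrightarrow> \<exists>p. real_polynomial_function p \<and> f = rs p"
    "\<And>f a b. f \<in> P \<Longrightarrow> det a = 1 \<Longrightarrow> det b = 1 \<Longrightarrow> (\<lambda>x. f (a ** x ** b)) \<in> P"
    using assms unfolding polysp_def by blast+
  then show "f x = 0" if "f \<in> P" "det x \<noteq> 1" for f x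
    using that by (fastforce simp: rs_def)
qed

lemma polysp_mult:
  assumes "polysp P" "polysp Q"
  obtains R where "polysp R" "\<And>f g. f \<in> P \<Longrightarrow> g \<in> Q \<Longrightarrow> (\<lambda>x. f x * g x) \<in> R"
proof -
  obtain B C where B: "finite B" "P = span B" and C: "finite C" "Q = span C"
    using fd_basis polyspD(1) assms by metis
  have BP: "B \<subseteq> P" "C \<subseteq> Q" using B C span_superset by auto
  let ?D = "{\<lambda>x. u x * v x | u v. u \<in> B \<and> v \<in> C}"
  have D: "?D = (\<lambda>(u, v) x. u x * v x) ` (B \<times> C)" by auto
  have prod: "(\<lambda>x. f x * g x) \<in> span ?D" if "f \<in> P" "g \<in> Q" for f g
    using span_mult[of f B g C] that B(2) C(2) by simp
  have gen: "\<exists>p. real_polynomial_function p \<and> h = rs p" if "h \<in> span ?D" for h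
    using that
  proof (induction h rule: span_induct_alt)
    case base
    have "(0 :: real^'a^'a \<Rightarrow> real) = rs (\<lambda>_. 0)" by (auto simp: rs_def)
    then show ?case using real_polynomial_function.intros(2) by blast
  next
    case (step c h k)
    obtain u v where h: "h = (\<lambda>x. u x * v x)" "u \<in> P" "v \<in> Q" using step(1) BP by blast
    obtain p q r where pqr: "real_polynomial_function p" "real_polynomial_function q"
      "real_polynomial_function r" "u = rs p" "v = rs q" "k = rs r"
      using polyspD(2)[OF assms(1) h(2)] polyspD(2)[OF assms(2) h(3)] step by blast
    have "c *\<^sub>R h + k = rs (\<lambda>x. c * (p x * q x) + r x)" using h pqr by (auto simp: rs_def)
    moreover have "real_polynomial_function (\<lambda>x. c * (p x * q x) + r x)"
      using pqr by (intro real_polynomial_function.intros(2,3,4))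
    ultimately show ?case by blast
  qed
  have inv: "(\<lambda>x. h (a ** x ** b)) \<in> span ?D" if "h \<in> span ?D" "det a = 1" "det b = 1" for h a b
  proof (rule span_comp[where h = "\<lambda>x. a ** x ** b", OF _ that(1)])
    fix f assume "f \<in> ?D"
    then obtain u v where h: "f = (\<lambda>x. u x * v x)" "u \<in> P" "v \<in> Q" using BP by blast
    then show "(\<lambda>x. f (a ** x ** b)) \<in> span ?D"
      using prod[OF polyspD(3)[OF assms(1) h(2)] polyspD(3)[OF assms(2) h(3)]] that by auto
  qed
  have "fd (span ?D)" unfolding D using B C by (intro fd_span) auto
  then have "polysp (span ?D)" unfolding polysp_def using gen inv by blast
  then show ?thesis using that prod by blast
qed

lemma polysp_prod:
  assumes "polysp P" "rs (\<lambda>_. 1) \<in> P"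
  shows "\<exists>R. polysp R \<and> (\<forall>F. (\<forall>i<(n :: nat). F i \<in> P) \<longrightarrow> rs (\<lambda>x. \<Prod>i = 0..<n. F i x) \<in> R)"
proof (induction n)
  case 0
  then show ?case using assms by (intro exI[of _ P]) auto
next
  case (Suc n)
  then obtain R where R: "polysp R" "\<And>F. (\<And>i. i<n \<Longrightarrow> F i \<in> P) \<Longrightarrow> rs (\<lambda>x. \<Prod>i = 0..<n. F i x) \<in> R"
    by blast
  obtain S where S: "polysp S" "\<And>f g. f \<in> R \<Longrightarrow> g \<in> P \<Longrightarrow> (\<lambda>x. f x * g x) \<in> S"
    using polysp_mult[OF R(1) assms(1)] by blast
  have "rs (\<lambda>x. \<Prod>i = 0..<Suc n. F i x) \<in> S" if F: "\<forall>i<Suc n. F i \<in> P" for F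
  proof -
    have "(\<lambda>x. rs (\<lambda>x. \<Prod>i = 0..<n. F i x) x * F n x) \<in> S"
      using F by (intro S(2) R(2)) auto
    moreover have "(\<lambda>x. rs (\<lambda>x. \<Prod>i = 0..<n. F i x) x * F n x) = rs (\<lambda>x. \<Prod>i = 0..<Suc n. F i x)"
      by (auto simp: rs_def)
    ultimately show ?thesis by simp
  qed
  then show ?case using S by blast
qed

text \<open>A single \<open>R\<close> receives the determinants of all matrices over
  \<open>P\<close>; later this makes the constants uniform over all subspaces of a given
  dimension.\<close>

lemma polysp_ldet:
  assumes "polysp P" "rs (\<lambda>_. 1) \<in> P"
  shows "\<exists>R. polysp R \<and> (\<forall>F. (\<forall>i<n. \<forall>j<n. F i j \<in> P) \<longrightarrow> rs (\<lambda>x. ldet n (\<lambda>i j. F i j x)) \<in> R)"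
proof -
  obtain R where R: "polysp R" "\<And>F. (\<And>i. i<n \<Longrightarrow> F i \<in> P) \<Longrightarrow> rs (\<lambda>x. \<Prod>i = 0..<n. F i x) \<in> R"
    using polysp_prod[OF assms, of n] by blast
  have sub: "subspace R" using polyspD(1)[OF R(1)] by (simp add: fd_def)
  have "rs (\<lambda>x. ldet n (\<lambda>i j. F i j x)) \<in> R" if F: "\<forall>i<n. \<forall>j<n. F i j \<in> P" for F
  proof -
    have "rs (\<lambda>x. ldet n (\<lambda>i j. F i j x))
      = (\<Sum>p | p permutes {0..<n}. of_int (sign p) *\<^sub>R rs (\<lambda>x. \<Prod>i = 0..<n. F i (p i) x))"
      by (auto simp: fun_eq_iff rs_def ldet_expand sum_fun_apply)
    also have "\<dots> \<in> R"
    proof (intro subspace_sum[OF sub] subspace_scale[OF sub] R(2))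
      fix p i assume "p \<in> {p. p permutes {0..<n}}" "i < n"
      then show "F i (p i) \<in> P" using F permutes_in_image[of p "{0..<n}" i] by auto
    qed
    finally show ?thesis .
  qed
  then show ?thesis using R(1) by blast
qed

subsection \<open>Finite-dimensional function representations\<close>

lemma bw_finite:
  fixes a :: "'i \<Rightarrow> nat \<Rightarrow> real"
  assumes "finite I" "\<And>i j. i \<in> I \<Longrightarrow> \<bar>a i j\<bar> \<le> B"
  shows "\<exists>r l. strict_mono (r :: nat \<Rightarrow> nat) \<and> (\<forall>i\<in>I. (\<lambda>j. a i (r j)) \<longlonglongrightarrow> l i)"
  using assms
proof (induction I rule: finite_induct)
  case empty
  then show ?case by (intro exI[of _ id]) (auto simp: strict_mono_def)
next
  case (insert x I)
  then obtain r l where r: "strict_mono (r :: nat \<Rightarrow> nat)" "\<forall>i\<in>I. (\<lambda>j. a i (r j)) \<longlonglongrightarrow> l i" by auto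
  have "bounded (range (\<lambda>j. a x (r j)))"
    using insert.prems by (intro boundedI[of _ B]) auto
  then obtain s y where s: "strict_mono (s :: nat \<Rightarrow> nat)" "((\<lambda>j. a x (r j)) \<circ> s) \<longlonglongrightarrow> y"
    using bounded_imp_convergent_subsequence by blast
  have "(\<lambda>j. a i (r (s j))) \<longlonglongrightarrow> (l(x := y)) i" if "i \<in> insert x I" for i
  proof (cases "i = x")
    case True
    then show ?thesis using s(2) by (simp add: o_def)
  next
    case False
    then have "(\<lambda>j. a i (r j)) \<longlonglongrightarrow> l i" using r(2) that by simp
    from LIMSEQ_subseq_LIMSEQ[OF this s(1)] False show ?thesis by (simp add: o_def)
  qed
  then show ?case using strict_mono_o[OF r(1) s(1)]
    by (intro exI[of _ "r \<circ> s"] exI[of _ "l(x := y)"]) (auto simp: o_def)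
qed

lemma SL_inverse:
  fixes g :: "real^'d^'d"
  assumes "det g = 1"
  shows "\<exists>h. det h = 1 \<and> g ** h = mat 1 \<and> h ** g = mat 1"
proof -
  have "invertible g" using assms by (simp add: invertible_det_nz)
  then obtain h where h: "g ** h = mat 1" "h ** g = mat 1" unfolding invertible_def by blast
  have "det g * det h = 1" using arg_cong[OF h(1), of det] by (simp add: det_mul)
  with h assms show ?thesis by auto
qed

text \<open>Two kinds of instances occur: differences of polynomial functions on pairs of matrices
  and, inside the proof of \<open>bounded_vector\<close>, a span of products of two functions.
  Points carry a left action, so translation of functions reverses products.\<close>

locale fun_rep =
  fixes act :: "real^'d^'d \<Rightarrow> 'x \<Rightarrow> 'x" and Z :: "('x \<Rightarrow> real) set"
  assumes act_one: "act (mat 1) x = x"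
    and act_mult: "act (g ** h) x = act g (act h x)"
    and fdZ: "fd Z"
    and Z_act: "f \<in> Z \<Longrightarrow> det g = 1 \<Longrightarrow> (\<lambda>x. f (act g x)) \<in> Z"
    and Z_poly: "f \<in> Z \<Longrightarrow> \<exists>p. real_polynomial_function p \<and> (\<forall>g. det g = 1 \<longrightarrow> f (act g x) = p g)"
begin

definition tr :: "real^'d^'d \<Rightarrow> ('x \<Rightarrow> real) \<Rightarrow> 'x \<Rightarrow> real" where
  "tr g f = (\<lambda>x. f (act g x))"

lemma tr_apply: "tr g f x = f (act g x)"
  by (simp add: tr_def)

lemma tr_Z: "f \<in> Z \<Longrightarrow> det g = 1 \<Longrightarrow> tr g f \<in> Z"
  unfolding tr_def by (rule Z_act)

lemma tr_mult: "tr (g ** h) f = tr h (tr g f)"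
  by (simp add: tr_def act_mult)

lemma tr_one: "tr (mat 1) f = f"
  by (simp add: tr_def act_one)

lemma linear_tr: "linear (tr g)"
  unfolding tr_def by (rule linear_comp_op)

lemma subZ: "subspace Z"
  using fdZ by (simp add: fd_def)

definition frZ :: "(nat \<Rightarrow> 'x) \<times> (nat \<Rightarrow> 'x \<Rightarrow> real)" where
  "frZ = (SOME te. frame Z (dim Z) (fst te) (snd te))"

lemma frame_frZ: "frame Z (dim Z) (fst frZ) (snd frZ)"
proof -
  obtain t e where "frame Z (dim Z) t e" using fd_frame[OF fdZ] by blast
  then have "\<exists>te. frame Z (dim Z) (fst te) (snd te)" by (intro exI[of _ "(t, e)"]) simp
  then show ?thesis unfolding frZ_def by (rule someI_ex)
qed

text \<open>Only values at the nodes of a fixed frame enter. Pointwise convergence therefore implies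
  convergence of \<open>nrm\<close>, while for functions in \<open>Z\<close> the value at any point
  is controlled by \<open>nrm\<close> through \<open>pb\<close>.\<close>

definition nrm :: "('x \<Rightarrow> real) \<Rightarrow> real" where
  "nrm f = (\<Sum>i<dim Z. \<bar>f (fst frZ i)\<bar>)"

lemma nrm_nonneg: "0 \<le> nrm f"
  by (simp add: nrm_def sum_nonneg)

lemma nrm_scale: "nrm (c *\<^sub>R f) = \<bar>c\<bar> * nrm f"
  unfolding nrm_def by (simp add: abs_mult sum_distrib_left)

definition pb :: "'x \<Rightarrow> real" where
  "pb x = (\<Sum>i<dim Z. \<bar>snd frZ i x\<bar>)"

lemma pb_nonneg: "0 \<le> pb x"
  by (simp add: pb_def sum_nonneg)

lemma pt_bound:
  assumes "f \<in> Z"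
  shows "\<bar>f x\<bar> \<le> pb x * nrm f"
proof -
  have "\<bar>f x\<bar> = \<bar>\<Sum>i<dim Z. f (fst frZ i) * snd frZ i x\<bar>"
    using frameD(4)[OF frame_frZ assms, of x] by (rule arg_cong)
  also have "\<dots> \<le> (\<Sum>i<dim Z. \<bar>f (fst frZ i)\<bar> * \<bar>snd frZ i x\<bar>)"
    unfolding abs_mult[symmetric] by (rule sum_abs)
  also have "\<dots> \<le> (\<Sum>i<dim Z. nrm f * \<bar>snd frZ i x\<bar>)"
    unfolding nrm_def by (intro sum_mono mult_right_mono member_le_sum) auto
  finally show ?thesis by (simp add: pb_def sum_distrib_left mult.commute)
qed

lemma nrm_zero: "f \<in> Z \<Longrightarrow> nrm f = 0 \<Longrightarrow> f = 0"
proof (rule ext)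
  fix x assume "f \<in> Z" "nrm f = 0"
  then show "f x = 0 x" using pt_bound[of f x] by simp
qed

lemma nrm_pos: "f \<in> Z \<Longrightarrow> f \<noteq> 0 \<Longrightarrow> 0 < nrm f"
  using nrm_zero[of f] nrm_nonneg[of f] by (auto simp: less_le)

text \<open>The summand 1 makes the bound at least 1, so that it can be divided by even when
  \<open>Z\<close> is trivial.\<close>

definition opb :: "real^'d^'d \<Rightarrow> real" where
  "opb g = 1 + (\<Sum>i<dim Z. pb (act g (fst frZ i)))"

lemma opb_pos: "0 < opb g"
  unfolding opb_def by (intro add_pos_nonneg sum_nonneg pb_nonneg) simp

lemma nrm_tr:
  assumes "f \<in> Z"
  shows "nrm (tr g f) \<le> opb g * nrm f"
proof -
  have "nrm (tr g f) = (\<Sum>i<dim Z. \<bar>f (act g (fst frZ i))\<bar>)" by (simp add: nrm_def tr_apply)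
  also have "\<dots> \<le> (\<Sum>i<dim Z. pb (act g (fst frZ i)) * nrm f)" by (intro sum_mono pt_bound assms)
  also have "\<dots> \<le> opb g * nrm f" by (simp add: opb_def sum_distrib_right distrib_right nrm_nonneg)
  finally show ?thesis .
qed

lemma nrm_tendsto:
  assumes "\<And>x. (\<lambda>n. f n x) \<longlonglongrightarrow> l x"
  shows "(\<lambda>n. nrm (f n)) \<longlonglongrightarrow> nrm l"
  unfolding nrm_def by (intro tendsto_sum tendsto_rabs assms)

lemma nrm_diff_tendsto:
  assumes "\<And>x. (\<lambda>n. f n x) \<longlonglongrightarrow> l x"
  shows "(\<lambda>n. nrm (f n - l)) \<longlonglongrightarrow> 0"
proof -
  have "(\<lambda>n. nrm (f n - l)) \<longlonglongrightarrow> nrm (\<lambda>_. 0)"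
  proof (rule nrm_tendsto)
    fix x show "(\<lambda>n. (f n - l) x) \<longlonglongrightarrow> 0" using tendsto_diff[OF assms[of x] tendsto_const[of "l x"]] by simp
  qed
  then show ?thesis by (simp add: nrm_def)
qed

lemma closed_subspace:
  assumes "L \<subseteq> Z" "subspace L" "\<And>n. f n \<in> L" "\<And>x. (\<lambda>n. f n x) \<longlonglongrightarrow> l x"
  shows "l \<in> L"
proof -
  obtain t e where fr: "frame L (dim L) t e" using fd_frame[OF fd_subspace[OF fdZ assms(1,2)]] by blast
  have "l = (\<Sum>i<dim L. l (t i) *\<^sub>R e i)"
  proof
    fix x
    have "(\<lambda>n. \<Sum>i<dim L. f n (t i) * e i x) \<longlonglongrightarrow> (\<Sum>i<dim L. l (t i) * e i x)"
      by (intro tendsto_sum tendsto_mult tendsto_const assms)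
    then have "(\<lambda>n. f n x) \<longlonglongrightarrow> (\<Sum>i<dim L. l (t i) * e i x)"
      using frameD(4)[OF fr assms(3), of _ x] by presburger
    from LIMSEQ_unique[OF assms(4) this] show "l x = (\<Sum>i<dim L. l (t i) *\<^sub>R e i) x"
      by (simp only: sum_fun_apply scaleR_fun_apply real_scaleR_def)
  qed
  also have "\<dots> \<in> L"
    using frameD(2)[OF fr] by (intro subspace_sum subspace_scale assms(2)) auto
  finally show ?thesis .
qed

lemma compactZ:
  assumes "\<And>n. f n \<in> Z" "\<And>n. nrm (f n) \<le> C"
  shows "\<exists>r l. strict_mono (r :: nat \<Rightarrow> nat) \<and> l \<in> Z \<and> (\<forall>x. (\<lambda>n. f (r n) x) \<longlonglongrightarrow> l x)"
proof -
  have "\<bar>f n (fst frZ i)\<bar> \<le> C" if "i \<in> {..<dim Z}" for i n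
    using assms(2)[of n] member_le_sum[of i "{..<dim Z}" "\<lambda>i. \<bar>f n (fst frZ i)\<bar>"] that
    unfolding nrm_def by fastforce
  then obtain r c where r: "strict_mono (r :: nat \<Rightarrow> nat)"
      "\<forall>i\<in>{..<dim Z}. (\<lambda>n. f (r n) (fst frZ i)) \<longlonglongrightarrow> c i"
    using bw_finite[of "{..<dim Z}" "\<lambda>i n. f n (fst frZ i)" C] by blast
  define l where "l = (\<lambda>x. \<Sum>i<dim Z. c i * snd frZ i x)"
  have conv: "(\<lambda>n. f (r n) x) \<longlonglongrightarrow> l x" for x
  proof -
    have "(\<lambda>n. \<Sum>i<dim Z. f (r n) (fst frZ i) * snd frZ i x) \<longlonglongrightarrow> l x"
      unfolding l_def using r(2) by (intro tendsto_sum tendsto_mult tendsto_const) auto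
    then show ?thesis using frameD(4)[OF frame_frZ assms(1), of _ x] by presburger
  qed
  have "l \<in> Z" using closed_subspace[OF order_refl subZ, of "\<lambda>n. f (r n)"] assms(1) conv by blast
  then show ?thesis using r(1) conv by blast
qed

lemma limit_in_subspace:
  assumes L: "L \<subseteq> Z" "subspace L" and u: "\<And>n. u n \<in> Z" "\<And>x. (\<lambda>n. u n x) \<longlonglongrightarrow> v x"
    and l: "\<And>n. l n \<in> L" "\<And>n. nrm (u n - l n) \<le> d n" "d \<longlonglongrightarrow> 0"
  shows "(\<lambda>n. l n x) \<longlonglongrightarrow> v x" "v \<in> L"
proof -
  have conv: "(\<lambda>n. l n x) \<longlonglongrightarrow> v x" for x
  proof -
    have "(\<lambda>n. u n x - l n x) \<longlonglongrightarrow> 0"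
    proof (rule Lim_null_comparison)
      show "\<forall>\<^sub>F n in sequentially. norm (u n x - l n x) \<le> pb x * d n"
      proof (intro always_eventually allI)
        fix n
        have "u n - l n \<in> Z" using l(1) L(1) by (intro subspace_diff[OF subZ] u(1)) blast
        from pt_bound[OF this, of x] have "\<bar>u n x - l n x\<bar> \<le> pb x * nrm (u n - l n)" by simp
        also have "\<dots> \<le> pb x * d n" by (intro mult_left_mono l pb_nonneg)
        finally show "norm (u n x - l n x) \<le> pb x * d n" by simp
      qed
      show "(\<lambda>n. pb x * d n) \<longlonglongrightarrow> 0" using tendsto_mult[OF tendsto_const[of "pb x"] l(3)] by simp
    qed
    from tendsto_diff[OF u(2)[of x] this] show ?thesis by simp
  qed
  then show "(\<lambda>n. l n x) \<longlonglongrightarrow> v x" .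
  show "v \<in> L" by (rule closed_subspace[where f = l, OF L l(1) conv])
qed

text \<open>The error is measured relative to \<open>nrm f\<close>; for a subspace \<open>L\<close>
  this gives a cone, in other words a neighbourhood of \<open>L\<close> in the projective space of
  \<open>Z\<close>.\<close>

definition nb :: "real \<Rightarrow> ('x \<Rightarrow> real) set \<Rightarrow> ('x \<Rightarrow> real) set" where
  "nb \<epsilon> L = {f \<in> Z. f \<noteq> 0 \<and> (\<exists>l\<in>L. nrm (f - l) \<le> \<epsilon> * nrm f)}"

lemma nb_mono: "\<epsilon> \<le> \<epsilon>' \<Longrightarrow> nb \<epsilon> L \<subseteq> nb \<epsilon>' L"
  unfolding nb_def by (blast intro: order_trans mult_right_mono nrm_nonneg)

lemma nb_scale1:
  assumes "subspace L" "c \<noteq> 0" "f \<in> nb \<epsilon> L"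
  shows "c *\<^sub>R f \<in> nb \<epsilon> L"
proof -
  obtain l where l: "l \<in> L" "nrm (f - l) \<le> \<epsilon> * nrm f" and f: "f \<in> Z" "f \<noteq> 0"
    using assms(3) by (auto simp: nb_def)
  have "nrm (c *\<^sub>R f - c *\<^sub>R l) = \<bar>c\<bar> * nrm (f - l)"
    by (simp only: scaleR_diff_right[symmetric] nrm_scale)
  also have "\<dots> \<le> \<bar>c\<bar> * (\<epsilon> * nrm f)" by (intro mult_left_mono l) auto
  also have "\<dots> = \<epsilon> * nrm (c *\<^sub>R f)" by (simp add: nrm_scale)
  finally have "nrm (c *\<^sub>R f - c *\<^sub>R l) \<le> \<epsilon> * nrm (c *\<^sub>R f)" .
  moreover have "c *\<^sub>R l \<in> L" "c *\<^sub>R f \<in> Z" using l f assms(1) subZ by (auto intro: subspace_scale)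
  moreover have "c *\<^sub>R f \<noteq> 0" using assms(2) f(2) by (simp only: scaleR_eq_0_iff) simp
  ultimately show ?thesis unfolding nb_def by blast
qed

lemma nb_scale:
  assumes "subspace L" "c \<noteq> 0"
  shows "c *\<^sub>R f \<in> nb \<epsilon> L \<longleftrightarrow> f \<in> nb \<epsilon> L"
proof
  assume "c *\<^sub>R f \<in> nb \<epsilon> L"
  from nb_scale1[OF assms(1) _ this, of "1 / c"] assms(2) show "f \<in> nb \<epsilon> L" by simp
qed (use assms nb_scale1 in blast)

lemma nb_unit:
  assumes "subspace L" "f \<in> nb \<epsilon> L"
  obtains c where "c \<noteq> 0" "nrm (c *\<^sub>R f) = 1" "c *\<^sub>R f \<in> nb \<epsilon> L"
proof -
  have "f \<in> Z" "f \<noteq> 0" using assms(2) by (auto simp: nb_def)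
  then have "nrm f > 0" by (rule nrm_pos)
  then show ?thesis using that[of "1 / nrm f"] nb_scale1[OF assms(1) _ assms(2), of "1 / nrm f"]
    by (simp add: nrm_scale)
qed

lemma unit_in_nbD:
  assumes "f \<in> nb \<epsilon> L" "nrm f = 1"
  shows "f \<in> Z" "\<exists>l\<in>L. nrm (f - l) \<le> \<epsilon>"
  using assms by (auto simp: nb_def)

lemma unit_in_nbI:
  assumes "f \<in> Z" "nrm f = 1" "l \<in> L" "nrm (f - l) \<le> \<epsilon>"
  shows "f \<in> nb \<epsilon> L"
proof -
  have "f \<noteq> 0" using assms(2) by (auto simp: nrm_def)
  then show ?thesis using assms unfolding nb_def by auto
qed

text \<open>Compactness of the unit sphere: unit vectors ever closer to both subspaces have a limit
  point in the intersection, and near that limit they cannot stay away from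
  \<open>L \<inter> L'\<close>.\<close>

lemma nb_inter:
  assumes L: "subspace L" "L \<subseteq> Z" "subspace L'" "L' \<subseteq> Z" and "0 < \<epsilon>"
  shows "\<exists>\<delta>>0. nb \<delta> L \<inter> nb \<delta> L' \<subseteq> nb \<epsilon> (L \<inter> L')"
proof (rule ccontr)
  assume neg: "\<not> ?thesis"
  define d where "d = (\<lambda>k. 1 / real (Suc k))"
  have d0: "d \<longlonglongrightarrow> 0" unfolding d_def by (rule LIMSEQ_Suc[OF lim_const_over_n])
  have "\<exists>u. u \<in> nb (d k) L \<and> u \<in> nb (d k) L' \<and> u \<notin> nb \<epsilon> (L \<inter> L') \<and> nrm u = 1" for k
  proof -
    have "d k > 0" by (simp add: d_def)
    then obtain f where f: "f \<in> nb (d k) L" "f \<in> nb (d k) L'" "f \<notin> nb \<epsilon> (L \<inter> L')" using neg by blast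
    obtain c where c: "c \<noteq> 0" "nrm (c *\<^sub>R f) = 1" using nb_unit[OF L(1) f(1)] by blast
    have "subspace (L \<inter> L')" using L by (intro subspace_inter)
    with f c L show ?thesis by (intro exI[of _ "c *\<^sub>R f"]) (simp add: nb_scale)
  qed
  then obtain u where u: "\<And>k. u k \<in> nb (d k) L" "\<And>k. u k \<in> nb (d k) L'"
    "\<And>k. u k \<notin> nb \<epsilon> (L \<inter> L')" "\<And>k. nrm (u k) = 1" by metis
  have uZ: "u k \<in> Z" for k using u(1) by (simp add: nb_def)
  obtain r v where r: "strict_mono (r :: nat \<Rightarrow> nat)" and v: "\<And>x. (\<lambda>n. u (r n) x) \<longlonglongrightarrow> v x"
    using compactZ[where f = u and C = 1] uZ u(4) by auto
  have dr: "(\<lambda>n. d (r n)) \<longlonglongrightarrow> 0" using LIMSEQ_subseq_LIMSEQ[OF d0 r] by (simp add: o_def)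
  have "\<forall>n. \<exists>l. l \<in> L \<and> nrm (u (r n) - l) \<le> d (r n)" using unit_in_nbD(2)[OF u(1,4)] by blast
  then obtain l where l: "\<And>n. l n \<in> L" "\<And>n. nrm (u (r n) - l n) \<le> d (r n)" by metis
  have "\<forall>n. \<exists>l. l \<in> L' \<and> nrm (u (r n) - l) \<le> d (r n)" using unit_in_nbD(2)[OF u(2,4)] by blast
  then obtain l' where l': "\<And>n. l' n \<in> L'" "\<And>n. nrm (u (r n) - l' n) \<le> d (r n)" by metis
  have "v \<in> L" by (rule limit_in_subspace(2)[OF L(2,1) _ v l dr]) (rule uZ)
  moreover have "v \<in> L'" by (rule limit_in_subspace(2)[OF L(4,3) _ v l' dr]) (rule uZ)
  moreover have "\<forall>\<^sub>F n in sequentially. nrm (u (r n) - v) < \<epsilon>"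
    using order_tendstoD(2)[OF nrm_diff_tendsto[where f = "\<lambda>n. u (r n)", OF v] \<open>0 < \<epsilon>\<close>] .
  then obtain n where "nrm (u (r n) - v) < \<epsilon>" using eventually_happens'[OF sequentially_bot] by blast
  ultimately have "u (r n) \<in> nb \<epsilon> (L \<inter> L')" using uZ u(4) by (intro unit_in_nbI[of _ v]) auto
  with u(3) show False by blast
qed

lemma nb_tr:
  assumes L: "L \<subseteq> Z" and g: "det g = 1" and "0 < \<epsilon>"
  shows "\<exists>\<delta>>0. \<forall>f\<in>nb \<delta> L. tr g f \<in> nb \<epsilon> (tr g ` L)"
proof -
  obtain h where h: "det h = 1" "g ** h = mat 1" using SL_inverse[OF g] by blast
  \<comment> \<open>\<open>opb g\<close> bounds the growth of the error and \<open>opb h\<close>,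
    for the inverse \<open>h\<close>, the shrinking of \<open>f\<close>, so the relative error grows
    at most by their product.\<close>
  define \<delta> where "\<delta> = \<epsilon> / (opb g * opb h)"
  have "\<delta> > 0" using assms opb_pos by (simp add: \<delta>_def)
  moreover have "tr g f \<in> nb \<epsilon> (tr g ` L)" if nb: "f \<in> nb \<delta> L" for f
  proof -
    obtain l where l: "l \<in> L" "nrm (f - l) \<le> \<delta> * nrm f" and f: "f \<in> Z" "f \<noteq> 0"
      using nb unfolding nb_def by blast
    have fh: "f = tr h (tr g f)" using h by (simp add: tr_mult[symmetric] tr_one)
    have "tr g f \<noteq> 0"
    proof
      assume "tr g f = 0"
      then show False using fh f(2) linear_0[OF linear_tr, of h] by simp
    qed
    have "f - l \<in> Z" using l(1) L by (intro subspace_diff[OF subZ] f(1)) blast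
    have "nrm f \<le> opb h * nrm (tr g f)" using nrm_tr[OF tr_Z[OF f(1) g], of h] fh by simp
    have "nrm (tr g f - tr g l) = nrm (tr g (f - l))" by (simp add: linear_diff[OF linear_tr])
    also have "\<dots> \<le> opb g * nrm (f - l)" by (rule nrm_tr) fact
    also have "\<dots> \<le> opb g * (\<delta> * nrm f)" using opb_pos[of g] by (intro mult_left_mono l) simp
    also have "\<dots> \<le> opb g * (\<delta> * (opb h * nrm (tr g f)))"
      using \<open>nrm f \<le> _\<close> opb_pos[of g] \<open>\<delta> > 0\<close> by simp
    also have "\<dots> = \<epsilon> * nrm (tr g f)" using opb_pos[of g] opb_pos[of h] by (simp add: \<delta>_def)
    finally show ?thesis using tr_Z[OF f(1) g] \<open>tr g f \<noteq> 0\<close> l(1) unfolding nb_def by blast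
  qed
  ultimately show ?thesis by blast
qed

text \<open>In a frame of an invariant subspace, translation is given by the matrix \<open>e i (act g (t k))\<close>,
  which is multiplicative in \<open>g\<close>. Its determinant is a polynomial with polynomial inverse along each
  transvection curve, hence equal to 1.\<close>

context
  fixes L n t e
  assumes fr: "frame L n t e" and LZ: "L \<subseteq> Z" and Linv: "\<And>f g. f \<in> L \<Longrightarrow> det g = 1 \<Longrightarrow> tr g f \<in> L"
begin

lemma coef_mult:
  assumes "i < n" "det g = 1"
  shows "e i (act (g ** h) x) = (\<Sum>k<n. e i (act g (t k)) * e k (act h x))"
proof -
  have "tr g (e i) \<in> L" using Linv frameD(2)[OF fr] assms by blast
  from frameD(4)[OF fr this, of "act h x"] show ?thesis by (simp add: tr_apply act_mult)
qed

lemma coef_expand: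
  assumes "i < n" "det g = 1"
  shows "e i (act g x) = (\<Sum>k<n. e i (act g (t k)) * e k x)"
  using coef_mult[OF assms, of "mat 1" x] by (simp add: act_one)

lemma ldet_coef:
  assumes "det g = 1"
  shows "ldet n (\<lambda>i k. e i (act g (t k))) = 1"
proof -
  let ?D = "\<lambda>g. ldet n (\<lambda>i k. e i (act g (t k)))"
  have mult: "?D (g ** h) = ?D g * ?D h" if "det g = 1" for g h
    unfolding ldet_mult[symmetric] using that by (intro ldet_cong) (rule coef_mult)
  have D1: "?D (mat 1) = 1"
  proof -
    have "?D (mat 1) = ldet n (\<lambda>i j. if i = j then 1 else 0)"
      using frameD(3)[OF fr] by (intro ldet_cong) (simp add: act_one)
    then show ?thesis by (simp add: ldet_one)
  qed
  obtain p where p: "real_polynomial_function p" "\<And>g. det g = 1 \<Longrightarrow> ?D g = p g"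
  proof -
    have "\<exists>p. real_polynomial_function p \<and> (\<forall>g. det g = 1 \<longrightarrow> e i (act g (t k)) = p g)" if "i < n" for i k
      using Z_poly[of "e i" "t k"] frameD(2)[OF fr] LZ that by blast
    then obtain q where q: "\<And>i k. i < n \<Longrightarrow> real_polynomial_function (q i k)"
      "\<And>i k g. i < n \<Longrightarrow> det g = 1 \<Longrightarrow> e i (act g (t k)) = q i k g" by metis
    have "real_polynomial_function (\<lambda>g. ldet n (\<lambda>i k. q i k g))" using q(1) by (intro ldet_polynomial)
    moreover have "?D g = ldet n (\<lambda>i k. q i k g)" if "det g = 1" for g
      using q(2) that by (intro ldet_cong) auto
    ultimately show ?thesis using that by blast
  qed
  have transv: "?D (transv a b s) = 1" if ab: "a \<noteq> b" for a b s
  proof -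
    let ?q = "\<lambda>s. p (transv a b s)"
    have qD: "?D (transv a b s) = ?q s" for s using p(2) det_transv[OF ab] by blast
    have "real_polynomial_function (\<lambda>s. p (mat 1 ** transv a b s ** mat 1))"
      by (rule polynomial_transv_curve[OF p(1)])
    then have "real_polynomial_function ?q" by simp
    then obtain c N where c: "?q = (\<lambda>x. \<Sum>i\<le>N. c i * x ^ i)"
      using real_polynomial_function_iff_sum by blast
    define Q where "Q = (\<Sum>i\<le>N. monom (c i) i)"
    have Q: "poly Q s = ?q s" for s unfolding Q_def poly_sum poly_monom using fun_cong[OF c] by simp
    have "?q s * ?q (- s) = 1" for s
      using mult[OF det_transv[OF ab], of s "transv a b (- s)"] D1
      by (simp add: transv_add[OF ab] transv_zero[OF ab] qD)
    then have "poly (Q * pcompose Q [:0, - 1:]) s = poly 1 s" for s by (simp add: poly_pcompose Q)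
    then have "Q * pcompose Q [:0, - 1:] = 1" using poly_eq_poly_eq_iff[of "Q * pcompose Q [:0, - 1:]" 1] by blast
    then have "degree (Q * pcompose Q [:0, - 1:]) = 0" "Q \<noteq> 0" "pcompose Q [:0, - 1:] \<noteq> 0"
      by (auto simp del: pcompose_eq_0)
    then have "degree Q = 0" by (simp add: degree_mult_eq)
    then obtain d where "Q = [:d:]" using degree_0_id by metis
    then have "poly Q s = poly Q 0" by simp
    then have "?q s = ?q 0" by (simp only: Q)
    then show ?thesis using qD[of s] qD[of 0] D1 by (simp add: transv_zero[OF ab])
  qed
  show ?thesis using assms
  proof (induction g rule: SL_induct)
    case one
    then show ?case by (rule D1)
  next
    case (step A m k s)
    then show ?case using mult[OF det_transv[OF step.hyps(2)]] transv by simp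
  qed
qed

end

end

subsection \<open>Invariant means on a function representation\<close>

text \<open>Invariance of \<open>m\<close> is required for cones only: \<open>m\<close> will come
  from a mean on lines by choosing a representative of each line, and for other sets it would depend
  on that choice. The hypothesis \<open>dense\<close> is Zariski density of
  \<open>G\<close>.\<close>

locale inv_mean = fun_rep act Z
  for act :: "real^'d^'d \<Rightarrow> 'x \<Rightarrow> 'x" and Z :: "('x \<Rightarrow> real) set" +
  fixes G :: "(real^'d^'d) set" and m :: "('x \<Rightarrow> real) set \<Rightarrow> real"
  assumes G_det: "g \<in> G \<Longrightarrow> det g = 1"
    and G_one: "mat 1 \<in> G"
    and G_mult: "g \<in> G \<Longrightarrow> h \<in> G \<Longrightarrow> g ** h \<in> G"
    and G_inv: "g \<in> G \<Longrightarrow> \<exists>h\<in>G. g ** h = mat 1 \<and> h ** g = mat 1"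
    and dense: "real_polynomial_function p \<Longrightarrow> (\<And>g. g \<in> G \<Longrightarrow> p g = 0) \<Longrightarrow> det a = 1 \<Longrightarrow> p a = 0"
    and m_pos: "0 \<le> m A"
    and m_add: "A \<inter> B = {} \<Longrightarrow> m (A \<union> B) = m A + m B"
    and m_Z: "m (Z - {0}) = 1"
    and m_UNIV: "m UNIV = 1"
    and m_inv: "g \<in> G \<Longrightarrow> (\<And>f c. c \<noteq> 0 \<Longrightarrow> c *\<^sub>R f \<in> A \<longleftrightarrow> f \<in> A) \<Longrightarrow> m {f. tr g f \<in> A} = m A"
begin

lemma m_mono:
  assumes "A \<subseteq> B"
  shows "m A \<le> m B"
proof -
  have "B = A \<union> (B - A)" using assms by blast
  then have "m B = m A + m (B - A)" using m_add[of A "B - A"] by simp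
  then show ?thesis using m_pos[of "B - A"] by simp
qed

lemma m_Un_Int: "m (A \<union> B) + m (A \<inter> B) = m A + m B"
proof -
  have "A \<union> B = A \<union> (B - A)" "B = (A \<inter> B) \<union> (B - A)" by blast+
  then have "m (A \<union> B) = m A + m (B - A)" "m B = m (A \<inter> B) + m (B - A)"
    using m_add[of A "B - A"] m_add[of "A \<inter> B" "B - A"] by auto
  then show ?thesis by simp
qed

lemma m_sub: "m (A \<union> B) \<le> m A + m B"
  using m_Un_Int[of A B] m_pos[of "A \<inter> B"] by linarith

lemma m_empty: "m {} = 0"
  using m_add[of "{}" "{}"] by simp

text \<open>The mass of \<open>L\<close> under the measure that the finitely additive
  \<open>m\<close> induces on projective space, where a closed set has the infimum of the masses of
  its neighbourhoods.\<close>

definition mb :: "('x \<Rightarrow> real) set \<Rightarrow> real" where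
  "mb L = Inf ((\<lambda>\<epsilon>. m (nb \<epsilon> L)) ` {0<..})"

lemma mb_le: "0 < \<epsilon> \<Longrightarrow> mb L \<le> m (nb \<epsilon> L)"
  unfolding mb_def by (intro cInf_lower bdd_belowI[of _ 0]) (auto simp: m_pos)

lemma mb_ge: "(\<And>\<epsilon>. 0 < \<epsilon> \<Longrightarrow> c \<le> m (nb \<epsilon> L)) \<Longrightarrow> c \<le> mb L"
  unfolding mb_def by (intro cInf_greatest) (auto intro!: exI[of _ 1])

lemma mb_nonneg: "0 \<le> mb L"
  by (intro mb_ge m_pos)

lemma mb_less:
  assumes "mb L < \<eta>"
  shows "\<forall>\<^sub>F \<epsilon> in at_right 0. m (nb \<epsilon> L) < \<eta>"
proof -
  obtain e where e: "0 < e" "m (nb e L) < \<eta>"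
    using cInf_lessD[of "(\<lambda>\<epsilon>. m (nb \<epsilon> L)) ` {0<..}" \<eta>] assms unfolding mb_def by auto
  have "m (nb \<epsilon> L) < \<eta>" if "\<epsilon> \<in> {0<..<e}" for \<epsilon>
    using m_mono[OF nb_mono[of \<epsilon> e L]] that e(2) by simp
  then show ?thesis by (rule eventually_at_rightI[OF _ e(1)])
qed

lemma mb_Z: "mb Z = 1"
proof -
  have "m (nb \<epsilon> Z) = 1" if "0 < \<epsilon>" for \<epsilon>
  proof -
    have "nb \<epsilon> Z = Z - {0}"
    proof (intro equalityI subsetI)
      fix f assume "f \<in> Z - {0}"
      moreover have "nrm (f - f) \<le> \<epsilon> * nrm f" using that nrm_nonneg[of f] by (simp add: nrm_def)
      ultimately show "f \<in> nb \<epsilon> Z" unfolding nb_def by blast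
    qed (simp add: nb_def)
    then show ?thesis by (simp add: m_Z)
  qed
  then show ?thesis using mb_le[of 1 Z] mb_ge[of 1 Z] by force
qed

lemma mb_zero: "mb {0} = 0"
proof -
  have "nb (1/2) {0} = {}"
  proof -
    have False if "f \<in> nb (1/2) {0}" for f
    proof -
      have "f \<in> Z" "f \<noteq> 0" "nrm f \<le> 1/2 * nrm f" using that by (auto simp: nb_def)
      then show False using nrm_pos[of f] by simp
    qed
    then show ?thesis by blast
  qed
  then show ?thesis using mb_le[of "1/2" "{0}"] mb_nonneg[of "{0}"] m_empty by simp
qed

lemma mb_tr:
  assumes g: "g \<in> G" and L: "subspace L" "L \<subseteq> Z"
  shows "mb L \<le> mb (tr g ` L)"
proof (rule mb_ge)
  fix \<epsilon> :: real assume "0 < \<epsilon>"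
  then obtain \<delta> where \<delta>: "\<delta> > 0" "\<forall>f\<in>nb \<delta> L. tr g f \<in> nb \<epsilon> (tr g ` L)"
    using nb_tr[OF L(2) G_det[OF g]] by blast
  have sub: "subspace (tr g ` L)" by (rule linear_subspace_image[OF linear_tr L(1)])
  have "mb L \<le> m (nb \<delta> L)" by (rule mb_le) fact
  also have "\<dots> \<le> m {f. tr g f \<in> nb \<epsilon> (tr g ` L)}" using \<delta>(2) by (intro m_mono) auto
  also have "\<dots> = m (nb \<epsilon> (tr g ` L))" by (rule m_inv[OF g]) (rule nb_scale[OF sub])
  finally show "mb L \<le> m (nb \<epsilon> (tr g ` L))" .
qed

section \<open>Furstenberg's argument: subspaces of least dimension with positive mass\<close>

lemma dim_tr_le:
  assumes "L \<subseteq> Z" "subspace L"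
  shows "dim (tr g ` L) \<le> dim L"
proof -
  obtain B where B: "finite B" "L = span B" "card B = dim L"
    using fd_basis[OF fd_subspace[OF fdZ assms]] by metis
  have "tr g ` L = span (tr g ` B)" unfolding B(2) by (rule linear_span_image[OF linear_tr, symmetric])
  then have "dim (tr g ` L) \<le> card (tr g ` B)"
    using B(1) by (intro real_vector.dim_le_card) auto
  also have "\<dots> \<le> card B" by (rule card_image_le[OF B(1)])
  finally show ?thesis using B(3) by simp
qed

lemma tr_image_sub: "L \<subseteq> Z \<Longrightarrow> det g = 1 \<Longrightarrow> tr g ` L \<subseteq> Z"
  using tr_Z by blast

lemma dim_tr:
  assumes "L \<subseteq> Z" "subspace L" "det g = 1"
  shows "dim (tr g ` L) = dim L"
proof -
  obtain h where h: "det h = 1" "g ** h = mat 1" using SL_inverse[OF assms(3)] by blast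
  have "tr h (tr g f) = f" for f using h by (simp add: tr_mult[symmetric] tr_one)
  then have "tr h ` (tr g ` L) = L" by (simp add: image_image)
  then have "dim L \<le> dim (tr g ` L)"
    using dim_tr_le[of "tr g ` L" h] tr_image_sub[OF assms(1,3)] linear_subspace_image[OF linear_tr assms(2)]
    by metis
  with dim_tr_le[OF assms(1,2)] show ?thesis by (metis le_antisym)
qed

lemma minimal_subspace:
  obtains L where "subspace L" "L \<subseteq> Z" "0 < mb L"
    "\<And>L'. subspace L' \<Longrightarrow> L' \<subseteq> Z \<Longrightarrow> dim L' < dim L \<Longrightarrow> mb L' = 0"
proof -
  define P where "P = (\<lambda>k. \<exists>L. subspace L \<and> L \<subseteq> Z \<and> dim L = k \<and> 0 < mb L)"
  have "P (dim Z)" unfolding P_def using subZ mb_Z by (intro exI[of _ Z]) auto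
  then have "P (LEAST k. P k)" by (rule LeastI)
  then obtain L where L: "subspace L" "L \<subseteq> Z" "dim L = (LEAST k. P k)" "0 < mb L" unfolding P_def by blast
  have "mb L' = 0" if "subspace L'" "L' \<subseteq> Z" "dim L' < dim L" for L'
  proof (rule ccontr)
    assume "mb L' \<noteq> 0"
    then have "P (dim L')" unfolding P_def using that mb_nonneg[of L'] by (intro exI[of _ L']) auto
    then show False using not_less_Least[of "dim L'" P] that(3) L(3) by simp
  qed
  with L that show ?thesis by blast
qed

context
  fixes L
  assumes Ls: "subspace L" and LZ: "L \<subseteq> Z" and mbL: "0 < mb L"
    and minL: "\<And>L'. subspace L' \<Longrightarrow> L' \<subseteq> Z \<Longrightarrow> dim L' < dim L \<Longrightarrow> mb L' = 0"
begin

lemma L_nonzero: "L \<noteq> {0}"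
  using mbL mb_zero by auto

definition orb :: "('x \<Rightarrow> real) set set" where
  "orb = (\<lambda>g. tr g ` L) ` G"

lemma orbD:
  assumes "A \<in> orb"
  shows "subspace A" "A \<subseteq> Z" "dim A = dim L" "mb L \<le> mb A"
proof -
  obtain g where g: "g \<in> G" "A = tr g ` L" using assms by (auto simp: orb_def)
  show "subspace A" unfolding g(2) by (rule linear_subspace_image[OF linear_tr Ls])
  show "A \<subseteq> Z" unfolding g(2) by (rule tr_image_sub[OF LZ G_det[OF g(1)]])
  show "dim A = dim L" unfolding g(2) by (rule dim_tr[OF LZ Ls G_det[OF g(1)]])
  show "mb L \<le> mb A" unfolding g(2) by (rule mb_tr[OF g(1) Ls LZ])
qed

text \<open>Distinct translates of \<open>L\<close> have equal dimension, so they meet in a smaller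
  subspace, which is null by minimality. \<open>nb_inter\<close> carries this over to
  neighbourhoods.\<close>

lemma orb_inter:
  assumes "A \<in> orb" "B \<in> orb" "A \<noteq> B" "0 < \<eta>"
  shows "\<forall>\<^sub>F \<epsilon> in at_right 0. m (nb \<epsilon> A \<inter> nb \<epsilon> B) < \<eta>"
proof -
  have sub: "subspace (A \<inter> B)" "A \<inter> B \<subseteq> Z" using orbD assms by (auto intro: subspace_inter)
  have "dim (A \<inter> B) < dim L"
  proof (rule ccontr)
    assume "\<not> ?thesis"
    then have "A \<inter> B = A" "A \<inter> B = B"
      using fd_dim_eq[of A "A \<inter> B"] fd_dim_eq[of B "A \<inter> B"] orbD[OF assms(1)] orbD[OF assms(2)] sub
        fd_subspace[OF fdZ] by auto
    then show False using assms(3) by simp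
  qed
  then have "mb (A \<inter> B) = 0" using minL sub by blast
  then have "\<forall>\<^sub>F \<epsilon> in at_right 0. m (nb \<epsilon> (A \<inter> B)) < \<eta>" using mb_less assms(4) by simp
  then obtain \<epsilon>' where "0 < \<epsilon>'" "m (nb \<epsilon>' (A \<inter> B)) < \<eta>"
    using eventually_happens'[OF trivial_limit_at_right_real eventually_conj[OF _ eventually_at_right_less[of 0]]]
    by blast
  moreover obtain \<delta> where \<delta>: "0 < \<delta>" "nb \<delta> A \<inter> nb \<delta> B \<subseteq> nb \<epsilon>' (A \<inter> B)"
    using nb_inter[OF orbD(1,2)[OF assms(1)] orbD(1,2)[OF assms(2)] \<open>0 < \<epsilon>'\<close>] by blast
  ultimately have "m (nb \<epsilon> A \<inter> nb \<epsilon> B) < \<eta>" if "\<epsilon> \<in> {0<..<\<delta>}" for \<epsilon>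
  proof -
    have "nb \<epsilon> A \<inter> nb \<epsilon> B \<subseteq> nb \<delta> A \<inter> nb \<delta> B" using nb_mono[of \<epsilon> \<delta>] that by auto
    then have "m (nb \<epsilon> A \<inter> nb \<epsilon> B) \<le> m (nb \<epsilon>' (A \<inter> B))" using \<delta>(2) by (intro m_mono) blast
    then show ?thesis using \<open>m (nb \<epsilon>' (A \<inter> B)) < \<eta>\<close> by simp
  qed
  then show ?thesis by (rule eventually_at_rightI[OF _ \<delta>(1)])
qed

lemma orb_inter_union:
  assumes "finite T" "T \<subseteq> orb" "B \<in> orb" "B \<notin> T" "0 < \<eta>"
  shows "\<forall>\<^sub>F \<epsilon> in at_right 0. m ((\<Union>A\<in>T. nb \<epsilon> A) \<inter> nb \<epsilon> B) < \<eta>"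
  using assms
proof (induction T arbitrary: \<eta> rule: finite_induct)
  case empty
  then show ?case by (simp add: m_empty)
next
  case (insert A T)
  have "\<forall>\<^sub>F \<epsilon> in at_right 0. m ((\<Union>A\<in>T. nb \<epsilon> A) \<inter> nb \<epsilon> B) < \<eta> / 2"
    using insert.prems by (intro insert.IH) auto
  moreover have "\<forall>\<^sub>F \<epsilon> in at_right 0. m (nb \<epsilon> A \<inter> nb \<epsilon> B) < \<eta> / 2"
    using insert.prems by (intro orb_inter) auto
  ultimately show ?case
  proof eventually_elim
    case (elim \<epsilon>)
    have "m ((\<Union>A\<in>insert A T. nb \<epsilon> A) \<inter> nb \<epsilon> B)
      = m (((\<Union>A\<in>T. nb \<epsilon> A) \<inter> nb \<epsilon> B) \<union> (nb \<epsilon> A \<inter> nb \<epsilon> B))" by (rule arg_cong[where f = m]) blast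
    also have "\<dots> \<le> m ((\<Union>A\<in>T. nb \<epsilon> A) \<inter> nb \<epsilon> B) + m (nb \<epsilon> A \<inter> nb \<epsilon> B)" by (rule m_sub)
    finally show ?case using elim by linarith
  qed
qed

text \<open>Each translate has mass at least \<open>mb L\<close>, and by
  \<open>orb_inter_union\<close> the overlap with the previous ones can be made as small as desired,
  so the masses add up to an arbitrarily small error.\<close>

lemma orb_union:
  assumes "finite T" "T \<subseteq> orb" "0 < \<eta>"
  shows "\<forall>\<^sub>F \<epsilon> in at_right 0. card T * mb L - \<eta> < m (\<Union>A\<in>T. nb \<epsilon> A)"
  using assms
proof (induction T arbitrary: \<eta> rule: finite_induct)
  case empty
  then show ?case by (simp add: m_empty)
next
  case (insert B T)
  have "\<forall>\<^sub>F \<epsilon> in at_right 0. card T * mb L - \<eta> / 2 < m (\<Union>A\<in>T. nb \<epsilon> A)"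
    using insert.prems by (intro insert.IH) auto
  moreover have "\<forall>\<^sub>F \<epsilon> in at_right 0. m ((\<Union>A\<in>T. nb \<epsilon> A) \<inter> nb \<epsilon> B) < \<eta> / 2"
    using insert by (intro orb_inter_union) auto
  moreover have "\<forall>\<^sub>F \<epsilon> in at_right (0::real). 0 < \<epsilon>" by (rule eventually_at_right_less)
  ultimately show ?case
  proof eventually_elim
    case (elim \<epsilon>)
    have "mb L \<le> m (nb \<epsilon> B)"
      using orbD(4)[of B] mb_le[OF elim(3), of B] insert.prems by (simp add: order_trans)
    moreover have "m (\<Union>A\<in>insert B T. nb \<epsilon> A) = m ((\<Union>A\<in>T. nb \<epsilon> A) \<union> nb \<epsilon> B)"
      by (rule arg_cong[where f = m]) blast
    moreover have "real (card (insert B T)) * mb L = card T * mb L + mb L"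
      using insert.hyps by (simp add: algebra_simps)
    ultimately show ?case
      using elim m_Un_Int[of "\<Union>A\<in>T. nb \<epsilon> A" "nb \<epsilon> B"] by linarith
  qed
qed

lemma finite_orb: "finite orb"
proof (rule ccontr)
  assume "infinite orb"
  obtain N :: nat where N: "1 < N * mb L" using reals_Archimedean3[OF mbL] by blast
  obtain T where T: "finite T" "card T = N" "T \<subseteq> orb"
    using infinite_arbitrarily_large[OF \<open>infinite orb\<close>] by blast
  \<comment> \<open>The error \<open>N * mb L - 1\<close> makes the lower bound exactly 1, which the
    total mass cannot exceed.\<close>
  have "\<forall>\<^sub>F \<epsilon> in at_right 0. card T * mb L - (N * mb L - 1) < m (\<Union>A\<in>T. nb \<epsilon> A)"
    using N by (intro orb_union T) simp
  then obtain \<epsilon> where "card T * mb L - (N * mb L - 1) < m (\<Union>A\<in>T. nb \<epsilon> A)"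
    using eventually_happens'[OF trivial_limit_at_right_real] by blast
  then show False using m_mono[of "\<Union>A\<in>T. nb \<epsilon> A" UNIV] m_UNIV T(2) by simp
qed

text \<open>If for every \<open>A\<close> in the finite orbit some translate of \<open>L\<close> left \<open>A\<close>, a product of polynomials
  none of which vanishes identically would vanish on \<open>G\<close>.\<close>

lemma L_invariant:
  assumes "f \<in> L" "det g = 1"
  shows "tr g f \<in> L"
proof -
  have "\<exists>A\<in>orb. \<forall>g. det g = 1 \<longrightarrow> (\<forall>f\<in>L. tr g f \<in> A)"
  proof (rule ccontr)
    assume neg: "\<not> ?thesis"
    have "\<exists>p. real_polynomial_function p \<and> (\<exists>g. det g = 1 \<and> p g \<noteq> 0)
      \<and> (\<forall>g. det g = 1 \<longrightarrow> tr g ` L \<subseteq> A \<longrightarrow> p g = 0)" if A: "A \<in> orb" for A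
    proof -
      obtain g f where gf: "det g = 1" "f \<in> L" "tr g f \<notin> A" using neg A by blast
      obtain t e where fr: "frame A (dim A) t e" using fd_frame[OF fd_subspace[OF fdZ orbD(2)[OF A] orbD(1)[OF A]]] by blast
      have "\<exists>x. tr g f x \<noteq> (\<Sum>i<dim A. tr g f (t i) * e i x)"
      proof (rule ccontr)
        assume "\<not> ?thesis"
        then have "tr g f = (\<Sum>i<dim A. tr g f (t i) *\<^sub>R e i)"
          by (intro ext) (simp only: sum_fun_apply scaleR_fun_apply real_scaleR_def, blast)
        also have "\<dots> \<in> A"
          using frameD(2)[OF fr] by (intro subspace_sum subspace_scale orbD(1)[OF A]) auto
        finally show False using gf(3) by simp
      qed
      then obtain x where x: "tr g f x \<noteq> (\<Sum>i<dim A. tr g f (t i) * e i x)" by blast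
      have "f \<in> Z" using gf LZ by blast
      then obtain q where q: "\<And>y. real_polynomial_function (q y)" "\<And>y g. det g = 1 \<Longrightarrow> f (act g y) = q y g"
        using Z_poly by metis
      \<comment> \<open>The error at \<open>x\<close> when the translate of \<open>f\<close> is
        interpolated in the frame of \<open>A\<close>: a polynomial in \<open>g\<close> that
        vanishes whenever the translate lies in \<open>A\<close>.\<close>
      define p where "p = (\<lambda>g. q x g - (\<Sum>i<dim A. q (t i) g * e i x))"
      have p: "real_polynomial_function p" unfolding p_def
        using q(1) by (intro real_polynomial_function_diff real_polynomial_function_sum
            real_polynomial_function.intros(4) real_polynomial_function.intros(2)) auto
      have pe: "p g = tr g f x - (\<Sum>i<dim A. tr g f (t i) * e i x)" if "det g = 1" for g
        using that by (simp add: p_def tr_apply q(2))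
      have "p g \<noteq> 0" using pe[OF gf(1)] x by simp
      moreover have "p h = 0" if "det h = 1" "tr h ` L \<subseteq> A" for h
      proof -
        have "tr h f \<in> A" using gf(2) that(2) by blast
        from frameD(4)[OF fr this, of x] pe[OF that(1)] show ?thesis by linarith
      qed
      ultimately show ?thesis using p gf(1) by blast
    qed
    then have "\<forall>A\<in>orb. \<exists>p. real_polynomial_function p \<and> (\<exists>g. det g = 1 \<and> p g \<noteq> 0)
      \<and> (\<forall>g. det g = 1 \<longrightarrow> tr g ` L \<subseteq> A \<longrightarrow> p g = 0)" by blast
    from bchoice[OF this] obtain p where p: "\<And>A. A \<in> orb \<Longrightarrow> real_polynomial_function (p A)"
      "\<And>A. A \<in> orb \<Longrightarrow> \<exists>g. det g = 1 \<and> p A g \<noteq> 0"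
      "\<And>A g. A \<in> orb \<Longrightarrow> det g = 1 \<Longrightarrow> tr g ` L \<subseteq> A \<Longrightarrow> p A g = 0" by blast
    obtain c where c: "det c = 1" "(\<Prod>A\<in>orb. p A c) \<noteq> 0"
      using SL_irreducible_finite[where p = p, OF finite_orb p(1,2)] by blast
    have "(\<Prod>A\<in>orb. p A c) = 0"
    proof (rule dense[OF _ _ c(1)])
      show "real_polynomial_function (\<lambda>g. \<Prod>A\<in>orb. p A g)"
        using p(1) finite_orb by (intro real_polynomial_function_prod)
      fix g assume g: "g \<in> G"
      then have "tr g ` L \<in> orb" by (auto simp: orb_def)
      moreover from this have "p (tr g ` L) g = 0" using p(3) G_det[OF g] by blast
      ultimately show "(\<Prod>A\<in>orb. p A g) = 0" using finite_orb by (intro prod_zero) auto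
    qed
    with c(2) show False by simp
  qed
  then obtain A where A: "A \<in> orb" "\<And>g f. det g = 1 \<Longrightarrow> f \<in> L \<Longrightarrow> tr g f \<in> A" by blast
  have "L \<subseteq> A" using A(2)[of "mat 1"] by (auto simp: tr_one)
  then have "L = A"
    using fd_dim_eq[OF fd_subspace[OF fdZ orbD(2)[OF A(1)] orbD(1)[OF A(1)]] _ Ls] orbD(3)[OF A(1)] by simp
  then show ?thesis using A(2)[OF assms(2,1)] by simp
qed

text \<open>Otherwise the normalized translations by a suitable sequence in \<open>G\<close> converge to a singular
  map of \<open>L\<close>, and all of \<open>L\<close> except a neighbourhood of a hyperplane is moved close to its range;
  both subspaces are null by minimality.\<close>

lemma G_bounded_on_L:
  assumes fr: "frame L n t e"
  shows "\<exists>K. \<forall>g\<in>G. \<forall>i<n. \<forall>k<n. \<bar>e i (act g (t k))\<bar> \<le> K"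
proof (rule ccontr)
  assume neg: "\<not> ?thesis"
  have n: "n = dim L" using frame_dim[OF fr] by simp
  have Li: "\<And>f g. f \<in> L \<Longrightarrow> det g = 1 \<Longrightarrow> tr g f \<in> L" by (rule L_invariant)
  have n0: "0 < n"
  proof (rule ccontr)
    assume "\<not> 0 < n"
    then have "L \<subseteq> {0}" using frameD(4)[OF fr] by (auto simp: fun_eq_iff)
    then show False using L_nonzero subspace_0[OF Ls] by blast
  qed
  define s where "s = (\<lambda>g. \<Sum>i<n. \<Sum>k<n. \<bar>e i (act g (t k))\<bar>)"
  have s_ge: "\<bar>e i (act g (t k))\<bar> \<le> s g" if "i < n" "k < n" for i k g
  proof -
    have "\<bar>e i (act g (t k))\<bar> \<le> (\<Sum>k<n. \<bar>e i (act g (t k))\<bar>)" using that by (intro member_le_sum) auto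
    also have "\<dots> \<le> s g" unfolding s_def using that
      by (intro member_le_sum[where f = "\<lambda>i. \<Sum>k<n. \<bar>e i (act g (t k))\<bar>"]) (auto intro: sum_nonneg)
    finally show ?thesis .
  qed
  have "\<exists>g\<in>G. real (Suc j) \<le> s g" for j
  proof -
    obtain g i k where g: "g \<in> G" "i < n" "k < n" "real (Suc j) < \<bar>e i (act g (t k))\<bar>"
      using neg by (meson not_le)
    then show ?thesis using s_ge[of i k g] by (intro bexI[of _ g]) auto
  qed
  then obtain g' where g': "\<And>j. g' j \<in> G" "\<And>j. real (Suc j) \<le> s (g' j)" by metis
  have s'pos: "0 < s (g' j)" for j using g'(2)[of j] by (rule less_le_trans[rotated]) simp
  have "\<bar>e i (act (g' j) (t k)) / s (g' j)\<bar> \<le> 1" if "(i, k) \<in> {..<n} \<times> {..<n}" for i k j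
    using s_ge[of i k "g' j"] that s'pos[of j] by (simp add: divide_le_eq)
  then obtain r A where r: "strict_mono (r :: nat \<Rightarrow> nat)"
    and A': "\<forall>x\<in>{..<n} \<times> {..<n}. (\<lambda>j. (\<lambda>(i, k). e i (act (g' (r j)) (t k)) / s (g' (r j))) x) \<longlonglongrightarrow> A x"
    using bw_finite[of "{..<n} \<times> {..<n}" "\<lambda>(i, k) j. e i (act (g' j) (t k)) / s (g' j)" 1]
    by (auto simp: case_prod_beta)
  define g where "g = (\<lambda>j. g' (r j))"
  define c where "c = (\<lambda>j. s (g j))"
  have gG: "g j \<in> G" for j by (simp add: g_def g')
  have gd: "det (g j) = 1" for j by (rule G_det[OF gG])
  have cpos: "0 < c j" for j by (simp add: c_def g_def s'pos)
  have cge: "real (Suc j) \<le> c j" for j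
    using g'(2)[of "r j"] seq_suble[OF r, of j] by (simp add: c_def g_def)
  have A: "(\<lambda>j. e i (act (g j) (t k)) / c j) \<longlonglongrightarrow> A (i, k)" if "i < n" "k < n" for i k
    using A' that by (auto simp: g_def c_def)
  have inv0: "(\<lambda>j. 1 / c j) \<longlonglongrightarrow> 0"
  proof (rule tendsto_sandwich[of "\<lambda>_. 0"])
    show "\<forall>\<^sub>F j in sequentially. 1 / c j \<le> 1 / real (Suc j)"
      using cge cpos by (intro always_eventually allI divide_left_mono) auto
    show "(\<lambda>j. 1 / real (Suc j)) \<longlonglongrightarrow> 0" by (rule LIMSEQ_Suc[OF lim_const_over_n])
  qed (auto intro!: always_eventually less_imp_le[OF cpos])
  have lim1: "(\<lambda>j. ldet n (\<lambda>i k. e i (act (g j) (t k)) / c j)) \<longlonglongrightarrow> ldet n (\<lambda>i k. A (i, k))"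
    by (intro ldet_tendsto A)
  \<comment> \<open>Translations have determinant 1 on \<open>L\<close>, so dividing the matrix by
    \<open>c j\<close> leaves \<open>(1 / c j) ^ n\<close>, which tends to 0: the limit matrix
    \<open>A\<close> is singular. It is nonzero because its entries keep absolute sum 1.\<close>
  have pw: "ldet n (\<lambda>i k. e i (act (g j) (t k)) / c j) = (1 / c j) ^ n" for j
    using ldet_scale[of n "1 / c j" "\<lambda>i k. e i (act (g j) (t k))"] ldet_coef[OF fr LZ Li gd] by simp
  have "(\<lambda>j. (1 / c j) ^ n) \<longlonglongrightarrow> 0"
    using tendsto_power[OF inv0, of n] n0 by (simp add: power_0_left)
  from LIMSEQ_unique[OF lim1[unfolded pw] this] have det0: "ldet n (\<lambda>i k. A (i, k)) = 0" .
  obtain v k1 where v: "k1 < n" "v k1 \<noteq> 0" "\<And>i. i < n \<Longrightarrow> (\<Sum>k<n. A (i, k) * v k) = 0"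
    by (rule ldet_zero_kernel[OF det0]) blast
  have sumA: "(\<Sum>i<n. \<Sum>k<n. \<bar>A (i, k)\<bar>) = 1"
  proof -
    have "(\<lambda>j. \<Sum>i<n. \<Sum>k<n. \<bar>e i (act (g j) (t k)) / c j\<bar>) \<longlonglongrightarrow> (\<Sum>i<n. \<Sum>k<n. \<bar>A (i, k)\<bar>)"
      using A by (intro tendsto_sum tendsto_rabs) auto
    moreover have "(\<Sum>i<n. \<Sum>k<n. \<bar>e i (act (g j) (t k)) / c j\<bar>) = 1" for j
      using cpos[of j] by (simp add: sum_divide_distrib[symmetric]) (simp add: c_def s_def)
    ultimately show ?thesis by (simp add: LIMSEQ_const_iff)
  qed
  have "\<exists>i0<n. \<exists>k0<n. A (i0, k0) \<noteq> 0"
  proof (rule ccontr)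
    assume "\<not> ?thesis"
    then have "(\<Sum>i<n. \<Sum>k<n. \<bar>A (i, k)\<bar>) = 0" by (intro sum.neutral ballI) simp
    with sumA show False by simp
  qed
  then obtain i0 k0 where ik0: "i0 < n" "k0 < n" "A (i0, k0) \<noteq> 0" by blast
  \<comment> \<open>The limit map sends \<open>f\<close> to the element of \<open>L\<close> with
    value \<open>\<Sum>i<n. f (t i) * A (i, k)\<close> at \<open>t k\<close>. Outside the hyperplane
    \<open>K\<close> the value at \<open>t k0\<close> is nonzero, and all images lie in the
    hyperplane \<open>H\<close>, since \<open>v\<close> is in the kernel of
    \<open>A\<close>.\<close>
  define K where "K = {f \<in> L. (\<Sum>i<n. f (t i) * A (i, k0)) = 0}"
  define H where "H = {f \<in> L. (\<Sum>k<n. f (t k) * v k) = 0}"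
  have hyper: "subspace {f \<in> L. (\<Sum>i<n. f (t i) * w i) = 0}
      \<and> dim {f \<in> L. (\<Sum>i<n. f (t i) * w i) = 0} < dim L" if w: "i1 < n" "w i1 \<noteq> 0" for w i1
  proof -
    let ?S = "{f \<in> L. (\<Sum>i<n. f (t i) * w i) = 0}"
    have sub: "subspace ?S"
      using Ls by (auto simp: subspace_def sum.distrib distrib_right mult.assoc sum_distrib_left[symmetric])
    have "(\<Sum>i<n. e i1 (t i) * w i) = (\<Sum>i<n. if i = i1 then w i1 else 0)"
      using frameD(3)[OF fr w(1)] by (intro sum.cong) auto
    then have "(\<Sum>i<n. e i1 (t i) * w i) = w i1" using w(1) by simp
    then have "e i1 \<notin> ?S" using w by simp
    moreover have "e i1 \<in> L" using frameD(2)[OF fr w(1)] .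
    ultimately have "?S \<noteq> L" by blast
    then have "\<not> dim L \<le> dim ?S"
      using fd_dim_eq[OF fd_subspace[OF fdZ LZ Ls] _ sub] by blast
    with sub show ?thesis by simp
  qed
  have K: "subspace K" "dim K < dim L" "K \<subseteq> L" unfolding K_def using hyper[where w = "\<lambda>i. A (i, k0)", OF ik0(1,3)] by auto
  have H: "subspace H" "dim H < dim L" "H \<subseteq> L" unfolding H_def using hyper[where w = v, OF v(1,2)] by auto
  have "mb K = 0" "mb H = 0" using minL K H LZ by blast+
  then have ev: "\<forall>\<^sub>F \<epsilon> in at_right 0. m (nb \<epsilon> K) < mb L / 2" "\<forall>\<^sub>F \<epsilon> in at_right 0. m (nb \<epsilon> H) < mb L / 2"
    using mbL by (intro mb_less; simp)+
  from eventually_conj[OF eventually_at_right_less[of 0] eventually_conj[OF ev]] obtain \<epsilon> where \<epsilon>: "0 < \<epsilon>" "m (nb \<epsilon> K) < mb L / 2" "m (nb \<epsilon> H) < mb L / 2"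
    using eventually_happens'[OF trivial_limit_at_right_real] by blast
  \<comment> \<open>The width is small enough to beat the expansion of \<open>tr (g j)\<close>: a
    unit vector within \<open>d j\<close> of \<open>l\<close> in \<open>L\<close> is moved to within
    \<open>1 / Suc j\<close> of the translate of \<open>l\<close>.\<close>
  define d where "d = (\<lambda>j. 1 / (real (Suc j) * opb (g j)))"
  have dpos: "0 < d j" for j using opb_pos[of "g j"] by (simp add: d_def)
  have opb1: "1 \<le> opb (g j)" for j
    by (simp add: opb_def sum_nonneg pb_nonneg)
  have dle: "d j \<le> 1 / real (Suc j)" for j
    using opb1[of j] unfolding d_def by (intro divide_left_mono) auto
  have d0: "d \<longlonglongrightarrow> 0"
  proof (rule tendsto_sandwich[of "\<lambda>_. 0"])
    show "(\<lambda>j. 1 / real (Suc j)) \<longlonglongrightarrow> 0" by (rule LIMSEQ_Suc[OF lim_const_over_n])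
  qed (auto intro!: always_eventually less_imp_le[OF dpos] dle[simplified])
  have "\<exists>j. \<forall>f\<in>nb (d j) L. f \<in> nb \<epsilon> K \<or> tr (g j) f \<in> nb \<epsilon> H"
  proof (rule ccontr)
    assume neg: "\<not> ?thesis"
    \<comment> \<open>Normalised counterexamples have a limit \<open>f\<close> in \<open>L\<close>
      outside \<open>K\<close>. Their translates divided by \<open>c\<close> converge to the image
      \<open>w\<close> of \<open>f\<close>, a nonzero element of \<open>H\<close>, so they enter the
      cone around \<open>H\<close> after all.\<close>
    have "\<exists>u. u \<in> nb (d j) L \<and> u \<notin> nb \<epsilon> K \<and> tr (g j) u \<notin> nb \<epsilon> H \<and> nrm u = 1" for j
    proof -
      obtain f where f: "f \<in> nb (d j) L" "f \<notin> nb \<epsilon> K" "tr (g j) f \<notin> nb \<epsilon> H" using neg by blast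
      obtain a where a: "a \<noteq> 0" "nrm (a *\<^sub>R f) = 1" using nb_unit[OF Ls f(1)] by blast
      show ?thesis using f a nb_scale[OF Ls a(1)] nb_scale[OF K(1) a(1)] nb_scale[OF H(1) a(1)]
        by (intro exI[of _ "a *\<^sub>R f"]) (simp add: linear_scale[OF linear_tr])
    qed
    then obtain u where u: "\<And>j. u j \<in> nb (d j) L" "\<And>j. u j \<notin> nb \<epsilon> K"
      "\<And>j. tr (g j) (u j) \<notin> nb \<epsilon> H" "\<And>j. nrm (u j) = 1" by metis
    have uZ: "u j \<in> Z" for j using u(1)[of j] unfolding nb_def by blast
    obtain q f where q: "strict_mono (q :: nat \<Rightarrow> nat)" and f: "\<And>x. (\<lambda>j. u (q j) x) \<longlonglongrightarrow> f x"
      using compactZ[where f = u and C = 1] uZ u(4) by auto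
    have "\<forall>j. \<exists>l. l \<in> L \<and> nrm (u j - l) \<le> d j" using unit_in_nbD(2)[OF u(1,4)] by blast
    then obtain l where l: "\<And>j. l j \<in> L" "\<And>j. nrm (u j - l j) \<le> d j" by metis
    have dq: "(\<lambda>j. d (q j)) \<longlonglongrightarrow> 0" using LIMSEQ_subseq_LIMSEQ[OF d0 q] by (simp add: o_def)
    have lim: "(\<lambda>j. l (q j) x) \<longlonglongrightarrow> f x" "f \<in> L" for x
      using limit_in_subspace[OF LZ Ls, of "\<lambda>j. u (q j)" f "\<lambda>j. l (q j)" "\<lambda>j. d (q j)"] uZ f l dq by auto
    have "f \<notin> K"
    proof
      assume "f \<in> K"
      have "\<forall>\<^sub>F j in sequentially. nrm (u (q j) - f) < \<epsilon>"
        using order_tendstoD(2)[OF nrm_diff_tendsto[where f = "\<lambda>j. u (q j)", OF f] \<epsilon>(1)] .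
      then obtain j where "nrm (u (q j) - f) < \<epsilon>" using eventually_happens'[OF sequentially_bot] by blast
      then have "u (q j) \<in> nb \<epsilon> K" using unit_in_nbI[OF uZ u(4) \<open>f \<in> K\<close>] by simp
      with u(2) show False by blast
    qed
    then have fA: "(\<Sum>i<n. f (t i) * A (i, k0)) \<noteq> 0" using lim(2) by (simp add: K_def)
    define a where "a = (\<lambda>k. \<Sum>i<n. f (t i) * A (i, k))"
    define w where "w = (\<lambda>x. \<Sum>k<n. a k * e k x)"
    have w_sum: "w = (\<Sum>k<n. a k *\<^sub>R e k)" by (rule ext) (simp add: w_def sum_fun_apply)
    have wL: "w \<in> L" unfolding w_sum using frameD(2)[OF fr] by (intro subspace_sum subspace_scale Ls) auto
    have wt: "w (t k) = a k" if "k < n" for k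
    proof -
      have "w (t k) = (\<Sum>j<n. if j = k then a k else 0)"
        unfolding w_def using frameD(3)[OF fr _ that] by (intro sum.cong) auto
      then show ?thesis using that by simp
    qed
    have "w (t k0) \<noteq> 0" using wt[OF ik0(2)] fA by (simp add: a_def)
    then have w0: "w \<noteq> 0" by auto
    have "(\<Sum>k<n. w (t k) * v k) = (\<Sum>k<n. \<Sum>i<n. f (t i) * (A (i, k) * v k))"
      using wt by (simp add: a_def sum_distrib_right mult.assoc)
    also have "\<dots> = (\<Sum>i<n. f (t i) * (\<Sum>k<n. A (i, k) * v k))"
      unfolding sum_distrib_left by (rule sum.swap)
    also have "\<dots> = 0" using v(3) by simp
    finally have wH: "w \<in> H" using wL by (simp add: H_def)
    define y where "y = (\<lambda>j. (1 / c (q j)) *\<^sub>R tr (g (q j)) (u (q j)))"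
    have yZ: "y j \<in> Z" for j unfolding y_def by (intro subspace_scale[OF subZ] tr_Z uZ gd)
    have ylim: "(\<lambda>j. y j x) \<longlonglongrightarrow> w x" for x
    proof -
      have e1: "tr (g j) (l j) x = (\<Sum>k<n. (\<Sum>i<n. l j (t i) * e i (act (g j) (t k))) * e k x)" for j x
      proof -
        have "tr (g j) (l j) \<in> L" by (rule Li[OF l(1) gd])
        from frameD(4)[OF fr this, of x]
        have "tr (g j) (l j) x = (\<Sum>k<n. l j (act (g j) (t k)) * e k x)" by (simp only: tr_apply)
        also have "\<dots> = (\<Sum>k<n. (\<Sum>i<n. l j (t i) * e i (act (g j) (t k))) * e k x)"
          by (intro sum.cong refl arg_cong2[where f = "(*)"] frameD(4)[OF fr l(1)])
        finally show ?thesis .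
      qed
      have "(\<lambda>j. \<Sum>k<n. (\<Sum>i<n. l (q j) (t i) * (e i (act (g (q j)) (t k)) / c (q j))) * e k x) \<longlonglongrightarrow> w x"
        unfolding w_def a_def
      proof (intro tendsto_sum tendsto_mult tendsto_const lim)
        fix i k assume "k \<in> {..<n}" "i \<in> {..<n}"
        then show "(\<lambda>j. e i (act (g (q j)) (t k)) / c (q j)) \<longlonglongrightarrow> A (i, k)"
          using LIMSEQ_subseq_LIMSEQ[OF A q] by (simp add: o_def)
      qed
      moreover have "(\<Sum>k<n. (\<Sum>i<n. l (q j) (t i) * (e i (act (g (q j)) (t k)) / c (q j))) * e k x)
        = tr (g (q j)) (l (q j)) x / c (q j)" for j
        unfolding e1 by (simp add: sum_divide_distrib[symmetric])
      ultimately have main: "(\<lambda>j. tr (g (q j)) (l (q j)) x / c (q j)) \<longlonglongrightarrow> w x" by simp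
      have "(\<lambda>j. y j x - tr (g (q j)) (l (q j)) x / c (q j)) \<longlonglongrightarrow> 0"
      proof (rule Lim_null_comparison)
        show "(\<lambda>j. pb x * (1 / real (Suc (q j)))) \<longlonglongrightarrow> 0"
          using LIMSEQ_subseq_LIMSEQ[OF LIMSEQ_Suc[OF lim_const_over_n[of 1]] q]
            tendsto_mult[OF tendsto_const[of "pb x"]] by (fastforce simp: o_def)
        show "\<forall>\<^sub>F j in sequentially. norm (y j x - tr (g (q j)) (l (q j)) x / c (q j)) \<le> pb x * (1 / real (Suc (q j)))"
        proof (intro always_eventually allI)
          fix j
          let ?z = "u (q j) - l (q j)"
          have zZ: "?z \<in> Z" using l(1) LZ by (intro subspace_diff[OF subZ] uZ) blast
          have "\<bar>tr (g (q j)) ?z x\<bar> \<le> pb x * nrm (tr (g (q j)) ?z)" by (rule pt_bound[OF tr_Z[OF zZ gd]])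
          also have "\<dots> \<le> pb x * (opb (g (q j)) * d (q j))"
            using nrm_tr[OF zZ, of "g (q j)"] l(2)[of "q j"] opb_pos[of "g (q j)"]
            by (intro mult_left_mono pb_nonneg) (meson less_imp_le mult_left_mono order_trans)
          also have "opb (g (q j)) * d (q j) = 1 / real (Suc (q j))"
            using opb_pos[of "g (q j)"] by (simp add: d_def)
          finally have b: "\<bar>tr (g (q j)) ?z x\<bar> \<le> pb x * (1 / real (Suc (q j)))" .
          have "1 \<le> c (q j)" using cge[of "q j"] by simp
          then have "\<bar>tr (g (q j)) ?z x\<bar> / c (q j) \<le> \<bar>tr (g (q j)) ?z x\<bar>"
            by (simp add: divide_le_eq mult_le_cancel_left1)
          moreover have "y j x - tr (g (q j)) (l (q j)) x / c (q j) = tr (g (q j)) ?z x / c (q j)"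
            by (simp add: y_def tr_apply diff_divide_distrib)
          ultimately show "norm (y j x - tr (g (q j)) (l (q j)) x / c (q j)) \<le> pb x * (1 / real (Suc (q j)))"
            using b cpos[of "q j"] by simp
        qed
      qed
      from tendsto_add[OF this main] show ?thesis by simp
    qed
    have nw: "0 < nrm w" using nrm_pos[OF _ w0] wL LZ by blast
    have "(\<lambda>j. nrm (y j - w) - \<epsilon> * nrm (y j)) \<longlonglongrightarrow> 0 - \<epsilon> * nrm w"
      by (intro tendsto_diff tendsto_mult tendsto_const nrm_diff_tendsto nrm_tendsto ylim)
    moreover have "0 - \<epsilon> * nrm w < 0" using nw \<epsilon>(1) by simp
    ultimately have "\<forall>\<^sub>F j in sequentially. nrm (y j - w) - \<epsilon> * nrm (y j) < 0" by (rule order_tendstoD(2))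
    moreover have "\<forall>\<^sub>F j in sequentially. 0 < nrm (y j)" using order_tendstoD(1)[OF nrm_tendsto[OF ylim] nw] .
    ultimately have "\<forall>\<^sub>F j in sequentially. nrm (y j - w) - \<epsilon> * nrm (y j) < 0 \<and> 0 < nrm (y j)"
      by (rule eventually_conj)
    then obtain j where j: "nrm (y j - w) - \<epsilon> * nrm (y j) < 0" "0 < nrm (y j)"
      using eventually_happens'[OF sequentially_bot] by blast
    have "y j \<noteq> 0" using j(2) by (auto simp: nrm_def)
    then have "y j \<in> nb \<epsilon> H" using j(1) yZ wH unfolding nb_def by (auto intro!: bexI[of _ w])
    moreover have "1 / c (q j) \<noteq> 0" using cpos[of "q j"] by simp
    ultimately have "tr (g (q j)) (u (q j)) \<in> nb \<epsilon> H" unfolding y_def using nb_scale[OF H(1)] by blast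
    with u(3) show False by blast
  qed
  then obtain j where j: "\<And>f. f \<in> nb (d j) L \<Longrightarrow> f \<in> nb \<epsilon> K \<or> tr (g j) f \<in> nb \<epsilon> H" by blast
  have "mb L \<le> m (nb (d j) L)" by (rule mb_le[OF dpos])
  also have "\<dots> \<le> m (nb \<epsilon> K \<union> {f. tr (g j) f \<in> nb \<epsilon> H})" using j by (intro m_mono) blast
  also have "\<dots> \<le> m (nb \<epsilon> K) + m {f. tr (g j) f \<in> nb \<epsilon> H}" by (rule m_sub)
  also have "m {f. tr (g j) f \<in> nb \<epsilon> H} = m (nb \<epsilon> H)" by (rule m_inv[OF gG]) (rule nb_scale[OF H(1)])
  finally show False using \<epsilon> by linarith
qed

end

end

context fun_rep
begin

text \<open>The circumcentre argument: \<open>\<Phi> F\<close>, the supremum of the squared Euclidean norms of the translates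
  of \<open>F\<close>, is uniformly convex, so minimizing sequences converge and the limit is invariant.\<close>

lemma bounded_fixed_point:
  assumes G_det: "\<And>g. g \<in> G \<Longrightarrow> det g = 1"
    and G_one: "mat 1 \<in> G"
    and G_mult: "\<And>g h. g \<in> G \<Longrightarrow> h \<in> G \<Longrightarrow> g ** h \<in> G"
    and G_inv: "\<And>g. g \<in> G \<Longrightarrow> \<exists>h\<in>G. g ** h = mat 1 \<and> h ** g = mat 1"
    and bnd: "\<And>F x. F \<in> Z \<Longrightarrow> \<exists>B. \<forall>g\<in>G. \<bar>F (act g x)\<bar> \<le> B"
    and CZ: "C \<subseteq> Z" and c0: "c0 \<in> C"
    and mid: "\<And>F F'. F \<in> C \<Longrightarrow> F' \<in> C \<Longrightarrow> (1 / 2) *\<^sub>R (F + F') \<in> C"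
    and C_inv: "\<And>F g. F \<in> C \<Longrightarrow> g \<in> G \<Longrightarrow> tr g F \<in> C"
  shows "\<exists>F f. (\<forall>n :: nat. f n \<in> C) \<and> F \<in> Z \<and> (\<forall>x. (\<lambda>n. f n x) \<longlonglongrightarrow> F x) \<and> (\<forall>g\<in>G. tr g F = F)"
proof -
  define N where "N = dim Z"
  define s where "s = fst frZ"
  define u where "u = snd frZ"
  have fr: "frame Z N s u" using frame_frZ by (simp add: N_def s_def u_def)
  define n2 where "n2 = (\<lambda>F. \<Sum>i<N. (F (s i) :: real)\<^sup>2)"
  have n2_nonneg: "0 \<le> n2 F" for F by (simp add: n2_def sum_nonneg)
  have n2_coord: "(F (s i))\<^sup>2 \<le> n2 F" if "i < N" for F i
    unfolding n2_def using that by (intro member_le_sum) auto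
  have "\<forall>i\<in>{..<N}. \<forall>k. \<exists>B. \<forall>g\<in>G. \<bar>u i (act g (s k))\<bar> \<le> B"
    using bnd frameD(2)[OF fr] by blast
  then obtain B0 where B0: "\<And>i k g. i < N \<Longrightarrow> g \<in> G \<Longrightarrow> \<bar>u i (act g (s k))\<bar> \<le> B0 i k"
    unfolding lessThan_iff Ball_def by metis
  define B where "B = (\<Sum>i<N. \<Sum>k<N. \<bar>B0 i k\<bar>)"
  have B: "\<bar>u i (act g (s k))\<bar> \<le> B" if "i < N" "k < N" "g \<in> G" for i k g
  proof -
    have "\<bar>u i (act g (s k))\<bar> \<le> \<bar>B0 i k\<bar>" using B0[OF that(1,3), of k] by linarith
    also have "\<dots> \<le> (\<Sum>k<N. \<bar>B0 i k\<bar>)" using that by (intro member_le_sum) auto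
    also have "\<dots> \<le> B" unfolding B_def using that
      by (intro member_le_sum[where f = "\<lambda>i. \<Sum>k<N. \<bar>B0 i k\<bar>"]) (auto intro: sum_nonneg)
    finally show ?thesis .
  qed
  \<comment> \<open>A bound for the squared Euclidean operator norm of all translations from
    \<open>G\<close>, by Cauchy-Schwarz; the added 1 keeps it positive when
    \<open>N = 0\<close>.\<close>
  define K where "K = real N * (real N * B\<^sup>2) + 1"
  have Kpos: "0 < K" unfolding K_def by (simp add: add_nonneg_pos)
  have upper: "n2 (tr g F) \<le> K * n2 F" if F: "F \<in> Z" and g: "g \<in> G" for F g
  proof -
    have "(F (act g (s k)))\<^sup>2 \<le> n2 F * (real N * B\<^sup>2)" if k: "k < N" for k
    proof -
      have "(F (act g (s k)))\<^sup>2 = (\<Sum>i<N. F (s i) * u i (act g (s k)))\<^sup>2"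
        using frameD(4)[OF fr F, of "act g (s k)"] by (rule arg_cong)
      also have "\<dots> \<le> (\<Sum>i<N. (F (s i))\<^sup>2) * (\<Sum>i<N. (u i (act g (s k)))\<^sup>2)"
        by (rule Cauchy_Schwarz_ineq_sum)
      also have "\<dots> \<le> n2 F * (\<Sum>i<N. B\<^sup>2)"
      proof -
        have "(u i (act g (s k)))\<^sup>2 \<le> B\<^sup>2" if "i < N" for i
          using B[OF that k g] by (intro abs_le_square_iff[THEN iffD1]) simp
        then have "(\<Sum>i<N. (u i (act g (s k)))\<^sup>2) \<le> (\<Sum>i<N. B\<^sup>2)" by (intro sum_mono) simp
        from mult_left_mono[OF this n2_nonneg[of F]] show ?thesis by (simp only: n2_def)
      qed
      finally show ?thesis by simp
    qed
    then have "(\<Sum>k<N. (F (act g (s k)))\<^sup>2) \<le> (\<Sum>k<N. n2 F * (real N * B\<^sup>2))"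
      by (intro sum_mono) auto
    moreover have "n2 (tr g F) = (\<Sum>k<N. (F (act g (s k)))\<^sup>2)" by (simp add: n2_def tr_apply)
    ultimately have "n2 (tr g F) \<le> (\<Sum>k<N. n2 F * (real N * B\<^sup>2))" by simp
    also have "\<dots> \<le> K * n2 F" by (simp add: K_def algebra_simps n2_nonneg)
    finally show ?thesis .
  qed
  have lower: "n2 F \<le> K * n2 (tr g F)" if F: "F \<in> Z" and g: "g \<in> G" for F g
  proof -
    obtain h where h: "h \<in> G" "g ** h = mat 1" using G_inv[OF g] by blast
    have "tr h (tr g F) = F" using h by (simp add: tr_mult[symmetric] tr_one)
    then show ?thesis using upper[OF tr_Z[OF F G_det[OF g]] h(1)] by simp
  qed
  define \<Phi> where "\<Phi> = (\<lambda>F. Sup ((\<lambda>g. n2 (tr g F)) ` G))"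
  have bdd: "bdd_above ((\<lambda>g. n2 (tr g F)) ` G)" if "F \<in> Z" for F
    using upper[OF that] by (intro bdd_aboveI[of _ "K * n2 F"]) auto
  have \<Phi>_ge: "n2 (tr g F) \<le> \<Phi> F" if "F \<in> Z" "g \<in> G" for F g
    unfolding \<Phi>_def using that by (intro cSup_upper bdd) auto
  have \<Phi>_le: "\<Phi> F \<le> b" if "\<And>g. g \<in> G \<Longrightarrow> n2 (tr g F) \<le> b" for F b
    unfolding \<Phi>_def using that G_one by (intro cSup_least) auto
  have \<Phi>_inv: "\<Phi> (tr h F) \<le> \<Phi> F" if "F \<in> Z" "h \<in> G" for h F
  proof (rule \<Phi>_le)
    fix g assume "g \<in> G"
    then show "n2 (tr g (tr h F)) \<le> \<Phi> F" using \<Phi>_ge[OF that(1) G_mult[OF that(2)]] by (simp add: tr_mult)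
  qed
  define I where "I = Inf (\<Phi> ` C)"
  have \<Phi>0: "0 \<le> \<Phi> F" if "F \<in> Z" for F
    using \<Phi>_ge[OF that G_one] n2_nonneg[of "tr (mat 1) F"] by linarith
  have I_le: "I \<le> \<Phi> F" if "F \<in> C" for F
    unfolding I_def using that CZ \<Phi>0 by (intro cInf_lower bdd_belowI[of _ 0]) auto
  \<comment> \<open>The parallelogram identity for each translate. As \<open>G\<close> is a group,
    \<open>n2\<close> of a translate of \<open>F - F'\<close> is at least
    \<open>n2 (F - F') / K\<close>, so the gain at the midpoint is uniform over \<open>G\<close> and
    survives the supremum.\<close>
  have key: "n2 (F - F') \<le> 2 * K * ((\<Phi> F - I) + (\<Phi> F' - I))" if F: "F \<in> C" "F' \<in> C" for F F'
  proof -
    have FZ: "F \<in> Z" "F' \<in> Z" "F - F' \<in> Z" using F CZ by (auto intro: subspace_diff[OF subZ])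
    have "\<Phi> ((1 / 2) *\<^sub>R (F + F')) \<le> \<Phi> F / 2 + \<Phi> F' / 2 - n2 (F - F') / (4 * K)"
    proof (rule \<Phi>_le)
      fix g assume g: "g \<in> G"
      have "n2 (tr g ((1 / 2) *\<^sub>R (F + F')))
        = (\<Sum>i<N. (F (act g (s i)))\<^sup>2 / 2 + (F' (act g (s i)))\<^sup>2 / 2 - (F (act g (s i)) - F' (act g (s i)))\<^sup>2 / 4)"
        unfolding n2_def tr_apply by (intro sum.cong refl) (simp add: power2_eq_square field_simps)
      also have "\<dots> = n2 (tr g F) / 2 + n2 (tr g F') / 2 - n2 (tr g (F - F')) / 4"
        unfolding n2_def tr_apply by (simp add: sum.distrib sum_subtractf sum_divide_distrib)
      also have "\<dots> \<le> \<Phi> F / 2 + \<Phi> F' / 2 - n2 (F - F') / (4 * K)"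
      proof -
        have "n2 (F - F') / (4 * K) \<le> n2 (tr g (F - F')) / 4"
          using lower[OF FZ(3) g] Kpos by (simp add: field_simps)
        then show ?thesis using \<Phi>_ge[OF FZ(1) g] \<Phi>_ge[OF FZ(2) g] by linarith
      qed
      finally show "n2 (tr g ((1 / 2) *\<^sub>R (F + F'))) \<le> \<Phi> F / 2 + \<Phi> F' / 2 - n2 (F - F') / (4 * K)" .
    qed
    then have "I \<le> \<Phi> F / 2 + \<Phi> F' / 2 - n2 (F - F') / (4 * K)" using I_le[OF mid[OF F]] by linarith
    then have "n2 (F - F') / (4 * K) \<le> ((\<Phi> F - I) + (\<Phi> F' - I)) / 2" by (simp add: field_simps)
    then show ?thesis using Kpos by (simp add: field_simps)
  qed
  have "\<exists>F\<in>C. \<Phi> F < I + 1 / real (Suc n)" for n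
  proof -
    have "Inf (\<Phi> ` C) < I + 1 / real (Suc n)" by (simp add: I_def)
    from cInf_lessD[OF _ this] c0 show ?thesis by auto
  qed
  then obtain f where f: "\<And>n. f n \<in> C" "\<And>n. \<Phi> (f n) < I + 1 / real (Suc n)" by metis
  have fZ: "f n \<in> Z" for n using f(1) CZ by blast
  have "Cauchy (\<lambda>n. f n (s i))" if i: "i < N" for i
  proof (rule metric_CauchyI)
    fix e :: real assume e: "0 < e"
    obtain M where M: "4 * K / e\<^sup>2 < real M" using reals_Archimedean2 by blast
    have M0: "0 < M" using M e Kpos by (metis divide_pos_pos less_trans mult_pos_pos of_nat_0_less_iff zero_less_numeral zero_less_power)
    have "dist (f a (s i)) (f b (s i)) < e" if ab: "M \<le> a" "M \<le> b" for a b
    proof -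
      have inv: "1 / real (Suc a) \<le> 1 / real M" "1 / real (Suc b) \<le> 1 / real M"
        using ab M0 by (auto intro!: divide_left_mono)
      have "(f a (s i) - f b (s i))\<^sup>2 \<le> n2 (f a - f b)" using n2_coord[OF i, of "f a - f b"] by simp
      also have "\<dots> \<le> 2 * K * ((\<Phi> (f a) - I) + (\<Phi> (f b) - I))" by (rule key[OF f(1) f(1)])
      also have "\<dots> \<le> 2 * K * (1 / real M + 1 / real M)"
        using f(2)[of a] f(2)[of b] inv Kpos by (intro mult_left_mono) linarith+
      also have "\<dots> < e\<^sup>2" using M M0 e by (simp add: field_simps)
      finally have "\<bar>f a (s i) - f b (s i)\<bar> < e"
        using e by (intro power2_less_imp_less[of "\<bar>f a (s i) - f b (s i)\<bar>" e]) simp_all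
      then show ?thesis by (simp add: dist_real_def)
    qed
    then show "\<exists>M. \<forall>m\<ge>M. \<forall>n\<ge>M. dist (f m (s i)) (f n (s i)) < e" by blast
  qed
  then have "\<forall>i. \<exists>l. i < N \<longrightarrow> (\<lambda>n. f n (s i)) \<longlonglongrightarrow> l"
    using Cauchy_convergent convergent_def by blast
  then obtain l where l: "\<And>i. i < N \<Longrightarrow> (\<lambda>n. f n (s i)) \<longlonglongrightarrow> l i" by metis
  define F where "F = (\<lambda>x. \<Sum>i<N. l i * u i x)"
  have conv: "(\<lambda>n. f n x) \<longlonglongrightarrow> F x" for x
  proof -
    have "(\<lambda>n. \<Sum>i<N. f n (s i) * u i x) \<longlonglongrightarrow> F x"
      unfolding F_def using l by (intro tendsto_sum tendsto_mult tendsto_const) auto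
    then show ?thesis using frameD(4)[OF fr fZ, of _ x] by presburger
  qed
  have FZ: "F \<in> Z" by (rule closed_subspace[OF order_refl subZ fZ conv])
  have "tr h F = F" if h: "h \<in> G" for h
  proof
    fix x
    have eq: "F (act h (s i)) = F (s i)" if i: "i < N" for i
    proof -
      \<comment> \<open>Translation by \<open>h\<close> does not increase \<open>\<Phi>\<close>, so
        \<open>tr h (f n)\<close> is minimizing along with \<open>f n\<close>, and
        \<open>key\<close> forces the two sequences together.\<close>
      have "(\<lambda>n. f n (s i) - f n (act h (s i))) \<longlonglongrightarrow> 0"
      proof (rule Lim_null_comparison)
        show "\<forall>\<^sub>F n in sequentially. norm (f n (s i) - f n (act h (s i))) \<le> sqrt (4 * K * (1 / real (Suc n)))"
        proof (intro always_eventually allI)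
          fix n
          have "(f n (s i) - f n (act h (s i)))\<^sup>2 \<le> n2 (f n - tr h (f n))"
            using n2_coord[OF i, of "f n - tr h (f n)"] by (simp add: tr_apply)
          also have "\<dots> \<le> 2 * K * ((\<Phi> (f n) - I) + (\<Phi> (tr h (f n)) - I))" by (rule key[OF f(1) C_inv[OF f(1) h]])
          also have "\<dots> \<le> 2 * K * (1 / real (Suc n) + 1 / real (Suc n))"
            using f(2)[of n] \<Phi>_inv[OF fZ h, of n] Kpos by (intro mult_left_mono) linarith+
          finally have "(f n (s i) - f n (act h (s i)))\<^sup>2 \<le> 4 * K * (1 / real (Suc n))" by simp
          from real_sqrt_le_mono[OF this]
          show "norm (f n (s i) - f n (act h (s i))) \<le> sqrt (4 * K * (1 / real (Suc n)))"
            by (simp only: real_sqrt_abs real_norm_def)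
        qed
        have "(\<lambda>n. 4 * K * (1 / real (Suc n))) \<longlonglongrightarrow> 4 * K * 0"
          by (intro tendsto_mult tendsto_const LIMSEQ_Suc[OF lim_const_over_n])
        from tendsto_real_sqrt[OF this] show "(\<lambda>n. sqrt (4 * K * (1 / real (Suc n)))) \<longlonglongrightarrow> 0" by simp
      qed
      moreover have "(\<lambda>n. f n (s i) - f n (act h (s i))) \<longlonglongrightarrow> F (s i) - F (act h (s i))"
        by (intro tendsto_diff conv)
      ultimately have "F (s i) - F (act h (s i)) = 0" using LIMSEQ_unique by blast
      then show ?thesis by simp
    qed
    have "tr h F x = (\<Sum>i<N. tr h F (s i) * u i x)" by (rule frameD(4)[OF fr tr_Z[OF FZ G_det[OF h]]])
    also have "\<dots> = (\<Sum>i<N. F (s i) * u i x)" using eq by (intro sum.cong) (auto simp: tr_apply)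
    also have "\<dots> = F x" by (rule frameD(4)[OF fr FZ, symmetric])
    finally show "tr h F x = F x" .
  qed
  then show ?thesis using f(1) FZ conv by blast
qed

end

section \<open>From bounded orbits of the subgroup to bounded orbits of the whole group\<close>

context inv_mean
begin

text \<open>Since \<open>G\<close> acts on \<open>L\<close> with bounded matrices, it preserves a
  positive quadratic expression in the functions of \<open>L\<close>, found as a fixed point. Its
  invariance is a polynomial condition and extends to the whole group by density; being invariant,
  it bounds entire orbits.\<close>

theorem bounded_vector:
  "\<exists>f\<in>Z. f \<noteq> 0 \<and> (\<forall>x. \<exists>K. \<forall>g. det g = 1 \<longrightarrow> \<bar>f (act g x)\<bar> \<le> K)"
proof -
  obtain L where Ls: "subspace L" and LZ: "L \<subseteq> Z" and mbL: "0 < mb L"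
    and minL: "\<And>L'. subspace L' \<Longrightarrow> L' \<subseteq> Z \<Longrightarrow> dim L' < dim L \<Longrightarrow> mb L' = 0"
    by (rule minimal_subspace) blast
  define n where "n = dim L"
  obtain t e where fr: "frame L n t e" unfolding n_def using fd_frame[OF fd_subspace[OF fdZ LZ Ls]] by blast
  have Li: "tr g f \<in> L" if "f \<in> L" "det g = 1" for f g
    by (rule L_invariant[OF Ls LZ mbL _ that]) (rule minL)
  have "\<exists>K. \<forall>g\<in>G. \<forall>i<n. \<forall>k<n. \<bar>e i (act g (t k))\<bar> \<le> K"
    by (rule G_bounded_on_L[OF Ls LZ mbL _ fr]) (rule minL)
  then obtain K0 where K0: "\<And>g i k. g \<in> G \<Longrightarrow> i < n \<Longrightarrow> k < n \<Longrightarrow> \<bar>e i (act g (t k))\<bar> \<le> K0" by blast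
  have "L \<noteq> {0}" using mbL mb_zero by auto
  moreover have "f = 0" if "f \<in> L" "n = 0" for f
  proof
    fix x
    have "f x = (\<Sum>i<n. f (t i) * e i x)" by (rule frameD(4)[OF fr that(1)])
    also have "\<dots> = 0" unfolding that(2) by simp
    finally show "f x = 0 x" by simp
  qed
  ultimately have n0: "0 < n" using subspace_0[OF Ls] by blast
  have coef: "e i (act g x) = (\<Sum>k<n. e i (act g (t k)) * e k x)" if "i < n" "det g = 1" for i g x
    by (rule coef_expand[OF fr LZ Li that])
  \<comment> \<open>\<open>q x\<close> is the squared length of the evaluation at \<open>x\<close>
    in the coordinates of the frame. The invariant expression is sought in the span \<open>Y\<close>
    of products of two basis functions, which contains \<open>q\<close>.\<close>
  define q where "q = (\<lambda>x. \<Sum>i<n. (e i x)\<^sup>2)"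
  define E where "E = e ` {..<n}"
  define Y where "Y = span {\<lambda>x. a x * b x | a b. a \<in> E \<and> b \<in> E}"
  have LE: "L = span E" unfolding E_def by (rule frame_basis(1)[OF fr])
  have prodY: "(\<lambda>x. a x * b x) \<in> Y" if "a \<in> L" "b \<in> L" for a b
    using span_mult[of a E b E] that unfolding Y_def LE by blast
  have EL: "E \<subseteq> L" unfolding LE by (rule span_superset)
  have YS: "(\<lambda>x. F (act g x)) \<in> Y" if F: "F \<in> Y" and g: "det g = 1" for F g
    unfolding Y_def
  proof (rule span_comp[where h = "act g", OF _ F[unfolded Y_def]])
    fix f assume "f \<in> {\<lambda>x. a x * b x | a b. a \<in> E \<and> b \<in> E}"
    then obtain a b where ab: "f = (\<lambda>x. a x * b x)" "a \<in> L" "b \<in> L" using EL by blast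
    have "(\<lambda>x. tr g a x * tr g b x) \<in> Y" by (intro prodY Li ab g)
    then show "(\<lambda>x. f (act g x)) \<in> span {\<lambda>x. a x * b x | a b. a \<in> E \<and> b \<in> E}"
      by (simp add: ab(1) tr_def Y_def)
  qed
  have Ypoly: "\<exists>p. real_polynomial_function p \<and> (\<forall>g. det g = 1 \<longrightarrow> F (act g x) = p g)" if "F \<in> Y" for F x
    using that unfolding Y_def
  proof (induction F rule: span_induct_alt)
    case base
    then show ?case by (intro exI[of _ "\<lambda>_. 0"]) (auto simp: real_polynomial_function.intros(2))
  next
    case (step c f h)
    obtain a b where ab: "f = (\<lambda>x. a x * b x)" "a \<in> Z" "b \<in> Z" using step(1) EL LZ by blast
    obtain pa pb ph where p: "real_polynomial_function pa" "\<And>g. det g = 1 \<Longrightarrow> a (act g x) = pa g"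
      "real_polynomial_function pb" "\<And>g. det g = 1 \<Longrightarrow> b (act g x) = pb g"
      "real_polynomial_function ph" "\<And>g. det g = 1 \<Longrightarrow> h (act g x) = ph g"
      using Z_poly[OF ab(2), of x] Z_poly[OF ab(3), of x] step(2) by blast
    have "real_polynomial_function (\<lambda>g. c * (pa g * pb g) + ph g)"
      using p by (intro real_polynomial_function.intros(2,3,4))
    then show ?case using p by (intro exI[of _ "\<lambda>g. c * (pa g * pb g) + ph g"]) (simp add: ab(1))
  qed
  have LB: "\<exists>B. \<forall>g\<in>G. \<bar>a (act g x)\<bar> \<le> B" if a: "a \<in> E" for a x
  proof -
    obtain i where i: "i < n" "a = e i" using a by (auto simp: E_def)
    have "\<bar>a (act g x)\<bar> \<le> (\<Sum>k<n. K0 * \<bar>e k x\<bar>)" if g: "g \<in> G" for g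
      unfolding i(2) coef[OF i(1) G_det[OF g], of x] using K0[OF g i(1)]
      by (intro order_trans[OF sum_abs] sum_mono) (auto simp: abs_mult intro: mult_right_mono)
    then show ?thesis by blast
  qed
  have YB: "\<exists>B. \<forall>g\<in>G. \<bar>F (act g x)\<bar> \<le> B" if "F \<in> Y" for F x
    using that unfolding Y_def
  proof (induction F rule: span_induct_alt)
    case base
    then show ?case by (intro exI[of _ 0]) auto
  next
    case (step c f h)
    obtain a b where ab: "f = (\<lambda>x. a x * b x)" "a \<in> E" "b \<in> E" using step(1) by blast
    obtain A B D where A: "\<And>g. g \<in> G \<Longrightarrow> \<bar>a (act g x)\<bar> \<le> A" and B: "\<And>g. g \<in> G \<Longrightarrow> \<bar>b (act g x)\<bar> \<le> B"
      and D: "\<And>g. g \<in> G \<Longrightarrow> \<bar>h (act g x)\<bar> \<le> D" using LB[OF ab(2)] LB[OF ab(3)] step(2) by blast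
    have "\<bar>(c *\<^sub>R f + h) (act g x)\<bar> \<le> \<bar>c\<bar> * (A * B) + D" if g: "g \<in> G" for g
    proof -
      have "\<bar>(c *\<^sub>R f + h) (act g x)\<bar> \<le> \<bar>c\<bar> * (\<bar>a (act g x)\<bar> * \<bar>b (act g x)\<bar>) + \<bar>h (act g x)\<bar>"
        using abs_triangle_ineq[of "c * (a (act g x) * b (act g x))" "h (act g x)"] by (simp add: ab(1) abs_mult)
      also have "\<dots> \<le> \<bar>c\<bar> * (A * B) + D"
        using A[OF g] B[OF g] by (intro add_mono mult_left_mono mult_mono D[OF g]) auto
      finally show ?thesis .
    qed
    then show ?case by blast
  qed
  have fdY: "fd Y"
  proof -
    have "{\<lambda>x. a x * b x | a b. a \<in> E \<and> b \<in> E} = (\<lambda>(a, b) x. a x * b x) ` (E \<times> E)" by auto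
    then show ?thesis unfolding Y_def by (intro fd_span) (simp add: E_def)
  qed
  interpret Y: fun_rep act Y
    by unfold_locales (rule act_one act_mult fdY YS Ypoly; assumption)+
  \<comment> \<open>Entries of the matrices of inverses are bounded by \<open>K0\<close> too, so
    moving a point by \<open>G\<close> shrinks \<open>q\<close> at most by this factor. The 1 in the
    denominator keeps it positive.\<close>
  define \<kappa> where "\<kappa> = 1 / (real n * (real n * K0\<^sup>2) + 1)"
  have kpos: "0 < \<kappa>" unfolding \<kappa>_def by (simp add: add_nonneg_pos)
  have qY: "q \<in> Y"
  proof -
    have "q = (\<Sum>i<n. (\<lambda>x. e i x * e i x))" by (auto simp: q_def sum_fun_apply power2_eq_square)
    also have "\<dots> \<in> Y" using frameD(2)[OF fr] by (intro subspace_sum Y.subZ prodY) auto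
    finally show ?thesis .
  qed
  have q_nonneg: "0 \<le> q x" for x by (simp add: q_def sum_nonneg)
  have q_low: "\<kappa> * q x \<le> q (act g x)" if g: "g \<in> G" for g x
  proof -
    obtain h where h: "h \<in> G" "h ** g = mat 1" using G_inv[OF g] by blast
    have "(e i x)\<^sup>2 \<le> (real n * K0\<^sup>2) * q (act g x)" if i: "i < n" for i
    proof -
      have "e i x = e i (act h (act g x))" using h(2) by (simp add: act_mult[symmetric] act_one)
      also have "\<dots> = (\<Sum>k<n. e i (act h (t k)) * e k (act g x))" by (rule coef[OF i G_det[OF h(1)]])
      finally have "(e i x)\<^sup>2 = (\<Sum>k<n. e i (act h (t k)) * e k (act g x))\<^sup>2" by (rule arg_cong)
      also have "\<dots> \<le> (\<Sum>k<n. (e i (act h (t k)))\<^sup>2) * q (act g x)"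
        unfolding q_def by (rule Cauchy_Schwarz_ineq_sum)
      also have "\<dots> \<le> (\<Sum>k<n. K0\<^sup>2) * q (act g x)"
      proof (intro mult_right_mono q_nonneg sum_mono)
        fix k assume "k \<in> {..<n}"
        then have "\<bar>e i (act h (t k))\<bar> \<le> \<bar>K0\<bar>" using K0[OF h(1) i, of k] by simp
        then show "(e i (act h (t k)))\<^sup>2 \<le> K0\<^sup>2" by (simp add: abs_le_square_iff)
      qed
      finally show ?thesis by simp
    qed
    then have "(\<Sum>i<n. (e i x)\<^sup>2) \<le> (\<Sum>i<n. (real n * K0\<^sup>2) * q (act g x))" by (intro sum_mono) auto
    then have "q x \<le> (\<Sum>i<n. (real n * K0\<^sup>2) * q (act g x))" by (simp only: q_def)
    also have "\<dots> \<le> (real n * (real n * K0\<^sup>2) + 1) * q (act g x)"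
      by (simp add: algebra_simps q_nonneg)
    finally have le: "q x \<le> (real n * (real n * K0\<^sup>2) + 1) * q (act g x)" .
    have "\<kappa> * q x \<le> \<kappa> * ((real n * (real n * K0\<^sup>2) + 1) * q (act g x))"
      using le kpos by (intro mult_left_mono) auto
    also have "\<dots> = q (act g x)" using kpos by (simp add: \<kappa>_def)
    finally show ?thesis .
  qed
  \<comment> \<open>The lower bound keeps fixed points away from the zero function, which would be a
    useless invariant; it holds along the orbit so that \<open>C\<close> is stable under
    translation.\<close>
  define C where "C = {F \<in> Y. \<forall>g\<in>G. \<forall>x. \<kappa> * q x \<le> F (act g x)}"
  have "\<exists>F f. (\<forall>n :: nat. f n \<in> C) \<and> F \<in> Y \<and> (\<forall>x. (\<lambda>n. f n x) \<longlonglongrightarrow> F x) \<and> (\<forall>g\<in>G. Y.tr g F = F)"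
  proof (rule Y.bounded_fixed_point[OF _ G_one G_mult G_inv YB])
    show "C \<subseteq> Y" by (auto simp: C_def)
    show "q \<in> C" using qY q_low by (simp add: C_def)
    fix F F' assume F: "F \<in> C" "F' \<in> C"
    have "(1 / 2) *\<^sub>R (F + F') \<in> Y"
      using F by (intro subspace_scale[OF Y.subZ] subspace_add[OF Y.subZ]) (auto simp: C_def)
    moreover have "\<kappa> * q x \<le> ((1 / 2) *\<^sub>R (F + F')) (act g x)" if "g \<in> G" for g x
    proof -
      have "\<kappa> * q x \<le> F (act g x)" "\<kappa> * q x \<le> F' (act g x)" using F that by (auto simp: C_def)
      then show ?thesis by simp
    qed
    ultimately show "(1 / 2) *\<^sub>R (F + F') \<in> C" by (simp add: C_def)
  next
    fix F h assume F: "F \<in> C" and h: "h \<in> G"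
    have "\<kappa> * q x \<le> Y.tr h F (act g x)" if "g \<in> G" for g x
      using F G_mult[OF h that] by (simp add: C_def Y.tr_apply act_mult[symmetric])
    moreover have "Y.tr h F \<in> Y" using Y.tr_Z F G_det[OF h] by (simp add: C_def)
    ultimately show "Y.tr h F \<in> C" by (simp add: C_def)
  qed (rule G_det)
  then obtain F f where f: "\<And>n :: nat. f n \<in> C" and FY: "F \<in> Y" and lim: "\<And>x. (\<lambda>n. f n x) \<longlonglongrightarrow> F x"
    and fix': "\<And>g. g \<in> G \<Longrightarrow> Y.tr g F = F" by blast
  have Fq: "\<kappa> * q x \<le> F x" for x
  proof (rule LIMSEQ_le_const[OF lim])
    have "\<kappa> * q x \<le> f n x" for n
      using f[of n] G_one by (auto simp: C_def act_one dest!: bspec[of G _ "mat 1"])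
    then show "\<exists>N. \<forall>n\<ge>N. \<kappa> * q x \<le> f n x" by blast
  qed
  have Finv: "F (act g x) = F x" if g: "det g = 1" for g x
  proof -
    obtain p where p: "real_polynomial_function p" "\<And>g. det g = 1 \<Longrightarrow> F (act g x) = p g" using Ypoly[OF FY] by blast
    \<comment> \<open>Along the orbit of \<open>x\<close>, \<open>F\<close> is a polynomial in the
      group element and is constant on \<open>G\<close>; density makes it constant on the whole
      group.\<close>
    have "p g - F x = 0"
    proof (rule dense[OF _ _ g])
      show "real_polynomial_function (\<lambda>g. p g - F x)"
        using p(1) by (intro real_polynomial_function_diff real_polynomial_function.intros(2))
      fix h assume h: "h \<in> G"
      then show "p h - F x = 0" using fun_cong[OF fix'[OF h], of x] p(2)[OF G_det[OF h]] by (simp add: Y.tr_apply)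
    qed
    then show ?thesis using p(2)[OF g] by simp
  qed
  have "\<bar>e 0 (act g x)\<bar> \<le> sqrt (F x / \<kappa>)" if g: "det g = 1" for g x
  proof -
    have "(e 0 (act g x))\<^sup>2 \<le> q (act g x)" unfolding q_def using n0 by (intro member_le_sum) auto
    also have "\<dots> \<le> F x / \<kappa>" using Fq[of "act g x"] Finv[OF g, of x] kpos by (simp add: field_simps)
    finally have "sqrt ((e 0 (act g x))\<^sup>2) \<le> sqrt (F x / \<kappa>)" by (rule real_sqrt_le_mono)
    then show ?thesis by (simp only: real_sqrt_abs)
  qed
  moreover have "e 0 \<in> Z" using frameD(2)[OF fr n0] LZ by blast
  moreover have "e 0 \<noteq> 0" using frameD(3)[OF fr n0 n0] by auto
  ultimately show ?thesis by blast
qed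

end

subsection \<open>Kesten's argument for doubly substochastic kernels\<close>

text \<open>The mass at \<open>w\<close> after \<open>n\<close> steps of the walk with kernel
  \<open>k\<close> started at \<open>o0\<close> and killed outside \<open>A\<close>. For finite
  \<open>A\<close> no summability question arises in a possibly uncountable state space.\<close>

primrec pth :: "('o \<Rightarrow> 'o \<Rightarrow> real) \<Rightarrow> 'o \<Rightarrow> 'o set \<Rightarrow> nat \<Rightarrow> 'o \<Rightarrow> real" where
  "pth k o0 A 0 w = (if w = o0 \<and> w \<in> A then 1 else 0)"
| "pth k o0 A (Suc n) w = (if w \<in> A then \<Sum>v\<in>A. pth k o0 A n v * k v w else 0)"

lemma pth_nonneg: "(\<And>v w. 0 \<le> k v w) \<Longrightarrow> 0 \<le> pth k o0 A n w"
  by (induction n arbitrary: w) (auto intro!: sum_nonneg)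

lemma pth_mono:
  assumes "\<And>v w. 0 \<le> k v w" "A \<subseteq> B" "finite B"
  shows "pth k o0 A n w \<le> pth k o0 B n w"
proof (induction n arbitrary: w)
  case 0
  then show ?case using assms(2) by auto
next
  case (Suc n)
  have "(\<Sum>v\<in>A. pth k o0 A n v * k v w) \<le> (\<Sum>v\<in>A. pth k o0 B n v * k v w)"
    by (intro sum_mono mult_right_mono Suc assms)
  also have "\<dots> \<le> (\<Sum>v\<in>B. pth k o0 B n v * k v w)"
    using assms pth_nonneg[of k o0 B n] by (intro sum_mono2) auto
  finally have "(\<Sum>v\<in>A. pth k o0 A n v * k v w) \<le> (\<Sum>v\<in>B. pth k o0 B n v * k v w)" .
  moreover have "0 \<le> pth k o0 B (Suc n) w" by (rule pth_nonneg[OF assms(1)])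
  ultimately show ?case using assms(2) by auto
qed

text \<open>The kernel \<open>k\<close> need not be symmetric, so the gap of the quadratic form only bounds the norm
  of its lazy version \<open>(1 + k) / 2\<close>. The \<open>2n\<close>-th power of the latter dominates the \<open>n\<close>-th
  power of \<open>k\<close> up to the factor given by the central binomial coefficient.\<close>

lemma kesten_finite:
  fixes k :: "'o \<Rightarrow> 'o \<Rightarrow> real"
  assumes A: "finite A" and k0: "\<And>v w. 0 \<le> k v w"
    and row: "\<And>v. v \<in> A \<Longrightarrow> (\<Sum>w\<in>A. k v w) \<le> 1"
    and col: "\<And>w. w \<in> A \<Longrightarrow> (\<Sum>v\<in>A. k v w) \<le> 1"
    and c: "c \<le> 1"
    and gap: "\<And>a. (\<And>v. 0 \<le> a v) \<Longrightarrow> (\<Sum>w\<in>A. \<Sum>v\<in>A. a v * k v w * a w) \<le> (1 - c) * (\<Sum>v\<in>A. (a v)\<^sup>2)"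
  shows "pth k o0 A n w \<le> (2 * n + 1) * (1 - c / 2) ^ n"
proof -
  define T where "T = (\<lambda>a w. \<Sum>v\<in>A. a v * k v w)"
  define N where "N = (\<lambda>a. \<Sum>w\<in>A. (a w :: real)\<^sup>2)"
  have N0: "0 \<le> N a" for a by (simp add: N_def sum_nonneg)
  \<comment> \<open>Schur's test: Cauchy-Schwarz against the weights \<open>k v w\<close> uses the
    column sums, and exchanging the sums then uses the row sums.\<close>
  have T_norm: "N (T a) \<le> N a" for a
  proof -
    have "(T a w)\<^sup>2 \<le> (\<Sum>v\<in>A. (a v)\<^sup>2 * k v w)" if w: "w \<in> A" for w
    proof -
      have "(T a w)\<^sup>2 = (\<Sum>v\<in>A. (a v * sqrt (k v w)) * sqrt (k v w))\<^sup>2"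
        unfolding T_def by (intro arg_cong[where f = "\<lambda>x. x\<^sup>2"] sum.cong refl) (simp add: k0 mult.assoc)
      also have "\<dots> \<le> (\<Sum>v\<in>A. (a v * sqrt (k v w))\<^sup>2) * (\<Sum>v\<in>A. (sqrt (k v w))\<^sup>2)"
        by (rule Cauchy_Schwarz_ineq_sum)
      also have "\<dots> = (\<Sum>v\<in>A. (a v)\<^sup>2 * k v w) * (\<Sum>v\<in>A. k v w)"
        by (simp add: power_mult_distrib k0)
      also have "\<dots> \<le> (\<Sum>v\<in>A. (a v)\<^sup>2 * k v w) * 1"
        by (intro mult_left_mono col w sum_nonneg) (simp add: k0)
      finally show ?thesis by simp
    qed
    then have "N (T a) \<le> (\<Sum>w\<in>A. \<Sum>v\<in>A. (a v)\<^sup>2 * k v w)" unfolding N_def by (intro sum_mono)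
    also have "\<dots> = (\<Sum>v\<in>A. (a v)\<^sup>2 * (\<Sum>w\<in>A. k v w))"
      unfolding sum_distrib_left by (rule sum.swap)
    also have "\<dots> \<le> (\<Sum>v\<in>A. (a v)\<^sup>2 * 1)" by (intro sum_mono mult_left_mono row) auto
    finally show ?thesis by (simp add: N_def)
  qed
  have lazy: "N (\<lambda>w. (a w + T a w) / 2) \<le> (1 - c / 2) * N a" if a: "\<And>v. 0 \<le> a v" for a
  proof -
    have "N (\<lambda>w. (a w + T a w) / 2) = (\<Sum>w\<in>A. (a w)\<^sup>2 / 4 + (T a w)\<^sup>2 / 4 + (T a w * a w) / 2)"
      unfolding N_def by (intro sum.cong refl) (simp add: power2_eq_square field_simps)
    also have "\<dots> = N a / 4 + N (T a) / 4 + (\<Sum>w\<in>A. T a w * a w) / 2"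
      unfolding N_def by (simp add: sum.distrib sum_divide_distrib)
    also have "(\<Sum>w\<in>A. T a w * a w) = (\<Sum>w\<in>A. \<Sum>v\<in>A. a v * k v w * a w)"
      unfolding T_def by (simp add: sum_distrib_right)
    also have "N a / 4 + N (T a) / 4 + (\<Sum>w\<in>A. \<Sum>v\<in>A. a v * k v w * a w) / 2
        \<le> N a / 4 + N a / 4 + ((1 - c) * N a) / 2"
    proof -
      have "(\<Sum>w\<in>A. \<Sum>v\<in>A. a v * k v w * a w) \<le> (1 - c) * N a"
        using gap[where a = a, OF a] by (simp only: N_def)
      then show ?thesis using T_norm[of a] by linarith
    qed
    finally show ?thesis by (simp add: field_simps)
  qed
  define p where "p = pth k o0 A"
  have p0: "0 \<le> p n w" for n w unfolding p_def by (rule pth_nonneg[OF k0])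
  have pT: "T (p n) w = p (Suc n) w" if "w \<in> A" for n w using that by (simp add: p_def T_def)
  \<comment> \<open>The point mass at \<open>o0\<close> after \<open>m\<close> applications of the
    lazy operator, expanded by the binomial theorem; \<open>l_Suc\<close> is Pascal's rule.\<close>
  define l where "l = (\<lambda>m w. (\<Sum>j\<le>m. real (m choose j) * p j w) / 2 ^ m)"
  have l0: "0 \<le> l m w" for m w unfolding l_def by (intro divide_nonneg_pos sum_nonneg mult_nonneg_nonneg p0) auto
  have l_Suc: "l (Suc m) w = (l m w + T (l m) w) / 2" if w: "w \<in> A" for m w
  proof -
    have "T (l m) w = (\<Sum>v\<in>A. \<Sum>j\<le>m. real (m choose j) * (p j v * k v w)) / 2 ^ m"
      unfolding T_def l_def by (simp add: sum_divide_distrib sum_distrib_right mult.assoc)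
    also have "\<dots> = (\<Sum>j\<le>m. real (m choose j) * T (p j) w) / 2 ^ m"
      unfolding T_def sum_distrib_left by (subst sum.swap) simp
    also have "\<dots> = (\<Sum>j\<le>m. real (m choose j) * p (Suc j) w) / 2 ^ m" using pT[OF w] by simp
    finally have Tl: "T (l m) w = (\<Sum>j\<le>m. real (m choose j) * p (Suc j) w) / 2 ^ m" .
    have "(\<Sum>j\<le>Suc m. real (Suc m choose j) * p j w)
      = p 0 w + (\<Sum>j\<le>m. real (m choose j) * p (Suc j) w) + (\<Sum>j\<le>m. real (m choose Suc j) * p (Suc j) w)"
      unfolding sum.atMost_Suc_shift by (simp add: sum.distrib algebra_simps)
    also have "p 0 w + (\<Sum>j\<le>m. real (m choose j) * p (Suc j) w) + (\<Sum>j\<le>m. real (m choose Suc j) * p (Suc j) w)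
      = (\<Sum>j\<le>Suc m. real (m choose j) * p j w) + (\<Sum>j\<le>m. real (m choose j) * p (Suc j) w)"
      unfolding sum.atMost_Suc_shift[of "\<lambda>j. real (m choose j) * p j w"] by simp
    also have "(\<Sum>j\<le>Suc m. real (m choose j) * p j w) = (\<Sum>j\<le>m. real (m choose j) * p j w)"
      by (simp add: binomial_eq_0)
    finally show ?thesis unfolding Tl unfolding l_def by (simp add: field_simps)
  qed
  have c2: "0 \<le> 1 - c / 2" using c by simp
  have Nl: "N (l m) \<le> (1 - c / 2) ^ m" for m
  proof (induction m)
    case 0
    have "N (l 0) = (\<Sum>w\<in>A. (if w = o0 then 1 else 0))"
      unfolding N_def by (intro sum.cong) (auto simp: l_def p_def)
    also have "\<dots> \<le> 1" using A by (simp add: sum.delta')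
    finally show ?case by simp
  next
    case (Suc m)
    have "N (l (Suc m)) = N (\<lambda>w. (l m w + T (l m) w) / 2)"
      unfolding N_def by (intro sum.cong refl arg_cong[where f = "\<lambda>x. x\<^sup>2"] l_Suc)
    also have "\<dots> \<le> (1 - c / 2) * N (l m)" by (rule lazy[OF l0])
    also have "\<dots> \<le> (1 - c / 2) * (1 - c / 2) ^ m" by (intro mult_left_mono Suc c2)
    finally show ?case by simp
  qed
  show ?thesis
  proof (cases "w \<in> A")
    case False
    then have "pth k o0 A n w = 0" by (cases n) auto
    then show ?thesis using c2 by simp
  next
    case True
    \<comment> \<open>The contraction factor \<open>1 - c / 2\<close> is for the squared norm, so
      \<open>2 * n\<close> steps give its \<open>n\<close>-th power after taking the root. The term
      \<open>j = n\<close> of the expansion is then isolated.\<close>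
    have "(l (2 * n) w)\<^sup>2 \<le> N (l (2 * n))" unfolding N_def using A True by (intro member_le_sum) auto
    also have "\<dots> \<le> ((1 - c / 2) ^ n)\<^sup>2" using Nl[of "2 * n"] by (simp add: power_mult[symmetric] mult.commute)
    finally have l_le: "l (2 * n) w \<le> (1 - c / 2) ^ n" by (rule power2_le_imp_le) (rule zero_le_power[OF c2])
    have "real (2 * n choose n) * p n w \<le> (\<Sum>j\<le>2 * n. real (2 * n choose j) * p j w)"
      using p0 by (intro member_le_sum[where f = "\<lambda>j. real (2 * n choose j) * p j w"]) auto
    then have "real (2 * n choose n) * p n w \<le> l (2 * n) w * 4 ^ n"
      unfolding l_def by (simp add: power_mult)
    also have "\<dots> \<le> (1 - c / 2) ^ n * 4 ^ n" by (intro mult_right_mono l_le) auto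
    also have "(4::real) ^ n \<le> (2 * n + 1) * real (2 * n choose n)"
    proof (cases "n = 0")
      case False
      then have "4 ^ n \<le> 2 * real n * real (2 * n choose n)"
        using central_binomial_lower_bound[of n] by (simp add: field_simps)
      also have "\<dots> \<le> (2 * n + 1) * real (2 * n choose n)" by (intro mult_right_mono) auto
      finally show ?thesis .
    qed simp
    finally have "real (2 * n choose n) * p n w \<le> (1 - c / 2) ^ n * ((2 * n + 1) * real (2 * n choose n))"
      using c2 by (simp add: mult_left_mono)
    then have "real (2 * n choose n) * p n w \<le> real (2 * n choose n) * ((2 * n + 1) * (1 - c / 2) ^ n)"
      by (simp add: algebra_simps)
    moreover have "0 < real (2 * n choose n)" by simp
    ultimately have "pth k o0 A n w \<le> real (2 * n + 1) * (1 - c / 2) ^ n"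
      unfolding p_def by (simp only: mult_le_cancel_left_pos)
    then show ?thesis by (simp add: add.commute)
  qed
qed

subsection \<open>Invariant means as generalized limits\<close>

text \<open>By Tychonoff the cube of set functions is compact, so the sequence has a cluster point.
  The filter \<open>H\<close> makes all coordinates converge simultaneously and plays the role of an
  ultrafilter limit.\<close>

lemma generalized_limit:
  fixes s :: "nat \<Rightarrow> 'i \<Rightarrow> real"
  assumes "\<And>n i. 0 \<le> s n i \<and> s n i \<le> 1"
  shows "\<exists>(m :: 'i \<Rightarrow> real) H. H \<noteq> bot \<and> H \<le> filtermap s sequentially \<and> (\<forall>i. ((\<lambda>u. u i) \<longlongrightarrow> m i) H)"
proof -
  let ?U = "PiE UNIV (\<lambda>_ :: 'i. {0..1 :: real})"
  have "compactin (product_topology (\<lambda>_. euclidean) UNIV) ?U"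
    by (subst compactin_PiE) auto
  then have comp: "compact ?U" by (simp add: euclidean_product_topology)
  have ev: "eventually (\<lambda>u. u \<in> ?U) (filtermap s sequentially)"
    unfolding eventually_filtermap using assms by (intro always_eventually) auto
  have "filtermap s sequentially \<noteq> bot" by (simp add: filtermap_bot_iff)
  then obtain m where m: "inf (nhds m) (filtermap s sequentially) \<noteq> bot"
    using comp ev unfolding compact_filter by blast
  have "((\<lambda>u. u i) \<longlongrightarrow> m i) (nhds m)" for i
  proof -
    show ?thesis
    proof (rule topological_tendstoI)
      fix S :: "real set" assume S: "open S" "m i \<in> S"
      have "open ((\<lambda>u :: 'i \<Rightarrow> real. u i) -` S)"
        by (rule open_vimage[OF S(1) continuous_on_product_coordinates])
      from eventually_nhds_in_open[OF this, of m] S(2) show "\<forall>\<^sub>F u in nhds m. u i \<in> S" by simp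
    qed
  qed
  then have "((\<lambda>u. u i) \<longlongrightarrow> m i) (inf (nhds m) (filtermap s sequentially))" for i
    using tendsto_mono[OF inf_le1] by blast
  with m show ?thesis by (intro exI[of _ m] exI[of _ "inf (nhds m) (filtermap s sequentially)"]) auto
qed

lemma bij_betw_vimage: "bij \<tau> \<Longrightarrow> bij_betw \<tau> (\<tau> -` A) A"
  by (simp add: bij_betw_def inj_on_subset[OF bij_is_inj] surj_image_vimage_eq[OF bij_is_surj])

text \<open>Translating a unit vector \<open>a\<close> by a bijection \<open>\<tau>\<close>: the correlation \<open>\<Sum> a v * a (\<tau> v)\<close> controls how far
  the probability measure with weights \<open>a\<^sup>2\<close> is from being invariant.\<close>

lemma correlation_norm:
  fixes a :: "'o \<Rightarrow> real"
  assumes A: "finite A" "\<And>v. v \<notin> A \<Longrightarrow> a v = 0" "(\<Sum>v\<in>A. (a v)\<^sup>2) = 1" and \<tau>: "bij \<tau>"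
    and B: "finite B" "A \<subseteq> B" "\<tau> -` A \<subseteq> B"
  shows "(\<Sum>v\<in>B. (a (\<tau> v) - a v)\<^sup>2) = 2 - 2 * (\<Sum>v\<in>A. a v * a (\<tau> v))"
    and "(\<Sum>v\<in>B. (a v)\<^sup>2) = 1" "(\<Sum>v\<in>B. (a (\<tau> v))\<^sup>2) = 1"
proof -
  show 1: "(\<Sum>v\<in>B. (a v)\<^sup>2) = 1"
    using sum.mono_neutral_left[OF B(1,2), of "\<lambda>v. (a v)\<^sup>2"] A by auto
  have "(\<Sum>v\<in>B. (a (\<tau> v))\<^sup>2) = (\<Sum>v\<in>\<tau> -` A. (a (\<tau> v))\<^sup>2)"
    using A by (intro sum.mono_neutral_right B) auto
  also have "\<dots> = (\<Sum>v\<in>A. (a v)\<^sup>2)"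
    by (rule sum.reindex_bij_betw[OF bij_betw_vimage[OF \<tau>]])
  finally show 2: "(\<Sum>v\<in>B. (a (\<tau> v))\<^sup>2) = 1" using A by simp
  have 3: "(\<Sum>v\<in>B. a v * a (\<tau> v)) = (\<Sum>v\<in>A. a v * a (\<tau> v))"
    using A by (intro sum.mono_neutral_right B) auto
  have "(\<Sum>v\<in>B. (a (\<tau> v) - a v)\<^sup>2) = (\<Sum>v\<in>B. (a (\<tau> v))\<^sup>2 + (a v)\<^sup>2 - 2 * (a v * a (\<tau> v)))"
    by (intro sum.cong refl) (simp add: power2_eq_square algebra_simps)
  also have "\<dots> = 1 + 1 - 2 * (\<Sum>v\<in>A. a v * a (\<tau> v))"
    by (simp add: sum.distrib sum_subtractf sum_distrib_left[symmetric] 1 2 3)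
  finally show "(\<Sum>v\<in>B. (a (\<tau> v) - a v)\<^sup>2) = 2 - 2 * (\<Sum>v\<in>A. a v * a (\<tau> v))" by simp
qed

text \<open>A difference of squares is the product of difference and sum. In Cauchy-Schwarz the
  first factor has norm \<open>sqrt (2 - 2 * \<phi>)\<close>, with \<open>\<phi>\<close> the
  correlation, and the second one at most 2.\<close>

lemma correlation_bound:
  fixes a :: "'o \<Rightarrow> real"
  assumes A: "finite A" "\<And>v. v \<notin> A \<Longrightarrow> a v = 0" "(\<Sum>v\<in>A. (a v)\<^sup>2) = 1" and \<tau>: "bij \<tau>"
  shows "(\<Sum>v\<in>A. a v * a (\<tau> v)) \<le> 1"
    and "\<bar>(\<Sum>v | v \<in> A \<and> \<tau> v \<in> E. (a v)\<^sup>2) - (\<Sum>v\<in>A \<inter> E. (a v)\<^sup>2)\<bar> \<le> 2 * sqrt (2 - 2 * (\<Sum>v\<in>A. a v * a (\<tau> v)))"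
proof -
  let ?\<phi> = "\<Sum>v\<in>A. a v * a (\<tau> v)"
  define B where "B = A \<union> \<tau> -` A"
  have inj: "inj \<tau>" using \<tau> by (simp add: bij_def)
  have B: "finite B" "A \<subseteq> B" "\<tau> -` A \<subseteq> B"
    using A(1) finite_vimageI[OF A(1) inj] by (auto simp: B_def)
  note cn = correlation_norm[OF A \<tau> B]
  have "0 \<le> (\<Sum>v\<in>B. (a (\<tau> v) - a v)\<^sup>2)" by (simp add: sum_nonneg)
  then show "?\<phi> \<le> 1" using cn(1) by simp
  have "(\<Sum>v\<in>A \<inter> E. (a v)\<^sup>2) = (\<Sum>v | v \<in> B \<and> \<tau> v \<in> E. (a (\<tau> v))\<^sup>2)"
  proof -
    have "(\<Sum>v | v \<in> B \<and> \<tau> v \<in> E. (a (\<tau> v))\<^sup>2) = (\<Sum>v\<in>\<tau> -` (A \<inter> E). (a (\<tau> v))\<^sup>2)"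
      using A B by (intro sum.mono_neutral_right) auto
    also have "\<dots> = (\<Sum>v\<in>A \<inter> E. (a v)\<^sup>2)"
      by (rule sum.reindex_bij_betw[OF bij_betw_vimage[OF \<tau>]])
    finally show ?thesis by simp
  qed
  moreover have "(\<Sum>v | v \<in> A \<and> \<tau> v \<in> E. (a v)\<^sup>2) = (\<Sum>v | v \<in> B \<and> \<tau> v \<in> E. (a v)\<^sup>2)"
    using A B by (intro sum.mono_neutral_left) auto
  ultimately have "\<bar>(\<Sum>v | v \<in> A \<and> \<tau> v \<in> E. (a v)\<^sup>2) - (\<Sum>v\<in>A \<inter> E. (a v)\<^sup>2)\<bar>
    = \<bar>\<Sum>v | v \<in> B \<and> \<tau> v \<in> E. (a v)\<^sup>2 - (a (\<tau> v))\<^sup>2\<bar>" by (simp add: sum_subtractf)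
  also have "\<dots> \<le> (\<Sum>v | v \<in> B \<and> \<tau> v \<in> E. \<bar>(a v)\<^sup>2 - (a (\<tau> v))\<^sup>2\<bar>)" by (rule sum_abs)
  also have "\<dots> \<le> (\<Sum>v\<in>B. \<bar>(a v)\<^sup>2 - (a (\<tau> v))\<^sup>2\<bar>)" using B by (intro sum_mono2) auto
  also have "\<dots> = (\<Sum>v\<in>B. \<bar>a (\<tau> v) - a v\<bar> * \<bar>a v + a (\<tau> v)\<bar>)"
    by (intro sum.cong refl) (simp add: abs_mult[symmetric] power2_eq_square algebra_simps abs_minus_commute)
  also have "\<dots> \<le> sqrt (\<Sum>v\<in>B. (a (\<tau> v) - a v)\<^sup>2) * sqrt (\<Sum>v\<in>B. (a v + a (\<tau> v))\<^sup>2)"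
    using L2_set_mult_ineq[of "\<lambda>v. a (\<tau> v) - a v" "\<lambda>v. a v + a (\<tau> v)" B] by (simp add: L2_set_def)
  also have "\<dots> \<le> sqrt (2 - 2 * ?\<phi>) * 2"
  proof -
    have "(\<Sum>v\<in>B. (a v + a (\<tau> v))\<^sup>2) \<le> (\<Sum>v\<in>B. 2 * (a v)\<^sup>2 + 2 * (a (\<tau> v))\<^sup>2)"
    proof (rule sum_mono)
      fix v
      show "(a v + a (\<tau> v))\<^sup>2 \<le> 2 * (a v)\<^sup>2 + 2 * (a (\<tau> v))\<^sup>2"
        using sum_squares_bound[of "a v" "a (\<tau> v)"] by (simp add: power2_sum)
    qed
    also have "\<dots> = 4" by (simp add: sum.distrib sum_distrib_left[symmetric] cn)
    finally have "sqrt (\<Sum>v\<in>B. (a v + a (\<tau> v))\<^sup>2) \<le> sqrt 4" by (rule real_sqrt_le_mono)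
    then have "sqrt (\<Sum>v\<in>B. (a v + a (\<tau> v))\<^sup>2) \<le> 2" by simp
    moreover have "sqrt (\<Sum>v\<in>B. (a (\<tau> v) - a v)\<^sup>2) = sqrt (2 - 2 * ?\<phi>)" using cn(1) by (rule arg_cong)
    ultimately show ?thesis using \<open>?\<phi> \<le> 1\<close> by (simp add: mult_left_mono)
  qed
  finally show "\<bar>(\<Sum>v | v \<in> A \<and> \<tau> v \<in> E. (a v)\<^sup>2) - (\<Sum>v\<in>A \<inter> E. (a v)\<^sup>2)\<bar> \<le> 2 * sqrt (2 - 2 * ?\<phi>)"
    by (simp add: mult.commute)
qed

lemma correlation_inverse:
  fixes a :: "'o \<Rightarrow> real"
  assumes A: "finite A" "\<And>v. v \<notin> A \<Longrightarrow> a v = 0" and \<tau>: "bij \<tau>" and inv: "\<And>v. \<sigma> (\<tau> v) = v"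
  shows "(\<Sum>v\<in>A. a v * a (\<sigma> v)) = (\<Sum>v\<in>A. a v * a (\<tau> v))"
proof -
  have inj: "inj \<tau>" using \<tau> by (simp add: bij_def)
  have "(\<Sum>v\<in>A. a v * a (\<sigma> v)) = (\<Sum>v\<in>\<tau> -` A. a (\<tau> v) * a (\<sigma> (\<tau> v)))"
    by (rule sum.reindex_bij_betw[OF bij_betw_vimage[OF \<tau>], symmetric])
  also have "\<dots> = (\<Sum>v\<in>A \<union> \<tau> -` A. a v * a (\<tau> v))"
    unfolding inv using A finite_vimageI[OF A(1) inj]
    by (intro sum.mono_neutral_cong_left) (auto simp: mult.commute)
  also have "\<dots> = (\<Sum>v\<in>A. a v * a (\<tau> v))"
    using A finite_vimageI[OF A(1) inj] by (intro sum.mono_neutral_right) auto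
  finally show ?thesis .
qed

text \<open>The defect of the correlation is half a squared distance, and squared distances satisfy
  a triangle inequality up to a factor 2. This makes the asymptotically invariant elements closed
  under products.\<close>

lemma correlation_comp:
  fixes a :: "'o \<Rightarrow> real"
  assumes A: "finite A" "\<And>v. v \<notin> A \<Longrightarrow> a v = 0" "(\<Sum>v\<in>A. (a v)\<^sup>2) = 1"
    and \<tau>: "bij \<tau>" and \<sigma>: "bij \<sigma>"
  shows "1 - (\<Sum>v\<in>A. a v * a (\<sigma> (\<tau> v)))
    \<le> 2 * (1 - (\<Sum>v\<in>A. a v * a (\<sigma> v))) + 2 * (1 - (\<Sum>v\<in>A. a v * a (\<tau> v)))"
proof -
  have st: "bij (\<lambda>v. \<sigma> (\<tau> v))" using bij_comp[OF \<tau> \<sigma>] by (simp add: o_def)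
  have inj: "inj \<tau>" "inj \<sigma>" "inj (\<lambda>v. \<sigma> (\<tau> v))" using \<tau> \<sigma> st by (auto simp: bij_def)
  define B where "B = A \<union> \<tau> -` A \<union> (\<lambda>v. \<sigma> (\<tau> v)) -` A"
  have B: "finite B" "A \<subseteq> B" "\<tau> -` A \<subseteq> B" "(\<lambda>v. \<sigma> (\<tau> v)) -` A \<subseteq> B"
    using A(1) finite_vimageI[OF A(1) inj(1)] finite_vimageI[OF A(1) inj(3)] by (auto simp: B_def)
  have B': "finite (\<tau> ` B)" "A \<subseteq> \<tau> ` B" "\<sigma> -` A \<subseteq> \<tau> ` B"
  proof -
    have "surj \<tau>" using \<tau> by (simp add: bij_def)
    show "finite (\<tau> ` B)" using B by simp
    show "A \<subseteq> \<tau> ` B"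
    proof
      fix v assume "v \<in> A"
      obtain u where "v = \<tau> u" using \<open>surj \<tau>\<close> by (metis surjD)
      then show "v \<in> \<tau> ` B" using \<open>v \<in> A\<close> B(3) by blast
    qed
    show "\<sigma> -` A \<subseteq> \<tau> ` B"
    proof
      fix v assume "v \<in> \<sigma> -` A"
      obtain u where "v = \<tau> u" using \<open>surj \<tau>\<close> by (metis surjD)
      then show "v \<in> \<tau> ` B" using \<open>v \<in> \<sigma> -` A\<close> B(4) by blast
    qed
  qed
  have "2 - 2 * (\<Sum>v\<in>A. a v * a (\<sigma> (\<tau> v))) = (\<Sum>v\<in>B. (a (\<sigma> (\<tau> v)) - a v)\<^sup>2)"
    by (rule correlation_norm(1)[OF A st B(1,2,4), symmetric])
  also have "\<dots> \<le> (\<Sum>v\<in>B. 2 * (a (\<sigma> (\<tau> v)) - a (\<tau> v))\<^sup>2 + 2 * (a (\<tau> v) - a v)\<^sup>2)"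
  proof (rule sum_mono)
    fix v
    have "(x + y)\<^sup>2 \<le> 2 * x\<^sup>2 + 2 * y\<^sup>2" for x y :: real
      using sum_squares_bound[of x y] by (simp add: power2_sum)
    from this[of "a (\<sigma> (\<tau> v)) - a (\<tau> v)" "a (\<tau> v) - a v"]
    show "(a (\<sigma> (\<tau> v)) - a v)\<^sup>2 \<le> 2 * (a (\<sigma> (\<tau> v)) - a (\<tau> v))\<^sup>2 + 2 * (a (\<tau> v) - a v)\<^sup>2" by simp
  qed
  also have "\<dots> = 2 * (\<Sum>v\<in>B. (a (\<sigma> (\<tau> v)) - a (\<tau> v))\<^sup>2) + 2 * (\<Sum>v\<in>B. (a (\<tau> v) - a v)\<^sup>2)"
    by (simp add: sum.distrib sum_distrib_left)
  also have "(\<Sum>v\<in>B. (a (\<sigma> (\<tau> v)) - a (\<tau> v))\<^sup>2) = (\<Sum>v\<in>\<tau> ` B. (a (\<sigma> v) - a v)\<^sup>2)"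
    using inj(1) by (subst sum.reindex) (auto intro: inj_on_subset)
  also have "\<dots> = 2 - 2 * (\<Sum>v\<in>A. a v * a (\<sigma> v))" by (rule correlation_norm(1)[OF A \<sigma> B'])
  also have "(\<Sum>v\<in>B. (a (\<tau> v) - a v)\<^sup>2) = 2 - 2 * (\<Sum>v\<in>A. a v * a (\<tau> v))"
    by (rule correlation_norm(1)[OF A \<tau> B(1,2,3)])
  finally show ?thesis by simp
qed

subsection \<open>The random walk on lines\<close>

lemma real_polynomial_function_det: "real_polynomial_function (det :: real^'d^'d \<Rightarrow> real)"
proof -
  have "real_polynomial_function (\<lambda>A :: real^'d^'d. A $ i $ j)" for i j
    by (rule real_polynomial_function.intros(1), rule bounded_linear_compose[OF bounded_linear_vec_nth bounded_linear_vec_nth])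
  then show ?thesis
    unfolding Determinants.det_def
    by (intro real_polynomial_function_sum real_polynomial_function.intros(2,4) real_polynomial_function_prod)
      (auto simp: finite_permutations)
qed

lemma continuous_on_poly: "real_polynomial_function p \<Longrightarrow> continuous_on S p"
  by (simp add: continuous_on_polymonial_function real_polynomial_function_eq)

lemma closed_SL: "closed {g :: real^'d^'d. det g = 1}"
  by (intro closed_Collect_eq continuous_on_poly real_polynomial_function_det continuous_on_const)

context fun_rep
begin

text \<open>Zero is left out so that any representative of the line of a nonzero function is a
  nonzero multiple of it.\<close>

definition line :: "('x \<Rightarrow> real) \<Rightarrow> ('x \<Rightarrow> real) set" where
  "line f = {c *\<^sub>R f | c. c \<noteq> 0}"

definition Om :: "('x \<Rightarrow> real) set set" where
  "Om = line ` (Z - {0})"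

definition ta :: "real^'d^'d \<Rightarrow> ('x \<Rightarrow> real) set \<Rightarrow> ('x \<Rightarrow> real) set" where
  "ta g v = tr g ` v"

definition St :: "('x \<Rightarrow> real) set \<Rightarrow> ('x \<Rightarrow> real) set \<Rightarrow> (real^'d^'d) set" where
  "St v w = {g. det g = 1 \<and> ta g v = w}"

lemma ta_mult: "ta (g ** h) v = ta h (ta g v)"
  by (simp add: ta_def image_image tr_mult)

lemma ta_one: "ta (mat 1) v = v"
  by (simp add: ta_def tr_one)

lemma ta_inverse: "g ** h = mat 1 \<Longrightarrow> ta h (ta g v) = v"
  by (simp add: ta_mult[symmetric] ta_one)

lemma bij_ta:
  assumes "det g = 1"
  shows "bij (ta g)"
proof -
  obtain h where "g ** h = mat 1" "h ** g = mat 1" using SL_inverse[OF assms] by blast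
  then have "ta h \<circ> ta g = id" "ta g \<circ> ta h = id" by (auto simp: fun_eq_iff ta_inverse)
  then show ?thesis by (rule o_bij)
qed

lemma ta_line: "ta g (line f) = line (tr g f)"
proof -
  have "tr g ` {c *\<^sub>R f | c. c \<noteq> 0} = {c *\<^sub>R tr g f | c. c \<noteq> 0}"
    using linear_scale[OF linear_tr, of g] by (auto simp: image_iff) metis
  then show ?thesis by (simp add: ta_def line_def)
qed

lemma tr_nonzero:
  assumes "f \<noteq> 0" "det g = 1"
  shows "tr g f \<noteq> 0"
proof
  assume "tr g f = 0"
  obtain h where "g ** h = mat 1" using SL_inverse[OF assms(2)] by blast
  then have "f = tr h (tr g f)" by (simp add: tr_mult[symmetric] tr_one)
  also have "\<dots> = 0" unfolding \<open>tr g f = 0\<close> by (rule linear_0[OF linear_tr])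
  finally show False using assms(1) by simp
qed

lemma ta_Om:
  assumes "v \<in> Om" "det g = 1"
  shows "ta g v \<in> Om"
proof -
  obtain f where f: "v = line f" "f \<in> Z" "f \<noteq> 0" using assms(1) by (auto simp: Om_def)
  have "tr g f \<in> Z - {0}" using tr_Z[OF f(2) assms(2)] tr_nonzero[OF f(3) assms(2)] by simp
  then show ?thesis unfolding f(1) ta_line Om_def by (rule imageI)
qed

lemma line_eq_iff:
  assumes "f \<noteq> 0" "f' \<noteq> 0"
  shows "line f = line f' \<longleftrightarrow> (\<forall>x y. f x * f' y = f y * f' x)"
proof
  assume "line f = line f'"
  moreover have "f \<in> line f" unfolding line_def by (auto intro!: exI[of _ 1])
  ultimately obtain c where "f = c *\<^sub>R f'" by (auto simp: line_def)
  then show "\<forall>x y. f x * f' y = f y * f' x" by simp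
next
  assume *: "\<forall>x y. f x * f' y = f y * f' x"
  obtain y where y: "f' y \<noteq> 0" using assms(2) by (auto simp: fun_eq_iff)
  define c where "c = f y / f' y"
  have fc: "f = c *\<^sub>R f'"
  proof
    fix x show "f x = (c *\<^sub>R f') x" using *[rule_format, of x y] y by (simp add: c_def field_simps)
  qed
  then have c0: "c \<noteq> 0" using assms(1) by auto
  show "line f = line f'"
  proof (intro equalityI subsetI)
    fix h assume "h \<in> line f"
    then obtain d where "d \<noteq> 0" "h = d *\<^sub>R f" by (auto simp: line_def)
    then show "h \<in> line f'" unfolding line_def using c0 fc by (auto intro!: exI[of _ "d * c"])
  next
    fix h assume "h \<in> line f'"
    then obtain d where "d \<noteq> 0" "h = d *\<^sub>R f'" by (auto simp: line_def)
    then have "h = (d / c) *\<^sub>R f" "d / c \<noteq> 0" using c0 fc by auto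
    then show "h \<in> line f" unfolding line_def by blast
  qed
qed

text \<open>Proportionality of two functions is a family of polynomial equations in
  \<open>g\<close>, one for each pair of points. There may be uncountably many, so measurability has
  to come from closedness.\<close>

lemma closed_St:
  assumes "v \<in> Om" "w \<in> Om"
  shows "closed (St v w)"
proof -
  obtain f where f: "v = line f" "f \<in> Z" "f \<noteq> 0" using assms(1) by (auto simp: Om_def)
  obtain f' where f': "w = line f'" "f' \<noteq> 0" using assms(2) by (auto simp: Om_def)
  obtain p where p: "\<And>x. real_polynomial_function (p x)" "\<And>x g. det g = 1 \<Longrightarrow> f (act g x) = p x g"
    using Z_poly[OF f(2)] by metis
  have eq: "line (tr g f) = line f' \<longleftrightarrow> (\<forall>x y. p x g * f' y = p y g * f' x)" if "det g = 1" for g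
    using line_eq_iff[OF tr_nonzero[OF f(3) that] f'(2)] p(2)[OF that] by (simp add: tr_apply)
  have "St v w = {g. det g = 1} \<inter> (\<Inter>x. \<Inter>y. {g. p x g * f' y = p y g * f' x})"
    unfolding St_def f(1) f'(1) ta_line
    by (rule Set.set_eqI) (simp add: eq cong: conj_cong)
  also have "closed \<dots>"
    by (intro closed_Int closed_SL closed_INT ballI closed_Collect_eq continuous_on_mult
        continuous_on_poly p(1) continuous_on_const)
  finally show ?thesis .
qed

end

section \<open>Convolution powers of the step law\<close>

definition cv :: "(real^'d^'d) measure \<Rightarrow> nat \<Rightarrow> (real^'d^'d) measure" where
  "cv \<mu> = rec_nat (return borel (mat 1)) (\<lambda>_ \<nu>. distr (\<nu> \<Otimes>\<^sub>M \<mu>) borel (\<lambda>(h, g). h ** g))"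

text \<open>The fresh factor stands on the right: translation of functions reverses products, so it
  acts last and the image of a line performs a Markov chain.\<close>

lemma cv_0: "cv \<mu> 0 = return borel (mat 1)"
  and cv_Suc: "cv \<mu> (Suc n) = distr (cv \<mu> n \<Otimes>\<^sub>M \<mu>) borel (\<lambda>(h, g). h ** g)"
  by (simp_all add: cv_def)

lemma continuous_on_matrix_mult: "continuous_on UNIV (\<lambda>(h :: real^'d^'d, g :: real^'d^'d). h ** g)"
  unfolding case_prod_beta matrix_matrix_mult_def by (intro continuous_intros)

lemma measurable_matrix_mult [measurable]:
  "(\<lambda>(h :: real^'d^'d, g :: real^'d^'d). h ** g) \<in> borel_measurable (borel \<Otimes>\<^sub>M borel)"
  unfolding borel_prod by (rule borel_measurable_continuous_onI[OF continuous_on_matrix_mult])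

lemma sets_cv: "sets (cv \<mu> n) = sets borel"
  by (cases n) (simp_all add: cv_0 cv_Suc)

lemma space_cv: "space (cv \<mu> n) = UNIV"
  using sets_eq_imp_space_eq[OF sets_cv, of \<mu> n] by simp

locale mat_walk =
  fixes \<mu> :: "(real^'d^'d) measure"
  assumes prob: "prob_space \<mu>" and sets_mu: "sets \<mu> = sets borel" and AE_det: "AE g in \<mu>. det g = 1"
begin

lemma space_mu: "space \<mu> = UNIV"
  using sets_eq_imp_space_eq[OF sets_mu] by simp

lemma prob_cv: "prob_space (cv \<mu> n)"
proof (induction n)
  case 0
  then show ?case unfolding cv_0 by (intro prob_space_return) simp
next
  case (Suc n)
  interpret A: prob_space "cv \<mu> n" by (rule Suc)
  interpret B: prob_space \<mu> by (rule prob)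
  interpret P: pair_prob_space "cv \<mu> n" \<mu> ..
  have "(\<lambda>(h, g). h ** g) \<in> borel_measurable (cv \<mu> n \<Otimes>\<^sub>M \<mu>)"
    using measurable_matrix_mult sets_pair_measure_cong[OF sets_cv sets_mu] measurable_cong_sets by blast
  then show ?case unfolding cv_Suc by (rule P.prob_space_distr)
qed

lemma measurable_mult_cv: "(\<lambda>(h, g). h ** g) \<in> borel_measurable (cv \<mu> n \<Otimes>\<^sub>M \<mu>)"
  using measurable_matrix_mult sets_pair_measure_cong[OF sets_cv sets_mu] measurable_cong_sets by blast

lemma nn_integral_cv_Suc:
  assumes "f \<in> borel_measurable borel"
  shows "(\<integral>\<^sup>+x. f x \<partial>cv \<mu> (Suc n)) = (\<integral>\<^sup>+g. \<integral>\<^sup>+h. f (h ** g) \<partial>cv \<mu> n \<partial>\<mu>)"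
proof -
  interpret A: prob_space "cv \<mu> n" by (rule prob_cv)
  interpret B: prob_space \<mu> by (rule prob)
  interpret P: pair_prob_space "cv \<mu> n" \<mu> ..
  have m: "(\<lambda>x. f (case x of (h, g) \<Rightarrow> h ** g)) \<in> borel_measurable (cv \<mu> n \<Otimes>\<^sub>M \<mu>)"
    using measurable_compose[OF measurable_mult_cv assms] .
  have "(\<integral>\<^sup>+x. f x \<partial>cv \<mu> (Suc n)) = (\<integral>\<^sup>+x. f (case x of (h, g) \<Rightarrow> h ** g) \<partial>(cv \<mu> n \<Otimes>\<^sub>M \<mu>))"
    unfolding cv_Suc using assms by (intro nn_integral_distr measurable_mult_cv) simp
  also have "\<dots> = (\<integral>\<^sup>+g. \<integral>\<^sup>+h. f (h ** g) \<partial>cv \<mu> n \<partial>\<mu>)"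
    using P.nn_integral_snd[OF m] by simp
  finally show ?thesis .
qed

lemma AE_det_cv: "AE g in cv \<mu> n. det g = 1"
proof -
  have B: "{g :: real^'d^'d. det g \<noteq> 1} \<in> sets borel"
    using borel_open[OF open_Compl[OF closed_SL]] by (simp add: Collect_neg_eq[symmetric])
  have "emeasure (cv \<mu> n) {g. det g \<noteq> 1} = 0"
  proof (induction n)
    case 0
    then show ?case unfolding cv_0 by (subst emeasure_return[OF B]) simp
  next
    case (Suc n)
    have "emeasure (cv \<mu> (Suc n)) {g. det g \<noteq> 1} = (\<integral>\<^sup>+x. indicator {g. det g \<noteq> 1} x \<partial>cv \<mu> (Suc n))"
      using B by (intro nn_integral_indicator[symmetric]) (simp add: sets_cv)
    also have "\<dots> = (\<integral>\<^sup>+g. \<integral>\<^sup>+h. indicator {g. det g \<noteq> 1} (h ** g) \<partial>cv \<mu> n \<partial>\<mu>)"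
      using B by (intro nn_integral_cv_Suc) simp
    also have "\<dots> = (\<integral>\<^sup>+g. 0 \<partial>\<mu>)"
    proof (rule nn_integral_cong_AE)
      have "(\<integral>\<^sup>+h. indicator {g. det g \<noteq> 1} (h ** g) \<partial>cv \<mu> n) = 0" if "det g = 1" for g
      proof -
        have "(\<integral>\<^sup>+h. indicator {g. det g \<noteq> 1} (h ** g) \<partial>cv \<mu> n) = (\<integral>\<^sup>+h. indicator {g. det g \<noteq> 1} h \<partial>cv \<mu> n)"
          using that by (intro nn_integral_cong) (simp add: indicator_def det_mul)
        also have "\<dots> = emeasure (cv \<mu> n) {g. det g \<noteq> 1}"
          using B by (intro nn_integral_indicator) (simp add: sets_cv)
        finally show ?thesis using Suc by simp
      qed
      with AE_det show "AE g in \<mu>. (\<integral>\<^sup>+h. indicator {g. det g \<noteq> 1} (h ** g) \<partial>cv \<mu> n) = 0" by auto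
    qed
    finally show ?case by simp
  qed
  then show ?thesis
    using B by (intro AE_I[of _ _ "{g. det g \<noteq> 1}"]) (auto simp: sets_cv)
qed

end

text \<open>\<open>dens\<close> says that every subgroup of full measure is Zariski dense, the form
  in which density is available for the asymptotically invariant elements. \<open>unb\<close>
  excludes the outcome of \<open>bounded_vector\<close>.\<close>

locale rw_rep = fun_rep act Z + mat_walk \<mu>
  for act :: "real^'d^'d \<Rightarrow> 'x \<Rightarrow> 'x" and Z :: "('x \<Rightarrow> real) set" and \<mu> :: "(real^'d^'d) measure" +
  assumes dens: "\<And>G p a. (\<And>g. g \<in> G \<Longrightarrow> det g = 1) \<Longrightarrow> mat 1 \<in> G
      \<Longrightarrow> (\<And>g h. g \<in> G \<Longrightarrow> h \<in> G \<Longrightarrow> g ** h \<in> G) \<Longrightarrow> (\<And>g. g \<in> G \<Longrightarrow> \<exists>h\<in>G. g ** h = mat 1 \<and> h ** g = mat 1)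
      \<Longrightarrow> AE g in \<mu>. g \<in> G \<Longrightarrow> real_polynomial_function p \<Longrightarrow> (\<And>g. g \<in> G \<Longrightarrow> p g = 0) \<Longrightarrow> det a = 1 \<Longrightarrow> p a = 0"
    and unb: "\<And>f. f \<in> Z \<Longrightarrow> f \<noteq> 0 \<Longrightarrow> \<exists>x. \<forall>K. \<exists>g. det g = 1 \<and> K < \<bar>f (act g x)\<bar>"
begin

definition kk :: "('x \<Rightarrow> real) set \<Rightarrow> ('x \<Rightarrow> real) set \<Rightarrow> real" where
  "kk v w = (if v \<in> Om \<and> w \<in> Om then measure \<mu> (St v w) else 0)"

lemma kk_nonneg: "0 \<le> kk v w"
  by (simp add: kk_def)

lemma St_sets: "v \<in> Om \<Longrightarrow> w \<in> Om \<Longrightarrow> St v w \<in> sets borel"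
  using borel_closed[OF closed_St] .

lemma sum_St_row:
  assumes "prob_space \<nu>" "sets \<nu> = sets borel" "finite A" "A \<subseteq> Om" "v \<in> Om"
  shows "(\<Sum>w\<in>A. measure \<nu> (St v w)) \<le> 1"
proof -
  interpret N: prob_space \<nu> by fact
  have "(\<Sum>w\<in>A. measure \<nu> (St v w)) = measure \<nu> (\<Union>w\<in>A. St v w)"
    using assms
    by (intro N.finite_measure_finite_Union[symmetric]) (auto simp: disjoint_family_on_def St_def intro!: St_sets[unfolded St_def])
  also have "\<dots> \<le> 1" by simp
  finally show ?thesis .
qed

lemma kk_row:
  assumes "finite A" "A \<subseteq> Om" "v \<in> A"
  shows "(\<Sum>w\<in>A. kk v w) \<le> 1"
proof -
  have "(\<Sum>w\<in>A. kk v w) = (\<Sum>w\<in>A. measure \<mu> (St v w))"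
    using assms by (intro sum.cong) (auto simp: kk_def)
  also have "\<dots> \<le> 1" using assms by (intro sum_St_row prob sets_mu) auto
  finally show ?thesis .
qed

text \<open>Each \<open>g\<close> permutes the lines, so at most one line is sent to
  \<open>w\<close> by it: the counting measure on lines does not grow under the walk.\<close>

lemma kk_col:
  assumes "finite A" "A \<subseteq> Om" "w \<in> A"
  shows "(\<Sum>v\<in>A. kk v w) \<le> 1"
proof -
  interpret N: prob_space \<mu> by (rule prob)
  have disj: "St v w \<inter> St v' w = {}" if "v \<noteq> v'" for v v'
  proof -
    have "False" if "g \<in> St v w" "g \<in> St v' w" for g
    proof -
      have "det g = 1" "ta g v = ta g v'" using that by (auto simp: St_def)
      then show False using bij_is_inj[OF bij_ta] \<open>v \<noteq> v'\<close> by (metis injD)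
    qed
    then show ?thesis by blast
  qed
  have "(\<Sum>v\<in>A. kk v w) = (\<Sum>v\<in>A. measure \<mu> (St v w))"
    using assms by (intro sum.cong) (auto simp: kk_def)
  also have "\<dots> = measure \<mu> (\<Union>v\<in>A. St v w)"
    using assms disj
    by (intro N.finite_measure_finite_Union[symmetric]) (auto simp: disjoint_family_on_def sets_mu intro!: St_sets)
  also have "\<dots> \<le> 1" by simp
  finally show ?thesis .
qed

end

context rw_rep
begin

text \<open>Without a gap there are finitely supported unit vectors on \<open>Om\<close> which are asymptotically invariant
  under a subgroup of full measure; their squares accumulate at an invariant mean, contradicting
  the existence of vectors with unbounded orbits only.\<close>

lemma gap_exists:
  "\<exists>c>0. c \<le> 1 \<and> (\<forall>A a. finite A \<longrightarrow> A \<subseteq> Om \<longrightarrow> (\<forall>v. 0 \<le> a v) \<longrightarrow>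
    (\<Sum>w\<in>A. \<Sum>v\<in>A. a v * kk v w * a w) \<le> (1 - c) * (\<Sum>v\<in>A. (a v)\<^sup>2))"
proof (rule ccontr)
  assume neg: "\<not> ?thesis"
  interpret M: prob_space \<mu> by (rule prob)
  \<comment> \<open>Summable defects: the averages of \<open>1 - \<phi> i g\<close> then have a
    finite sum, so \<open>\<phi> i g\<close> tends to 1 for almost every \<open>g\<close>, without
    passing to a subsequence.\<close>
  define c where "c = (\<lambda>i :: nat. (1 / 2 :: real) ^ Suc i)"
  have c: "0 < c i" "c i \<le> 1" for i unfolding c_def by (intro zero_less_power power_le_one; simp)+
  have "\<exists>A b. finite A \<and> A \<subseteq> Om \<and> (\<forall>v. v \<notin> A \<longrightarrow> b v = 0) \<and> (\<Sum>v\<in>A. (b v)\<^sup>2) = 1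
    \<and> 1 - c i < (\<Sum>w\<in>A. \<Sum>v\<in>A. b v * kk v w * b w)" for i
  proof -
    obtain A a where A: "finite A" "A \<subseteq> Om" and a: "\<And>v. 0 \<le> a v"
      and lt: "(1 - c i) * (\<Sum>v\<in>A. (a v)\<^sup>2) < (\<Sum>w\<in>A. \<Sum>v\<in>A. a v * kk v w * a w)"
      using neg c[of i] by (meson not_le)
    define S where "S = (\<Sum>v\<in>A. (a v)\<^sup>2)"
    have "S \<noteq> 0"
    proof
      assume "S = 0"
      then have "\<forall>v\<in>A. a v = 0" using A(1) by (simp add: S_def sum_nonneg_eq_0_iff)
      then have "(\<Sum>w\<in>A. \<Sum>v\<in>A. a v * kk v w * a w) = 0" by (intro sum.neutral ballI) simp
      then show False using lt \<open>S = 0\<close> by (simp add: S_def)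
    qed
    then have S: "0 < S" by (simp add: S_def less_le sum_nonneg)
    define b where "b = (\<lambda>v. if v \<in> A then a v / sqrt S else 0)"
    have "(\<Sum>v\<in>A. (b v)\<^sup>2) = (\<Sum>v\<in>A. (a v)\<^sup>2 / S)"
      using S by (intro sum.cong) (auto simp: b_def power_divide)
    then have 1: "(\<Sum>v\<in>A. (b v)\<^sup>2) = 1" using S by (simp add: sum_divide_distrib[symmetric] S_def[symmetric])
    have "(\<Sum>w\<in>A. \<Sum>v\<in>A. b v * kk v w * b w) = (\<Sum>w\<in>A. \<Sum>v\<in>A. a v * kk v w * a w / S)"
      using S by (intro sum.cong) (auto simp: b_def)
    also have "\<dots> = (\<Sum>w\<in>A. \<Sum>v\<in>A. a v * kk v w * a w) / S" by (simp add: sum_divide_distrib)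
    finally have "1 - c i < (\<Sum>w\<in>A. \<Sum>v\<in>A. b v * kk v w * b w)"
      using lt S by (simp add: S_def[symmetric] less_divide_eq)
    moreover have "\<forall>v. v \<notin> A \<longrightarrow> b v = 0" by (simp add: b_def)
    ultimately show ?thesis using A 1 by (intro exI[of _ A] exI[of _ b]) auto
  qed
  then have "\<forall>i. \<exists>A b. finite A \<and> A \<subseteq> Om \<and> (\<forall>v. v \<notin> A \<longrightarrow> b v = 0) \<and> (\<Sum>v\<in>A. (b v)\<^sup>2) = 1
    \<and> 1 - c i < (\<Sum>w\<in>A. \<Sum>v\<in>A. b v * kk v w * b w)" ..
  from choice[OF this] obtain A where "\<forall>i. \<exists>b. finite (A i) \<and> A i \<subseteq> Om \<and> (\<forall>v. v \<notin> A i \<longrightarrow> b v = 0)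
    \<and> (\<Sum>v\<in>A i. (b v)\<^sup>2) = 1 \<and> 1 - c i < (\<Sum>w\<in>A i. \<Sum>v\<in>A i. b v * kk v w * b w)" ..
  from choice[OF this] obtain b where Ab: "\<forall>i. finite (A i) \<and> A i \<subseteq> Om \<and> (\<forall>v. v \<notin> A i \<longrightarrow> b i v = 0)
    \<and> (\<Sum>v\<in>A i. (b i v)\<^sup>2) = 1 \<and> 1 - c i < (\<Sum>w\<in>A i. \<Sum>v\<in>A i. b i v * kk v w * b i w)" ..
  have A: "\<And>i. finite (A i)" "\<And>i. A i \<subseteq> Om" and b0: "\<And>i v. v \<notin> A i \<Longrightarrow> b i v = 0"
    and b1: "\<And>i. (\<Sum>v\<in>A i. (b i v)\<^sup>2) = 1"
    and bk: "\<And>i. 1 - c i < (\<Sum>w\<in>A i. \<Sum>v\<in>A i. b i v * kk v w * b i w)" using Ab by simp_all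
  define \<phi> where "\<phi> = (\<lambda>i g. \<Sum>v\<in>A i. b i v * b i (ta g v))"
  \<comment> \<open>Equal to \<open>\<phi>\<close> on determinant 1, but visibly a finite
    combination of indicators of measurable sets, so that it is integrable and integrates to the
    quadratic form.\<close>
  define \<psi> where "\<psi> = (\<lambda>i g. \<Sum>w\<in>A i. \<Sum>v\<in>A i. b i v * b i w * indicator (St v w) g)"
  have \<phi>1: "\<phi> i g \<le> 1" if "det g = 1" for i g
    unfolding \<phi>_def by (rule correlation_bound(1)[OF A(1) b0 b1 bij_ta[OF that]])
  have \<phi>\<psi>: "\<phi> i g = \<psi> i g" if g: "det g = 1" for i g
  proof -
    have "b i (ta g v) = (\<Sum>w\<in>A i. b i w * indicator (St v w) g)" for v
    proof -
      have "(\<Sum>w\<in>A i. b i w * indicator (St v w) g) = (\<Sum>w\<in>A i. if w = ta g v then b i w else 0)"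
        using g by (intro sum.cong) (auto simp: St_def)
      also have "\<dots> = b i (ta g v)" using A(1)[of i] b0[of "ta g v" i] by simp
      finally show ?thesis by simp
    qed
    then have "\<phi> i g = (\<Sum>v\<in>A i. \<Sum>w\<in>A i. b i v * b i w * indicator (St v w) g)"
      unfolding \<phi>_def by (simp add: sum_distrib_left mult.assoc)
    then show ?thesis unfolding \<psi>_def by (subst sum.swap) simp
  qed
  have St_mu: "St v w \<in> sets \<mu>" if "v \<in> A i" "w \<in> A i" for i v w
    unfolding sets_mu using St_sets A(2) that by blast
  have \<psi>_int: "integrable \<mu> (\<psi> i)" for i
    unfolding \<psi>_def using St_mu
    by (intro Bochner_Integration.integrable_sum integrable_mult_right integrable_real_indicator)
      (auto simp: M.emeasure_finite less_top[symmetric])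
  have "(\<integral>g. \<psi> i g \<partial>\<mu>) = (\<Sum>w\<in>A i. \<Sum>v\<in>A i. b i v * kk v w * b i w)" for i
  proof -
    have "(\<integral>g. \<psi> i g \<partial>\<mu>) = (\<Sum>w\<in>A i. \<integral>g. (\<Sum>v\<in>A i. b i v * b i w * indicator (St v w) g) \<partial>\<mu>)"
      unfolding \<psi>_def using St_mu
      by (intro Bochner_Integration.integral_sum Bochner_Integration.integrable_sum integrable_mult_right integrable_real_indicator)
        (auto simp: M.emeasure_finite less_top[symmetric])
    also have "\<dots> = (\<Sum>w\<in>A i. \<Sum>v\<in>A i. \<integral>g. b i v * b i w * indicator (St v w) g \<partial>\<mu>)"
      using St_mu
      by (intro sum.cong refl Bochner_Integration.integral_sum integrable_mult_right integrable_real_indicator)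
        (auto simp: M.emeasure_finite less_top[symmetric])
    also have "\<dots> = (\<Sum>w\<in>A i. \<Sum>v\<in>A i. b i v * kk v w * b i w)"
    proof (intro sum.cong refl)
      fix w v assume "w \<in> A i" "v \<in> A i"
      then have "kk v w = measure \<mu> (St v w)" using A(2)[of i] by (auto simp: kk_def)
      then show "(\<integral>g. b i v * b i w * indicator (St v w) g \<partial>\<mu>) = b i v * kk v w * b i w"
        by (simp add: space_mu)
    qed
    finally show ?thesis .
  qed
  then have small: "(\<integral>g. 1 - \<psi> i g \<partial>\<mu>) \<le> c i" for i
    using bk[of i] \<psi>_int[of i] by (subst Bochner_Integration.integral_diff) (auto simp: M.prob_space)
  have nn: "AE g in \<mu>. 0 \<le> 1 - \<psi> i g" for i
    using AE_det by eventually_elim (use \<phi>1 \<phi>\<psi> in \<open>fastforce\<close>)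
  have "(\<integral>\<^sup>+g. (\<Sum>i. ennreal (1 - \<psi> i g)) \<partial>\<mu>) = (\<Sum>i. \<integral>\<^sup>+g. ennreal (1 - \<psi> i g) \<partial>\<mu>)"
    using \<psi>_int by (intro nn_integral_suminf) (auto intro!: measurable_compose[OF _ measurable_ennreal])
  also have "\<dots> \<le> (\<Sum>i. ennreal (c i))"
  proof (intro suminf_le summableI)
    fix i
    have "(\<integral>\<^sup>+g. ennreal (1 - \<psi> i g) \<partial>\<mu>) = ennreal (\<integral>g. 1 - \<psi> i g \<partial>\<mu>)"
      using \<psi>_int nn by (intro nn_integral_eq_integral) auto
    then show "(\<integral>\<^sup>+g. ennreal (1 - \<psi> i g) \<partial>\<mu>) \<le> ennreal (c i)" using small[of i] by (simp add: ennreal_leI)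
  qed
  also have "\<dots> < \<infinity>"
  proof -
    have "summable c" unfolding c_def by (simp add: summable_geometric)
    then have "(\<Sum>i. ennreal (c i)) = ennreal (suminf c)"
      using c(1) less_imp_le by (intro suminf_ennreal2) auto
    then show ?thesis by simp
  qed
  finally have "(\<integral>\<^sup>+g. (\<Sum>i. ennreal (1 - \<psi> i g)) \<partial>\<mu>) \<noteq> \<infinity>" by simp
  then have "AE g in \<mu>. (\<Sum>i. ennreal (1 - \<psi> i g)) \<noteq> \<infinity>"
    using \<psi>_int by (intro nn_integral_PInf_AE) (auto intro!: measurable_compose[OF _ measurable_ennreal])
  then have AE_lim: "AE g in \<mu>. det g = 1 \<and> (\<lambda>i. \<phi> i g) \<longlonglongrightarrow> 1"
    using AE_det
  proof eventually_elim
    case (elim g)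
    have "summable (\<lambda>i. 1 - \<psi> i g)"
      using elim \<phi>1[OF elim(2)] \<phi>\<psi>[OF elim(2)] by (intro summable_suminf_not_top) auto
    then have "(\<lambda>i. 1 - \<psi> i g) \<longlonglongrightarrow> 0" by (rule summable_LIMSEQ_zero)
    from tendsto_diff[OF tendsto_const[of 1] this] have "(\<lambda>i. \<psi> i g) \<longlonglongrightarrow> 1" by simp
    then show ?case using elim(2) \<phi>\<psi>[OF elim(2)] by simp
  qed
  \<comment> \<open>Correlation tending to 1 means that the vectors \<open>b i\<close> are
    asymptotically fixed by \<open>g\<close>, a condition stable under products and
    inverses.\<close>
  define G where "G = {g. det g = 1 \<and> (\<lambda>i. \<phi> i g) \<longlonglongrightarrow> 1}"
  have G_det: "det g = 1" if "g \<in> G" for g using that by (simp add: G_def)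
  have G_lim: "(\<lambda>i. \<phi> i g) \<longlonglongrightarrow> 1" if "g \<in> G" for g using that by (simp add: G_def)
  have G_one: "mat 1 \<in> G"
    using b1 by (simp add: G_def \<phi>_def ta_one power2_eq_square[symmetric])
  have G_mult: "g ** h \<in> G" if g: "g \<in> G" and h: "h \<in> G" for g h
  proof -
    have det: "det (g ** h) = 1" using G_det[OF g] G_det[OF h] by (simp add: det_mul)
    have "(\<lambda>i. 1 - \<phi> i (g ** h)) \<longlonglongrightarrow> 0"
    proof (rule tendsto_sandwich[of "\<lambda>_. 0"])
      show "\<forall>\<^sub>F i in sequentially. 0 \<le> 1 - \<phi> i (g ** h)" using \<phi>1[OF det] by simp
      show "\<forall>\<^sub>F i in sequentially. 1 - \<phi> i (g ** h) \<le> 2 * (1 - \<phi> i h) + 2 * (1 - \<phi> i g)"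
        unfolding \<phi>_def ta_mult
        by (intro always_eventually allI correlation_comp[OF A(1) b0 b1 bij_ta[OF G_det[OF g]] bij_ta[OF G_det[OF h]]])
      have "(\<lambda>i. 2 * (1 - \<phi> i h) + 2 * (1 - \<phi> i g)) \<longlonglongrightarrow> 2 * (1 - 1) + 2 * (1 - 1)"
        by (intro tendsto_intros G_lim g h)
      then show "(\<lambda>i. 2 * (1 - \<phi> i h) + 2 * (1 - \<phi> i g)) \<longlonglongrightarrow> 0" by simp
    qed simp
    from tendsto_diff[OF tendsto_const[of 1] this] det show ?thesis by (simp add: G_def)
  qed
  have G_inv: "\<exists>h\<in>G. g ** h = mat 1 \<and> h ** g = mat 1" if g: "g \<in> G" for g
  proof -
    obtain h where h: "det h = 1" "g ** h = mat 1" "h ** g = mat 1" using SL_inverse[OF G_det[OF g]] by blast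
    have "\<phi> i h = \<phi> i g" for i
      unfolding \<phi>_def
      by (rule correlation_inverse[OF A(1) _ bij_ta[OF G_det[OF g]]]) (simp_all add: b0 ta_inverse[OF h(2)])
    then have "h \<in> G" using h(1) G_lim[OF g] by (simp add: G_def)
    with h show ?thesis by blast
  qed
  define s where "s = (\<lambda>i E. \<Sum>v\<in>A i \<inter> E. (b i v)\<^sup>2)"
  have s_bd: "0 \<le> s i E \<and> s i E \<le> 1" for i E
  proof -
    have "s i E \<le> (\<Sum>v\<in>A i. (b i v)\<^sup>2)" unfolding s_def using A(1) by (intro sum_mono2) auto
    then show ?thesis using b1[of i] by (simp add: s_def sum_nonneg)
  qed
  obtain m H where H: "H \<noteq> bot" "H \<le> filtermap s sequentially" and mH: "\<And>E. ((\<lambda>u. u E) \<longlongrightarrow> m E) H"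
    using generalized_limit[of s, OF s_bd] by blast
  have lim: "(F \<longlongrightarrow> l) H" if "(\<lambda>i. F (s i)) \<longlonglongrightarrow> l" for F :: "_ \<Rightarrow> real" and l
    using that by (intro tendsto_mono[OF H(2)]) (simp add: filterlim_filtermap)
  have m_lim: "m E = l" if "(\<lambda>i. s i E) \<longlonglongrightarrow> l" for E l
  proof -
    have "((\<lambda>u. u E) \<longlongrightarrow> l) H" by (rule lim[OF that])
    from tendsto_unique[OF H(1) mH this] show ?thesis .
  qed
  have m_pos: "0 \<le> m E" for E
  proof (rule tendsto_lowerbound[OF mH _ H(1)])
    have "eventually (\<lambda>u. 0 \<le> u E) (filtermap s sequentially)"
      unfolding eventually_filtermap using s_bd by (intro always_eventually) auto
    then show "eventually (\<lambda>u. 0 \<le> u E) H" by (rule filter_leD[OF H(2)])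
  qed
  have m_add: "m (E \<union> E') = m E + m E'" if "E \<inter> E' = {}" for E E'
  proof -
    have "s i (E \<union> E') - s i E - s i E' = 0" for i
    proof -
      have "s i (E \<union> E') = s i E + s i E'"
        unfolding s_def Int_Un_distrib using A(1)[of i] that by (intro sum.union_disjoint) auto
      then show ?thesis by simp
    qed
    then have "((\<lambda>u. u (E \<union> E') - u E - u E') \<longlongrightarrow> 0) H" by (intro lim) simp
    moreover have "((\<lambda>u. u (E \<union> E') - u E - u E') \<longlongrightarrow> m (E \<union> E') - m E - m E') H" by (intro tendsto_diff mH)
    ultimately have "m (E \<union> E') - m E - m E' = 0" using tendsto_unique[OF H(1)] by blast
    then show ?thesis by simp
  qed
  have s_Om: "s i E = 1" if "Om \<subseteq> E" for i E
  proof -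
    have "A i \<inter> E = A i" using A(2)[of i] that by blast
    then show ?thesis by (simp add: s_def b1)
  qed
  have m_Om: "m E = 1" if "Om \<subseteq> E" for E
    using s_Om[OF that] by (intro m_lim) simp
  have m_inv: "m {v. ta g v \<in> E} = m E" if g: "g \<in> G" for g E
  proof -
    have "(\<lambda>i. s i {v. ta g v \<in> E} - s i E) \<longlonglongrightarrow> 0"
    proof (rule Lim_null_comparison)
      show "\<forall>\<^sub>F i in sequentially. norm (s i {v. ta g v \<in> E} - s i E) \<le> 2 * sqrt (2 - 2 * \<phi> i g)"
      proof (intro always_eventually allI)
        fix i
        have "A i \<inter> {v. ta g v \<in> E} = {v. v \<in> A i \<and> ta g v \<in> E}" by blast
        then show "norm (s i {v. ta g v \<in> E} - s i E) \<le> 2 * sqrt (2 - 2 * \<phi> i g)"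
          using correlation_bound(2)[OF A(1) b0 b1 bij_ta[OF G_det[OF g]], of i E] by (simp add: s_def \<phi>_def)
      qed
      have "(\<lambda>i. 2 * sqrt (2 - 2 * \<phi> i g)) \<longlonglongrightarrow> 2 * sqrt (2 - 2 * 1)"
        by (intro tendsto_intros G_lim g)
      then show "(\<lambda>i. 2 * sqrt (2 - 2 * \<phi> i g)) \<longlonglongrightarrow> 0" by simp
    qed
    then have "((\<lambda>u. u {v. ta g v \<in> E} - u E) \<longlongrightarrow> 0) H" by (rule lim)
    moreover have "((\<lambda>u. u {v. ta g v \<in> E} - u E) \<longlongrightarrow> m {v. ta g v \<in> E} - m E) H" by (intro tendsto_diff mH)
    ultimately have "m {v. ta g v \<in> E} - m E = 0" using tendsto_unique[OF H(1)] by blast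
    then show ?thesis by simp
  qed
  have m_cong: "m E = m E'" if "E \<inter> Om = E' \<inter> Om" for E E'
  proof -
    have "A i \<inter> E = A i \<inter> E'" for i using A(2)[of i] that by blast
    then have "((\<lambda>u. u E - u E') \<longlongrightarrow> 0) H" by (intro lim) (simp add: s_def)
    moreover have "((\<lambda>u. u E - u E') \<longlongrightarrow> m E - m E') H" by (intro tendsto_diff mH)
    ultimately have "m E - m E' = 0" using tendsto_unique[OF H(1)] by blast
    then show ?thesis by simp
  qed
  \<comment> \<open>An arbitrary function from each line turns the mean on lines into one on
    functions. On cones the choice is immaterial, and only for cones is invariance claimed.\<close>
  define rep where "rep = (\<lambda>v :: ('x \<Rightarrow> real) set. SOME f. f \<in> v)"
  have rep_line: "\<exists>c. c \<noteq> 0 \<and> rep (line f) = c *\<^sub>R f" for f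
  proof -
    have "f \<in> line f" unfolding line_def by (auto intro!: exI[of _ 1])
    then have "rep (line f) \<in> line f" unfolding rep_def by (rule someI[where P = "\<lambda>h. h \<in> line f"])
    then show ?thesis by (auto simp: line_def)
  qed
  define mh where "mh = (\<lambda>C. m {v. rep v \<in> C})"
  interpret I: inv_mean act Z G mh
  proof unfold_locales
    show "det g = 1" if "g \<in> G" for g by (rule G_det[OF that])
    show "mat 1 \<in> G" by (rule G_one)
    show "g ** h \<in> G" if "g \<in> G" "h \<in> G" for g h by (rule G_mult[OF that])
    show "\<exists>h\<in>G. g ** h = mat 1 \<and> h ** g = mat 1" if "g \<in> G" for g by (rule G_inv[OF that])
    show "p a = 0" if "real_polynomial_function p" "\<And>g. g \<in> G \<Longrightarrow> p g = 0" "det a = 1" for p a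
    proof (rule dens[where G = G])
      show "AE g in \<mu>. g \<in> G" using AE_lim by (simp add: G_def)
    qed (use G_det G_one G_mult G_inv that in blast)+
    show "0 \<le> mh C" for C unfolding mh_def by (rule m_pos)
    show "mh (C \<union> C') = mh C + mh C'" if "C \<inter> C' = {}" for C C'
    proof -
      have "{v. rep v \<in> C \<union> C'} = {v. rep v \<in> C} \<union> {v. rep v \<in> C'}" by blast
      then show ?thesis unfolding mh_def using that by (simp only:) (rule m_add, blast)
    qed
    show "mh (Z - {0}) = 1" unfolding mh_def
    proof (rule m_Om, rule subsetI)
      fix v assume "v \<in> Om"
      then obtain f where f: "v = line f" "f \<in> Z" "f \<noteq> 0" by (auto simp: Om_def)
      obtain c where "c \<noteq> 0" "rep v = c *\<^sub>R f" using rep_line[of f] f(1) by blast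
      then show "v \<in> {v. rep v \<in> Z - {0}}" using f subspace_scale[OF subZ f(2), of c] by simp
    qed
    show "mh UNIV = 1" unfolding mh_def by (rule m_Om) simp
    show "mh {f. tr g f \<in> C} = mh C"
      if g: "g \<in> G" and conic: "\<And>f c. c \<noteq> 0 \<Longrightarrow> c *\<^sub>R f \<in> C \<longleftrightarrow> f \<in> C" for g C
    proof -
      have "tr g (rep v) \<in> C \<longleftrightarrow> rep (ta g v) \<in> C" if "v \<in> Om" for v
      proof -
        obtain f where f: "v = line f" using \<open>v \<in> Om\<close> by (auto simp: Om_def)
        obtain c where c: "c \<noteq> 0" "rep v = c *\<^sub>R f" using rep_line[of f] f by blast
        obtain d where d: "d \<noteq> 0" "rep (ta g v) = d *\<^sub>R tr g f" using rep_line[of "tr g f"] f ta_line by metis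
        show ?thesis using conic c d by (simp add: linear_scale[OF linear_tr])
      qed
      then have "m {v. tr g (rep v) \<in> C} = m {v. ta g v \<in> {v. rep v \<in> C}}" by (intro m_cong) auto
      also have "\<dots> = m {v. rep v \<in> C}" by (rule m_inv[OF g])
      finally show ?thesis by (simp add: mh_def)
    qed
  qed
  obtain f where f: "f \<in> Z" "f \<noteq> 0" "\<And>x. \<exists>K. \<forall>g. det g = 1 \<longrightarrow> \<bar>f (act g x)\<bar> \<le> K"
    using I.bounded_vector by blast
  then show False using unb[OF f(1,2)] by (meson not_le)
qed

text \<open>\<open>kesten_finite\<close> sees only finite sets of lines, while the walk may spread
  over uncountably many. At each step only the finitely many lines of noticeable mass matter, and
  their approximating sets are united.\<close>

lemma path_approx:
  assumes v0: "v0 \<in> Om"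
  shows "w \<in> Om \<Longrightarrow> 0 < \<epsilon> \<Longrightarrow> \<exists>A. finite A \<and> A \<subseteq> Om \<and> measure (cv \<mu> n) (St v0 w) \<le> pth kk v0 A n w + \<epsilon>"
proof (induction n arbitrary: w \<epsilon>)
  case 0
  show ?case
  proof (intro exI[of _ "{w}"] conjI)
    have "measure (cv \<mu> 0) (St v0 w) = indicator (St v0 w) (mat 1)"
      unfolding cv_0 by (rule measure_return[OF St_sets[OF v0 0(1)]])
    also have "\<dots> \<le> pth kk v0 {w} 0 w + \<epsilon>" using 0 by (auto simp: St_def ta_one indicator_def)
    finally show "measure (cv \<mu> 0) (St v0 w) \<le> pth kk v0 {w} 0 w + \<epsilon>" .
  qed (use 0 in auto)
next
  case (Suc n)
  interpret M: prob_space \<mu> by (rule prob)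
  interpret C: prob_space "cv \<mu> n" by (rule prob_cv)
  interpret C': prob_space "cv \<mu> (Suc n)" by (rule prob_cv)
  define t where "t = (\<lambda>v. measure (cv \<mu> n) (St v0 v))"
  define \<delta> where "\<delta> = \<epsilon> / 2"
  have \<delta>: "0 < \<delta>" using Suc.prems by (simp add: \<delta>_def)
  \<comment> \<open>The events of moving \<open>v0\<close> to different lines are disjoint, so at
    most \<open>1 / \<delta>\<close> lines carry more than \<open>\<delta>\<close>.\<close>
  define D where "D = {v \<in> Om. \<delta> < t v}"
  have "finite D"
  proof (rule ccontr)
    assume "infinite D"
    obtain N :: nat where N: "1 / \<delta> < real N" using reals_Archimedean2 by blast
    obtain B where B: "finite B" "card B = N" "B \<subseteq> D" using infinite_arbitrarily_large[OF \<open>infinite D\<close>] by blast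
    have "real N * \<delta> \<le> (\<Sum>v\<in>B. t v)" using B by (intro order_trans[OF _ sum_bounded_below[of B \<delta> t]]) (auto simp: D_def)
    also have "\<dots> \<le> 1" unfolding t_def using B v0 by (intro sum_St_row prob_cv sets_cv) (auto simp: D_def)
    finally show False using N \<delta> by (simp add: field_simps)
  qed
  \<comment> \<open>The error is shared among the members of \<open>D\<close>; the added 1 covers
    the case of empty \<open>D\<close>.\<close>
  have "\<forall>v\<in>D. \<exists>A. finite A \<and> A \<subseteq> Om \<and> t v \<le> pth kk v0 A n v + \<delta> / (real (card D) + 1)"
    using Suc.IH \<delta> unfolding t_def D_def by (intro ballI Suc.IH) auto
  from bchoice[OF this] obtain A0 where A0: "\<And>v. v \<in> D \<Longrightarrow> finite (A0 v)" "\<And>v. v \<in> D \<Longrightarrow> A0 v \<subseteq> Om"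
    "\<And>v. v \<in> D \<Longrightarrow> t v \<le> pth kk v0 (A0 v) n v + \<delta> / (real (card D) + 1)" by blast
  define A where "A = insert w (D \<union> (\<Union>v\<in>D. A0 v))"
  have A: "finite A" "A \<subseteq> Om" using \<open>finite D\<close> A0(1,2) Suc.prems by (auto simp: A_def D_def)
  have kk1: "kk v w \<le> 1" if "v \<in> D" for v
    by (simp add: kk_def)
  have le1: "emeasure (cv \<mu> (Suc n)) (St v0 w) \<le> ennreal (\<delta> + (\<Sum>v\<in>D. t v * kk v w))"
  proof -
    have "emeasure (cv \<mu> (Suc n)) (St v0 w) = (\<integral>\<^sup>+x. indicator (St v0 w) x \<partial>cv \<mu> (Suc n))"
      using St_sets[OF v0 Suc.prems(1)] by (intro nn_integral_indicator[symmetric]) (simp add: sets_cv)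
    also have "\<dots> = (\<integral>\<^sup>+g. \<integral>\<^sup>+h. indicator (St v0 w) (h ** g) \<partial>cv \<mu> n \<partial>\<mu>)"
      using St_sets[OF v0 Suc.prems(1)] by (intro nn_integral_cv_Suc) simp
    also have "\<dots> \<le> (\<integral>\<^sup>+g. ennreal (\<delta> + (\<Sum>v\<in>D. t v * indicator (St v w) g)) \<partial>\<mu>)"
    proof (rule nn_integral_mono_AE)
      have "(\<integral>\<^sup>+h. indicator (St v0 w) (h ** g) \<partial>cv \<mu> n) \<le> ennreal (\<delta> + (\<Sum>v\<in>D. t v * indicator (St v w) g))"
        if g: "det g = 1" for g
      proof -
        obtain g' where g': "det g' = 1" "g ** g' = mat 1" "g' ** g = mat 1" using SL_inverse[OF g] by blast
        \<comment> \<open>For fixed \<open>g\<close> the line \<open>w\<close> has exactly one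
          predecessor, so the lines outside \<open>D\<close> cost at most \<open>\<delta>\<close>
          altogether, however many there are.\<close>
        define v where "v = ta g' w"
        have v: "v \<in> Om" unfolding v_def by (rule ta_Om[OF Suc.prems(1) g'(1)])
        have "ta g v = w" unfolding v_def by (rule ta_inverse[OF g'(3)])
        then have gv: "g \<in> St v w" using g by (simp add: St_def)
        have "h ** g \<in> St v0 w \<longleftrightarrow> h \<in> St v0 v" for h
        proof -
          have "ta g (ta h v0) = w \<longleftrightarrow> ta h v0 = v"
            using \<open>ta g v = w\<close> bij_is_inj[OF bij_ta[OF g]] by (metis injD)
          then show ?thesis using g by (simp add: St_def det_mul ta_mult)
        qed
        then have "(\<integral>\<^sup>+h. indicator (St v0 w) (h ** g) \<partial>cv \<mu> n) = (\<integral>\<^sup>+h. indicator (St v0 v) h \<partial>cv \<mu> n)"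
          by (intro nn_integral_cong) (simp add: indicator_def)
        also have "\<dots> = emeasure (cv \<mu> n) (St v0 v)"
          using St_sets[OF v0 v] by (intro nn_integral_indicator) (simp add: sets_cv)
        also have "\<dots> = ennreal (t v)" by (simp add: t_def C.emeasure_eq_measure)
        also have "t v \<le> \<delta> + (\<Sum>v\<in>D. t v * indicator (St v w) g)"
        proof (cases "v \<in> D")
          case True
          have "t v * indicator (St v w) g \<le> (\<Sum>v\<in>D. t v * indicator (St v w) g)"
            using True \<open>finite D\<close> by (intro member_le_sum[where f = "\<lambda>v. t v * indicator (St v w) g"]) (auto simp: t_def)
          then show ?thesis using gv \<delta> by simp
        next
          case False
          then have "t v \<le> \<delta>" using v by (auto simp: D_def)
          moreover have "0 \<le> (\<Sum>v\<in>D. t v * indicator (St v w) g)" by (intro sum_nonneg) (simp add: t_def)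
          ultimately show ?thesis by simp
        qed
        finally show ?thesis by (simp add: ennreal_leI)
      qed
      with AE_det show "AE g in \<mu>. (\<integral>\<^sup>+h. indicator (St v0 w) (h ** g) \<partial>cv \<mu> n)
          \<le> ennreal (\<delta> + (\<Sum>v\<in>D. t v * indicator (St v w) g))" by auto
    qed
    also have "\<dots> = ennreal (\<integral>g. \<delta> + (\<Sum>v\<in>D. t v * indicator (St v w) g) \<partial>\<mu>)"
    proof (rule nn_integral_eq_integral)
      show "integrable \<mu> (\<lambda>g. \<delta> + (\<Sum>v\<in>D. t v * indicator (St v w) g))"
        using St_sets Suc.prems(1)
        by (intro Bochner_Integration.integrable_add Bochner_Integration.integrable_sum integrable_mult_right integrable_real_indicator)
          (auto simp: M.emeasure_finite less_top[symmetric] sets_mu D_def)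
      show "AE g in \<mu>. 0 \<le> \<delta> + (\<Sum>v\<in>D. t v * indicator (St v w) g)"
        using \<delta> by (intro AE_I2 add_nonneg_nonneg sum_nonneg) (auto simp: t_def)
    qed
    also have "(\<integral>g. \<delta> + (\<Sum>v\<in>D. t v * indicator (St v w) g) \<partial>\<mu>) = \<delta> + (\<Sum>v\<in>D. t v * kk v w)"
    proof -
      have int: "integrable \<mu> (\<lambda>g. t v * indicator (St v w) g)" if "v \<in> D" for v
        using St_sets Suc.prems(1) that
        by (intro integrable_mult_right integrable_real_indicator)
          (auto simp: M.emeasure_finite less_top[symmetric] sets_mu D_def)
      have "(\<integral>g. \<delta> + (\<Sum>v\<in>D. t v * indicator (St v w) g) \<partial>\<mu>)
        = (\<integral>g. \<delta> \<partial>\<mu>) + (\<integral>g. (\<Sum>v\<in>D. t v * indicator (St v w) g) \<partial>\<mu>)"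
        by (intro Bochner_Integration.integral_add Bochner_Integration.integrable_sum int) auto
      also have "(\<integral>g. (\<Sum>v\<in>D. t v * indicator (St v w) g) \<partial>\<mu>) = (\<Sum>v\<in>D. \<integral>g. t v * indicator (St v w) g \<partial>\<mu>)"
        by (intro Bochner_Integration.integral_sum int)
      also have "\<dots> = (\<Sum>v\<in>D. t v * kk v w)"
        using Suc.prems(1) by (intro sum.cong refl) (auto simp: kk_def D_def space_mu)
      finally show ?thesis by (simp add: M.prob_space)
    qed
    finally show ?thesis .
  qed
  have "measure (cv \<mu> (Suc n)) (St v0 w) \<le> \<delta> + (\<Sum>v\<in>D. t v * kk v w)"
  proof -
    have "0 \<le> \<delta> + (\<Sum>v\<in>D. t v * kk v w)"
      using \<delta> kk_nonneg by (intro add_nonneg_nonneg sum_nonneg mult_nonneg_nonneg) (auto simp: t_def)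
    then show ?thesis using le1 unfolding C'.emeasure_eq_measure by simp
  qed
  also have "(\<Sum>v\<in>D. t v * kk v w) \<le> (\<Sum>v\<in>D. pth kk v0 A n v * kk v w + \<delta> / (real (card D) + 1))"
  proof (rule sum_mono)
    fix v assume v: "v \<in> D"
    have "A0 v \<subseteq> A" using v by (auto simp: A_def)
    then have "pth kk v0 (A0 v) n v \<le> pth kk v0 A n v" by (intro pth_mono kk_nonneg A(1))
    then have "t v \<le> pth kk v0 A n v + \<delta> / (real (card D) + 1)" using A0(3)[OF v] by linarith
    from mult_right_mono[OF this kk_nonneg[of v w]]
    have "t v * kk v w \<le> pth kk v0 A n v * kk v w + \<delta> / (real (card D) + 1) * kk v w"
      by (simp only: distrib_right)
    also have "\<dots> \<le> pth kk v0 A n v * kk v w + \<delta> / (real (card D) + 1) * 1"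
      using kk1[OF v] \<delta> by (intro add_left_mono mult_left_mono) auto
    finally show "t v * kk v w \<le> pth kk v0 A n v * kk v w + \<delta> / (real (card D) + 1)" by simp
  qed
  also have "\<dots> = (\<Sum>v\<in>D. pth kk v0 A n v * kk v w) + real (card D) * (\<delta> / (real (card D) + 1))"
    by (simp add: sum.distrib)
  also have "\<dots> \<le> (\<Sum>v\<in>A. pth kk v0 A n v * kk v w) + \<delta>"
  proof (rule add_mono)
    show "(\<Sum>v\<in>D. pth kk v0 A n v * kk v w) \<le> (\<Sum>v\<in>A. pth kk v0 A n v * kk v w)"
      using A by (intro sum_mono2) (auto simp: A_def kk_nonneg pth_nonneg)
    show "real (card D) * (\<delta> / (real (card D) + 1)) \<le> \<delta>" using \<delta> by (simp add: field_simps)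
  qed
  also have "(\<Sum>v\<in>A. pth kk v0 A n v * kk v w) = pth kk v0 A (Suc n) w" by (simp add: A_def)
  finally have "measure (cv \<mu> (Suc n)) (St v0 w) \<le> pth kk v0 A (Suc n) w + \<epsilon>" by (simp add: \<delta>_def)
  with A show ?case by blast
qed

theorem line_concentration:
  "\<exists>\<rho>. 0 \<le> \<rho> \<and> \<rho> < 1 \<and> (\<forall>n. \<forall>v\<in>Om. \<forall>w\<in>Om. measure (cv \<mu> n) (St v w) \<le> (2 * real n + 1) * \<rho> ^ n)"
proof -
  obtain c where c: "0 < c" "c \<le> 1" and gap: "\<And>A a. finite A \<Longrightarrow> A \<subseteq> Om \<Longrightarrow> (\<And>v. 0 \<le> a v) \<Longrightarrow>
    (\<Sum>w\<in>A. \<Sum>v\<in>A. a v * kk v w * a w) \<le> (1 - c) * (\<Sum>v\<in>A. (a v)\<^sup>2)"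
    using gap_exists by blast
  have "measure (cv \<mu> n) (St v w) \<le> (2 * real n + 1) * (1 - c / 2) ^ n" if v: "v \<in> Om" and w: "w \<in> Om" for n v w
  proof (rule field_le_epsilon)
    fix \<epsilon> :: real assume "0 < \<epsilon>"
    then obtain A where A: "finite A" "A \<subseteq> Om" "measure (cv \<mu> n) (St v w) \<le> pth kk v A n w + \<epsilon>"
      using path_approx[OF v w] by blast
    have "pth kk v A n w \<le> (2 * real n + 1) * (1 - c / 2) ^ n"
      by (rule kesten_finite[OF A(1) kk_nonneg _ _ c(2) gap[OF A(1,2)]]) (use kk_row kk_col A in auto)
    with A(3) show "measure (cv \<mu> n) (St v w) \<le> (2 * real n + 1) * (1 - c / 2) ^ n + \<epsilon>" by linarith
  qed
  moreover have "0 \<le> 1 - c / 2" "1 - c / 2 < 1" using c by auto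
  ultimately show ?thesis by blast
qed

end

subsection \<open>Differences of polynomial functions\<close>

definition act2 :: "real^'d^'d \<Rightarrow> (real^'d^'d) \<times> (real^'d^'d) \<Rightarrow> (real^'d^'d) \<times> (real^'d^'d)" where
  "act2 g = (\<lambda>(x, y). (g ** x, g ** y))"

text \<open>Passing from \<open>Q\<close> to \<open>Q x - Q y\<close> is how functions modulo constants are represented.\<close>

definition dif :: "(real^'d^'d \<Rightarrow> real) \<Rightarrow> (real^'d^'d) \<times> (real^'d^'d) \<Rightarrow> real" where
  "dif Q = (\<lambda>(x, y). if det x = 1 \<and> det y = 1 then Q x - Q y else 0)"

lemma linear_dif: "linear dif"
  by (rule linearI) (auto simp: dif_def fun_eq_iff algebra_simps)

lemma dif_act2:
  assumes "det g = 1"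
  shows "(\<lambda>x. dif Q (act2 g x)) = dif (\<lambda>x. Q (g ** x))"
  using assms by (auto simp: dif_def act2_def fun_eq_iff det_mul)

lemma fun_rep_dif:
  fixes P :: "(real^'d^'d \<Rightarrow> real) set"
  assumes "polysp P"
  shows "fun_rep act2 (dif ` P)"
proof
  fix g h :: "real^'d^'d" and x :: "(real^'d^'d) \<times> (real^'d^'d)"
  show "act2 (mat 1) x = x" by (simp add: act2_def split: prod.split)
  show "act2 (g ** h) x = act2 g (act2 h x)" by (simp add: act2_def matrix_mul_assoc split: prod.split)
  obtain B where B: "finite B" "P = span B" using fd_basis[OF polyspD(1)[OF assms]] by metis
  have "dif ` P = span (dif ` B)" unfolding B(2) by (rule linear_span_image[OF linear_dif, symmetric])
  then show "fd (dif ` P)" using fd_span[of "dif ` B"] B(1) by simp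
next
  fix f and g :: "real^'d^'d" assume "f \<in> dif ` P" "det g = 1"
  then obtain Q where Q: "f = dif Q" "Q \<in> P" by blast
  have "(\<lambda>x. Q (g ** x ** mat 1)) \<in> P" by (rule polyspD(3)[OF assms Q(2) \<open>det g = 1\<close>]) simp
  then show "(\<lambda>x. f (act2 g x)) \<in> dif ` P" unfolding Q(1) dif_act2[OF \<open>det g = 1\<close>] by simp
next
  fix f and x :: "(real^'d^'d) \<times> (real^'d^'d)" assume "f \<in> dif ` P"
  then obtain Q where Q: "f = dif Q" "Q \<in> P" by blast
  obtain p where p: "real_polynomial_function p" "Q = rs p" using polyspD(2)[OF assms Q(2)] by blast
  obtain a b where x: "x = (a, b)" by (cases x)
  show "\<exists>p. real_polynomial_function p \<and> (\<forall>g. det g = 1 \<longrightarrow> f (act2 g x) = p g)"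
  proof (cases "det a = 1 \<and> det b = 1")
    case True
    have "real_polynomial_function (\<lambda>g. p (mat 1 ** g ** a) - p (mat 1 ** g ** b))"
      by (intro real_polynomial_function_diff polynomial_lmult p(1))
    moreover have "f (act2 g x) = p (mat 1 ** g ** a) - p (mat 1 ** g ** b)" if "det g = 1" for g
      using that True by (simp add: Q(1) p(2) x dif_def act2_def rs_def det_mul)
    ultimately show ?thesis by blast
  next
    case False
    then have "f (act2 g x) = 0" if "det g = 1" for g
      using that by (auto simp: Q(1) x dif_def act2_def det_mul)
    then show ?thesis by (intro exI[of _ "\<lambda>_. 0"]) (simp add: real_polynomial_function.intros(2))
  qed
qed

lemma elem_det: "A \<in> elem \<Longrightarrow> det A = 1"
  by (induction A rule: elem.induct) (auto simp: det_mul det_transv)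

text \<open>Each transvection is conjugate to its fourth power.\<close>

lemma SL_hom_trivial:
  fixes c :: "real^'d^'d \<Rightarrow> real"
  assumes hom: "\<And>g h. det g = 1 \<Longrightarrow> det h = 1 \<Longrightarrow> c (g ** h) = c g + c h" and g: "det g = 1"
  shows "c g = 0"
proof -
  have c1: "c (mat 1) = 0" using hom[of "mat 1" "mat 1"] by simp
  have tv: "c (transv m n s) = 0" if mn: "m \<noteq> n" for m n s
  proof -
    have T: "det (transv m n r) = 1" for r by (rule det_transv[OF mn])
    have add: "c (transv m n (r + r')) = c (transv m n r) + c (transv m n r')" for r r'
      using hom[OF T T] by (simp add: transv_add[OF mn])
    define d :: "'d \<Rightarrow> real" where "d = (\<lambda>i. if i = m then 2 else if i = n then 1 / 2 else 1)"
    have d: "det (dg d) = 1" unfolding d_def by (intro elem_det elem_hyperbolic mn) simp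
    have "dg d ** transv m n s = transv m n (s * d m / d n) ** dg d" by (rule dg_transv[OF mn]) (simp add: d_def)
    also have "s * d m / d n = (s + s) + (s + s)" using mn by (simp add: d_def)
    finally have "c (dg d) + c (transv m n s) = c (transv m n ((s + s) + (s + s))) + c (dg d)"
      using hom[OF d T] hom[OF T d] by metis
    then show ?thesis using add[of "s + s" "s + s"] add[of s s] by linarith
  qed
  show ?thesis using g
  proof (induction g rule: SL_induct)
    case one
    then show ?case by (rule c1)
  next
    case (step A m n s)
    then show ?case using hom[OF det_transv[OF step.hyps(2)] step.hyps(1)] tv by simp
  qed
qed

text \<open>A bounded polynomial is constant along every transvection curve, so bounded translates
  make \<open>p (g ** x) - p (g ** y)\<close> independent of \<open>g\<close>. Then \<open>p\<close>
  minus its value at the identity is additive on the group, and \<open>SL_hom_trivial\<close>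
  applies.\<close>

lemma dif_unbounded:
  fixes P :: "(real^'d^'d \<Rightarrow> real) set"
  assumes "polysp P" "f \<in> dif ` P" "f \<noteq> 0"
  shows "\<exists>x. \<forall>K. \<exists>g. det g = 1 \<and> K < \<bar>f (act2 g x)\<bar>"
proof (rule ccontr)
  assume "\<not> ?thesis"
  then have bd: "\<exists>K. \<forall>g. det g = 1 \<longrightarrow> \<bar>f (act2 g x)\<bar> \<le> K" for x by (meson not_le)
  obtain Q where Q: "f = dif Q" "Q \<in> P" using assms(2) by blast
  obtain p where p: "real_polynomial_function p" "Q = rs p" using polyspD(2)[OF assms(1) Q(2)] by blast
  have fe: "f (x, y) = p x - p y" if "det x = 1" "det y = 1" for x y
    using that by (simp add: Q(1) p(2) dif_def rs_def)
  have tv: "p (transv m n s ** x) - p (transv m n s ** y) = p x - p y"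
    if mn: "m \<noteq> n" and xy: "det x = 1" "det y = 1" for m n s x y
  proof -
    obtain K where K: "\<And>g. det g = 1 \<Longrightarrow> \<bar>f (act2 g (x, y))\<bar> \<le> K" using bd by blast
    define q where "q = (\<lambda>s. p (mat 1 ** transv m n s ** x) - p (mat 1 ** transv m n s ** y))"
    have "real_polynomial_function q"
      unfolding q_def by (intro real_polynomial_function_diff polynomial_transv_curve p(1))
    moreover have "\<bar>q s\<bar> \<le> K" for s
      using K[OF det_transv[OF mn], of s] xy by (simp add: act2_def fe det_mul det_transv[OF mn] q_def)
    ultimately have "q s = q 0" by (rule poly_curve_bounded_const)
    then show ?thesis by (simp add: q_def transv_zero[OF mn])
  qed
  have inv: "p (g ** x) - p (g ** y) = p x - p y" if "det g = 1" and xy: "det x = 1" "det y = 1" for g x y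
    using that(1)
  proof (induction g rule: SL_induct)
    case one
    then show ?case by simp
  next
    case (step A m n s)
    have "p (transv m n s ** (A ** x)) - p (transv m n s ** (A ** y)) = p (A ** x) - p (A ** y)"
      using step.hyps xy by (intro tv) (simp_all add: det_mul)
    then show ?case using step.IH by (simp add: matrix_mul_assoc)
  qed
  have p1: "p g - p (mat 1) = 0" if g: "det g = 1" for g
  proof (rule SL_hom_trivial[where c = "\<lambda>g. p g - p (mat 1)", OF _ g])
    fix g h :: "real^'d^'d" assume "det g = 1" "det h = 1"
    then show "p (g ** h) - p (mat 1) = (p g - p (mat 1)) + (p h - p (mat 1))"
      using inv[of g h "mat 1"] by simp
  qed
  have "f = 0"
  proof
    fix x :: "(real^'d^'d) \<times> (real^'d^'d)"
    obtain a b where x: "x = (a, b)" by (cases x)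
    show "f x = 0 x"
    proof (cases "det a = 1 \<and> det b = 1")
      case True
      then have "f x = (p a - p (mat 1)) - (p b - p (mat 1))" using fe[of a b] by (simp add: x)
      also have "\<dots> = 0" using p1[of a] p1[of b] True by linarith
      finally show ?thesis by simp
    next
      case False
      then show ?thesis by (auto simp: Q(1) x dif_def)
    qed
  qed
  with assms(3) show False by simp
qed

subsection \<open>Pluecker coordinates of spaces of functions\<close>

definition ltr :: "real^'d^'d \<Rightarrow> (real^'d^'d \<Rightarrow> real) \<Rightarrow> real^'d^'d \<Rightarrow> real" where
  "ltr g f = (\<lambda>x. f (g ** x))"

lemma linear_ltr: "linear (ltr g)"
  unfolding ltr_def by (rule linear_comp_op)

lemma ltr_mult: "ltr (g ** h) f = ltr h (ltr g f)"
  by (simp add: ltr_def matrix_mul_assoc)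

lemma ltr_one: "ltr (mat 1) f = f"
  by (simp add: ltr_def)

lemma ltr_polysp: "polysp P \<Longrightarrow> f \<in> P \<Longrightarrow> det g = 1 \<Longrightarrow> ltr g f \<in> P"
  using polyspD(3)[of P f g "mat 1"] by (simp add: ltr_def)

text \<open>The Pluecker coordinate, at the evaluations in the points \<open>y k\<close>, of the
  translate by \<open>g\<close> of the space with basis \<open>e\<close>, seen as a function of
  \<open>g\<close>.\<close>

definition pl :: "nat \<Rightarrow> (nat \<Rightarrow> real^'d^'d \<Rightarrow> real) \<Rightarrow> (nat \<Rightarrow> real^'d^'d) \<Rightarrow> real^'d^'d \<Rightarrow> real" where
  "pl n e y = rs (\<lambda>g. ldet n (\<lambda>k i. e i (g ** y k)))"

lemma frame_points_SL:
  assumes "polysp P" "F \<subseteq> P" "frame F n t e" "i < n"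
  shows "det (t i) = 1"
proof (rule ccontr)
  assume "det (t i) \<noteq> 1"
  moreover have "e i \<in> P" using frameD(2)[OF assms(3,4)] assms(2) by blast
  ultimately have "e i (t i) = 0" using polyspD(4)[OF assms(1)] by blast
  then show False using frameD(3)[OF assms(3,4,4)] by simp
qed

text \<open>If all Pluecker functions of \<open>F\<close> were constant, then evaluating at the frame points with one
  point replaced by \<open>x\<close> would express each \<open>e i\<close> through the translates \<open>ltr g (e k)\<close>.\<close>

lemma pluecker_nonconstant:
  assumes P: "polysp P" and FP: "F \<subseteq> P" and fr: "frame F n t e"
    and f: "f \<in> F" "det a = 1" "ltr a f \<notin> F"
  shows "\<exists>y. (\<forall>k<n. det (y k) = 1) \<and> dif (pl n e y) \<noteq> 0"
proof (rule ccontr)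
  assume neg: "\<not> ?thesis"
  obtain g where g: "det g = 1" "a ** g = mat 1" "g ** a = mat 1" using SL_inverse[OF f(2)] by blast
  have const: "ldet n (\<lambda>k i. e i (g ** y k)) = ldet n (\<lambda>k i. e i (y k))" if "\<And>k. k < n \<Longrightarrow> det (y k) = 1" for y
  proof -
    have "dif (pl n e y) = 0" using neg that by blast
    then have "dif (pl n e y) (g, mat 1) = 0" by simp
    then show ?thesis using g(1) by (simp add: dif_def pl_def rs_def)
  qed
  have sub: "subspace (ltr g ` F)" by (rule linear_subspace_image[OF linear_ltr frameD(1)[OF fr]])
  have "e i \<in> ltr g ` F" if i: "i < n" for i
  proof -
    have row: "ldet n (\<lambda>k j. e j ((t(i := x)) k)) = e i x" for x
    proof -
      have "ldet n (\<lambda>k j. e j ((t(i := x)) k)) = e i ((t(i := x)) i)"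
        using frameD(3)[OF fr] by (intro ldet_row i) auto
      then show ?thesis by simp
    qed
    \<comment> \<open>The factors of the Leibniz formula that do not involve row \<open>i\<close>,
      the only row containing \<open>x\<close>.\<close>
    define D where "D = (\<lambda>p. of_int (sign p) * (\<Prod>k\<in>{0..<n} - {i}. e (p k) (g ** t k)))"
    have "e i = (\<Sum>p | p permutes {0..<n}. D p *\<^sub>R ltr g (e (p i)))"
    proof
      fix x
      show "e i x = (\<Sum>p | p permutes {0..<n}. D p *\<^sub>R ltr g (e (p i))) x"
      proof (cases "det x = 1")
        case True
        have "e i x = ldet n (\<lambda>k j. e j (g ** (t(i := x)) k))"
          using const[of "t(i := x)"] row[of x] True frame_points_SL[OF P FP fr] by simp
        also have "\<dots> = (\<Sum>p | p permutes {0..<n}. D p * e (p i) (g ** x))"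
          unfolding ldet_expand
        proof (intro sum.cong refl)
          fix p
          have "(\<Prod>k = 0..<n. e (p k) (g ** (t(i := x)) k))
            = e (p i) (g ** x) * (\<Prod>k\<in>{0..<n} - {i}. e (p k) (g ** t k))"
            using i by (subst prod.remove[of _ i]) auto
          then show "of_int (sign p) * (\<Prod>k = 0..<n. e (p k) (g ** (t(i := x)) k)) = D p * e (p i) (g ** x)"
            by (simp add: D_def)
        qed
        finally show ?thesis by (simp add: sum_fun_apply ltr_def)
      next
        case False
        have eP: "e j \<in> P" if "j < n" for j using frameD(2)[OF fr that] FP by blast
        have "e j (g ** x) = 0" if "j < n" for j
          using polyspD(4)[OF P eP[OF that]] False g(1) by (simp add: det_mul)
        moreover have "p i < n" if "p permutes {0..<n}" for p using permutes_in_image[OF that, of i] i by simp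
        ultimately have "(\<Sum>p | p permutes {0..<n}. D p *\<^sub>R ltr g (e (p i))) x = 0"
          unfolding sum_fun_apply by (intro sum.neutral) (auto simp: ltr_def)
        moreover have "e i x = 0" using polyspD(4)[OF P eP[OF i] False] .
        ultimately show ?thesis by simp
      qed
    qed
    also have "\<dots> \<in> ltr g ` F"
    proof (intro subspace_sum[OF sub] subspace_scale[OF sub] imageI frameD(2)[OF fr])
      fix p assume "p \<in> {p. p permutes {0..<n}}"
      then show "p i < n" using permutes_in_image[of p "{0..<n}" i] i by simp
    qed
    finally show ?thesis .
  qed
  then have "span (e ` {..<n}) \<subseteq> ltr g ` F" by (intro span_minimal sub) auto
  with frame_basis(1)[OF fr] have "F \<subseteq> ltr g ` F" by (rule ord_eq_le_trans)
  then obtain h where h: "h \<in> F" "f = ltr g h" using f(1) by blast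
  have "ltr a f = h" unfolding h(2) by (simp add: ltr_mult[symmetric] g ltr_one)
  with f(3) h(1) show False by simp
qed

text \<open>A change of basis multiplies all Pluecker coordinates by the determinant of the
  transition matrix, which depends neither on \<open>g\<close> nor on \<open>y\<close>. A
  coincidence of subspaces thus becomes a coincidence of lines of functions.\<close>

lemma pluecker_translate:
  assumes P: "polysp P" and FP: "F \<subseteq> P" "F' \<subseteq> P" and fr: "frame F n t e" and fr': "frame F' n t' e'"
    and S: "det S = 1" "ltr S ` F = F'"
  shows "ltr S (pl n e y) = ldet n (\<lambda>k i. e i (S ** t' k)) *\<^sub>R pl n e' y"
proof
  fix g
  show "ltr S (pl n e y) g = (ldet n (\<lambda>k i. e i (S ** t' k)) *\<^sub>R pl n e' y) g"
  proof (cases "det g = 1")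
    case False
    then show ?thesis using S(1) by (simp add: ltr_def pl_def rs_def det_mul)
  next
    case True
    have "e i (S ** g ** y k) = (\<Sum>l<n. e' l (g ** y k) * e i (S ** t' l))" if "i < n" for i k
    proof -
      have "ltr S (e i) \<in> F'" using S(2) frameD(2)[OF fr that] by blast
      from frameD(4)[OF fr' this, of "g ** y k"] show ?thesis
        by (simp add: ltr_def matrix_mul_assoc mult.commute)
    qed
    then have "ldet n (\<lambda>k i. e i (S ** g ** y k)) = ldet n (\<lambda>k i. \<Sum>l<n. e' l (g ** y k) * e i (S ** t' l))"
      by (intro ldet_cong)
    also have "\<dots> = ldet n (\<lambda>k l. e' l (g ** y k)) * ldet n (\<lambda>l i. e i (S ** t' l))"
      by (rule ldet_mult)
    finally show ?thesis using True S(1)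
      by (simp add: ltr_def pl_def rs_def det_mul matrix_mul_assoc mult.commute)
  qed
qed

subsection \<open>Zariski density of subgroups of full measure\<close>

text \<open>Cramer's rule: the inverse on the special linear group, as a polynomial map.\<close>

definition minv :: "real^'d^'d \<Rightarrow> real^'d^'d" where
  "minv A = (\<chi> k j. det (\<chi> i l. if l = k then axis j 1 $ i else A $ i $ l))"

lemma minv_right:
  fixes A :: "real^'d^'d"
  assumes "det A = 1"
  shows "A ** minv A = mat 1"
proof -
  have "A *v (\<chi> k. minv A $ k $ j) = axis j 1" for j
    using cramer[of A "\<chi> k. minv A $ k $ j" "axis j 1"] assms by (simp add: minv_def)
  then have "(A *v (\<chi> k. minv A $ k $ j)) $ i = axis j 1 $ i" for i j by simp
  then have "(A ** minv A) $ i $ j = axis j 1 $ i" for i j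
    by (simp add: matrix_matrix_mult_def matrix_vector_mult_def)
  then show ?thesis by (simp add: vec_eq_iff mat_def axis_def)
qed

lemma polynomial_minv:
  fixes p :: "real^'d^'d \<Rightarrow> real"
  assumes "real_polynomial_function p"
  shows "real_polynomial_function (\<lambda>A. p (minv A))"
proof -
  have ent: "real_polynomial_function (\<lambda>A :: real^'d^'d. A $ i $ j)" for i j
    by (rule real_polynomial_function.intros(1), rule bounded_linear_compose[OF bounded_linear_vec_nth bounded_linear_vec_nth])
  have "real_polynomial_function (\<lambda>A :: real^'d^'d. if l = k then axis j 1 $ i else A $ i $ l)" for i j k l
    by (cases "l = k") (simp_all add: ent real_polynomial_function.intros(2))
  then have minv: "real_polynomial_function (\<lambda>A :: real^'d^'d. minv A $ k $ j)" for k j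
    unfolding minv_def Determinants.det_def
    by (simp only: vec_lambda_beta, intro real_polynomial_function_sum real_polynomial_function.intros(2,4) real_polynomial_function_prod)
      (auto simp: finite_permutations)
  have "polynomial_function (minv :: real^'d^'d \<Rightarrow> _)"
    unfolding polynomial_function_iff_Basis_inner
  proof
    fix b :: "real^'d^'d" assume "b \<in> Basis"
    then obtain i j where "b = axis i (axis j 1)" by (auto simp: Basis_vec_def)
    then show "real_polynomial_function (\<lambda>A. minv A \<bullet> b)" using minv[of i j] by (simp add: inner_axis)
  qed
  from real_polynomial_function_compose[OF this assms] show ?thesis by (simp add: o_def)
qed

lemma right_inverse_unique:
  fixes A :: "real^'d^'d"
  assumes "det A = 1" "A ** B = mat 1" "A ** C = mat 1"
  shows "B = C"
proof -
  obtain A' where "A' ** A = mat 1" using SL_inverse[OF assms(1)] by blast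
  then have "B = A' ** (A ** B)" "C = A' ** (A ** C)" by (simp_all add: matrix_mul_assoc)
  then show ?thesis using assms by simp
qed

text \<open>If a polynomial vanishes on \<open>G\<close>, its nonzero set is open and null, so it
  misses the support. Hence the support lies in the Zariski closure \<open>C\<close> of
  \<open>G\<close>; this is again a group, so it contains \<open>\<Gamma>\<close> and therefore
  everything.\<close>

lemma full_measure_dense:
  fixes \<mu> :: "(real^'d^'d) measure" and \<Gamma> :: "(real^'d^'d) set"
  assumes sets: "sets \<mu> = sets SL_borel"
    and gen: "generate SL (measure_support \<mu>) = \<Gamma>" and dense: "zariski_dense_in \<Gamma> (carrier SL)"
    and G_det: "\<And>g. g \<in> G \<Longrightarrow> det g = 1" and G_one: "mat 1 \<in> G"
    and G_mult: "\<And>g h. g \<in> G \<Longrightarrow> h \<in> G \<Longrightarrow> g ** h \<in> G"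
    and G_inv: "\<And>g. g \<in> G \<Longrightarrow> \<exists>h\<in>G. g ** h = mat 1 \<and> h ** g = mat 1"
    and AE_G: "AE g in \<mu>. g \<in> G"
    and p: "real_polynomial_function p" "\<And>g. g \<in> G \<Longrightarrow> p g = 0" and a: "det a = 1"
  shows "p a = 0"
proof -
  define van where "van = (\<lambda>p :: real^'d^'d \<Rightarrow> real. real_polynomial_function p \<and> (\<forall>g\<in>G. p g = 0))"
  define C where "C = {c :: real^'d^'d. det c = 1 \<and> (\<forall>p. van p \<longrightarrow> p c = 0)}"
  have C_mult: "c ** d \<in> C" if c: "c \<in> C" and d: "d \<in> C" for c d
  proof -
    have "p (c ** d) = 0" if p: "van p" for p
    proof -
      have "p (h ** d) = 0" if h: "h \<in> G" for h
      proof -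
        have "van (\<lambda>x. p (h ** x ** mat 1))"
          using p G_mult[OF h] unfolding van_def by (intro conjI ballI polynomial_lmult) simp_all
        then have "(\<lambda>x. p (h ** x ** mat 1)) d = 0" using d unfolding C_def by blast
        then show ?thesis by simp
      qed
      then have "van (\<lambda>x. p (mat 1 ** x ** d))" using p unfolding van_def by (intro conjI ballI polynomial_lmult) simp_all
      then have "(\<lambda>x. p (mat 1 ** x ** d)) c = 0" using c unfolding C_def by blast
      then show ?thesis by simp
    qed
    then show ?thesis using c d by (simp add: C_def det_mul)
  qed
  have C_inv: "minv c \<in> C" if c: "c \<in> C" for c
  proof -
    have dc: "det c = 1" using c by (simp add: C_def)
    have "det c * det (minv c) = 1" using arg_cong[OF minv_right[OF dc], of det] by (simp add: det_mul)
    then have "det (minv c) = 1" using dc by simp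
    moreover have "p (minv c) = 0" if p: "van p" for p
    proof -
      have "p (minv g) = 0" if g: "g \<in> G" for g
      proof -
        obtain h where "h \<in> G" "g ** h = mat 1" using G_inv[OF g] by blast
        then have "minv g = h" using right_inverse_unique[OF G_det[OF g] minv_right[OF G_det[OF g]]] by blast
        then show ?thesis using p \<open>h \<in> G\<close> by (simp add: van_def)
      qed
      then have "van (\<lambda>x. p (minv x))" using p polynomial_minv unfolding van_def by blast
      then show ?thesis using c unfolding C_def by blast
    qed
    ultimately show ?thesis by (simp add: C_def)
  qed
  have space: "space \<mu> = {g. det g = 1}"
    using sets_eq_imp_space_eq[OF sets] by (simp add: SL_borel_def SL_def space_restrict_space)
  have supp: "measure_support \<mu> \<subseteq> C"
  proof
    fix x assume x: "x \<in> measure_support \<mu>"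
    have "p x = 0" if p: "van p" for p
    proof (rule ccontr)
      assume "p x \<noteq> 0"
      have "open {y. p y \<noteq> 0}"
        using p by (intro open_Collect_neq continuous_on_poly continuous_on_const) (simp add: van_def)
      then have "0 < emeasure \<mu> ({y. p y \<noteq> 0} \<inter> space \<mu>)"
        using x \<open>p x \<noteq> 0\<close> unfolding measure_support_def by blast
      moreover have "AE y in \<mu>. \<not> p y \<noteq> 0" using AE_G by eventually_elim (use p in \<open>simp add: van_def\<close>)
      then have "emeasure \<mu> {y \<in> space \<mu>. p y \<noteq> 0} = 0" by (rule emeasure_eq_0_AE)
      moreover have "{y \<in> space \<mu>. p y \<noteq> 0} = {y. p y \<noteq> 0} \<inter> space \<mu>" by blast
      ultimately show False by simp
    qed
    moreover have "det x = 1" using x space by (simp add: measure_support_def)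
    ultimately show "x \<in> C" by (simp add: C_def)
  qed
  have "x \<in> C" if "x \<in> generate SL (measure_support \<mu>)" for x
    using that
  proof (induction x rule: generate.induct)
    case one
    have "mat 1 \<in> C" using G_one by (auto simp: C_def van_def)
    then show ?case by (simp add: SL_def)
  next
    case (incl h)
    then show ?case using supp by blast
  next
    case (inv h)
    then have h: "h \<in> C" using supp by blast
    then have "det h = 1" by (simp add: C_def)
    then have "h \<in> carrier SL" by (simp add: SL_def)
    from group.r_inv[OF group_SL this] have "h ** inv\<^bsub>SL\<^esub> h = mat 1" by (simp add: SL_def)
    then have "inv\<^bsub>SL\<^esub> h = minv h" using right_inverse_unique[OF \<open>det h = 1\<close> _ minv_right[OF \<open>det h = 1\<close>]] by blast
    then show ?case using C_inv[OF h] by simp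
  next
    case (eng x y)
    then show ?case using C_mult by (simp add: SL_def)
  qed
  then have "\<Gamma> \<subseteq> C" using gen by blast
  then have "\<Gamma> \<subseteq> {x. p x = 0}" using p by (auto simp: C_def van_def)
  moreover have "algebraic_set {x. p x = 0}" unfolding algebraic_set_def using p(1) by (intro exI[of _ "{p}"]) auto
  moreover have "a \<in> zariski_closure \<Gamma>" using dense a unfolding zariski_dense_in_def by (auto simp: SL_def)
  ultimately show ?thesis unfolding zariski_closure_def by blast
qed

subsection \<open>Exponential bounds\<close>

lemma linear_geometric_bound:
  fixes \<rho> :: real
  assumes "0 \<le> \<rho>" "\<rho> < 1"
  shows "\<exists>C r. 0 \<le> C \<and> 0 < r \<and> r < 1 \<and> (\<forall>n. (2 * real n + 1) * \<rho> ^ n \<le> C * r ^ n)"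
proof -
  \<comment> \<open>The midpoint between \<open>\<rho>\<close> and 1: the linear factor is absorbed
    because \<open>\<rho> / r\<close> is less than 1.\<close>
  define r where "r = (\<rho> + 1) / 2"
  have r: "0 < r" "r < 1" "\<rho> < r" using assms by (auto simp: r_def)
  define x where "x = \<rho> / r"
  have x: "0 \<le> x" "x < 1" using r assms by (auto simp: x_def)
  have "(\<lambda>n. real n * x ^ n) \<longlonglongrightarrow> 0" using powser_times_n_limit_0[of x] x by simp
  then have "Bseq (\<lambda>n. real n * x ^ n)" by (intro convergent_imp_Bseq convergentI)
  then obtain K where K: "0 < K" "\<And>n. norm (real n * x ^ n) \<le> K" by (rule BseqE) blast
  have "(2 * real n + 1) * \<rho> ^ n \<le> (2 * K + 1) * r ^ n" for n
  proof -
    have "(2 * real n + 1) * x ^ n = 2 * (real n * x ^ n) + x ^ n" by (simp add: algebra_simps)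
    also have "\<dots> \<le> 2 * K + 1" using K(2)[of n] power_le_one[of x n] x by (intro add_mono) auto
    finally have "(2 * real n + 1) * x ^ n * r ^ n \<le> (2 * K + 1) * r ^ n" using r by (intro mult_right_mono) auto
    moreover have "x ^ n * r ^ n = \<rho> ^ n" using r by (simp add: x_def power_divide)
    ultimately show ?thesis by (simp add: mult.assoc)
  qed
  then show ?thesis using r K(1) by (intro exI[of _ "2 * K + 1"] exI[of _ r]) auto
qed

text \<open>The square on the left and the halved time each cost a square root of the rate; dividing
  by \<open>sqrt r\<close> pays for odd \<open>n\<close>.\<close>

lemma sqrt_half_bound:
  fixes q :: "nat \<Rightarrow> real"
  assumes r: "0 < r" "r < 1" and D: "0 \<le> D" and q: "(q n)\<^sup>2 \<le> D * r ^ (n div 2)"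
  shows "q n \<le> sqrt (D / sqrt r) * sqrt (sqrt r) ^ n"
proof (rule power2_le_imp_le)
  have "sqrt r * r ^ (n div 2) = sqrt r ^ (2 * (n div 2) + 1)" using r by (simp add: power_mult)
  also have "\<dots> \<le> sqrt r ^ n" using r by (intro power_decreasing) auto
  finally have "r ^ (n div 2) \<le> sqrt r ^ n / sqrt r" using r by (simp add: field_simps)
  then have "D * r ^ (n div 2) \<le> D * (sqrt r ^ n / sqrt r)" using D by (rule mult_left_mono)
  also have "\<dots> = (sqrt (D / sqrt r) * sqrt (sqrt r) ^ n)\<^sup>2"
  proof -
    have "(sqrt (sqrt r) ^ n)\<^sup>2 = ((sqrt (sqrt r))\<^sup>2) ^ n" by (simp only: power_mult[symmetric] mult.commute)
    also have "\<dots> = sqrt r ^ n" using r by simp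
    finally show ?thesis using r D by (simp add: power_mult_distrib)
  qed
  finally show "(q n)\<^sup>2 \<le> (sqrt (D / sqrt r) * sqrt (sqrt r) ^ n)\<^sup>2" using q by linarith
  show "0 \<le> sqrt (D / sqrt r) * sqrt (sqrt r) ^ n" using r D by simp
qed

context mat_walk
begin

lemma measurable_translate:
  fixes f :: "real^'d^'d \<Rightarrow> ennreal"
  assumes "f \<in> borel_measurable borel"
  shows "(\<lambda>(h, g). f (h ** g)) \<in> borel_measurable (cv \<mu> n \<Otimes>\<^sub>M cv \<mu> m)"
    and "(\<lambda>(g, h). f (h ** g)) \<in> borel_measurable (cv \<mu> m \<Otimes>\<^sub>M cv \<mu> n)"
    and "(\<lambda>h. f (h ** g)) \<in> borel_measurable (cv \<mu> n)"
    and "(\<lambda>g. f (h ** g)) \<in> borel_measurable (cv \<mu> n)"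
proof -
  have sets: "sets (cv \<mu> n \<Otimes>\<^sub>M cv \<mu> m) = sets (borel \<Otimes>\<^sub>M (borel :: (real^'d^'d) measure))" for n m
    by (rule sets_pair_measure_cong[OF sets_cv sets_cv])
  have 1: "(\<lambda>x :: (real^'d^'d) \<times> (real^'d^'d). f (case x of (h, g) \<Rightarrow> h ** g)) \<in> borel_measurable (borel \<Otimes>\<^sub>M borel)"
    by (rule measurable_compose[OF measurable_matrix_mult assms])
  then show *: "(\<lambda>(h, g). f (h ** g)) \<in> borel_measurable (cv \<mu> n \<Otimes>\<^sub>M cv \<mu> m)" for n m
    unfolding measurable_cong_sets[OF sets refl] by (simp add: case_prod_beta)
  show "(\<lambda>(g, h). f (h ** g)) \<in> borel_measurable (cv \<mu> m \<Otimes>\<^sub>M cv \<mu> n)"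
    using measurable_compose[OF measurable_pair_swap' *[of n m]] by (simp add: case_prod_beta)
  show "(\<lambda>h. f (h ** g)) \<in> borel_measurable (cv \<mu> n)"
    using measurable_compose[OF measurable_Pair2'[of g "cv \<mu> n" "cv \<mu> n"] *[of n n]] by (simp add: space_cv)
  show "(\<lambda>g. f (h ** g)) \<in> borel_measurable (cv \<mu> n)"
    using measurable_compose[OF measurable_Pair1'[of h "cv \<mu> n" "cv \<mu> n"] *[of n n]] by (simp add: space_cv)
qed

lemma borel_measurable_inner:
  fixes f :: "real^'d^'d \<Rightarrow> ennreal"
  assumes "f \<in> borel_measurable borel"
  shows "(\<lambda>g. \<integral>\<^sup>+h. f (h ** g) \<partial>cv \<mu> n) \<in> borel_measurable (borel :: (real^'d^'d) measure)"
proof -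
  interpret A: prob_space "cv \<mu> n" by (rule prob_cv)
  have "(\<lambda>g. \<integral>\<^sup>+h. f (h ** g) \<partial>cv \<mu> n) \<in> borel_measurable (cv \<mu> 0)"
    using measurable_translate(2)[OF assms, where m = 0 and n = n] by (rule A.borel_measurable_nn_integral)
  then show ?thesis unfolding measurable_cong_sets[OF sets_cv refl] .
qed

lemma nn_integral_cv_add:
  fixes f :: "real^'d^'d \<Rightarrow> ennreal"
  assumes "f \<in> borel_measurable borel"
  shows "(\<integral>\<^sup>+x. f x \<partial>cv \<mu> (n + m)) = (\<integral>\<^sup>+g. \<integral>\<^sup>+h. f (h ** g) \<partial>cv \<mu> n \<partial>cv \<mu> m)"
  using assms
proof (induction m arbitrary: f)
  case 0
  show ?case unfolding cv_0 using borel_measurable_inner[OF 0]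
    by (subst nn_integral_return) auto
next
  case (Suc m)
  have tr: "(\<lambda>x. f (x ** g)) \<in> borel_measurable borel" for g :: "real^'d^'d"
    using measurable_translate(3)[OF Suc.prems, of g 0] unfolding measurable_cong_sets[OF sets_cv refl] .
  have "(\<integral>\<^sup>+x. f x \<partial>cv \<mu> (n + Suc m)) = (\<integral>\<^sup>+g. \<integral>\<^sup>+x. f (x ** g) \<partial>cv \<mu> (n + m) \<partial>\<mu>)"
    using nn_integral_cv_Suc[OF Suc.prems, of "n + m"] by simp
  also have "\<dots> = (\<integral>\<^sup>+g. \<integral>\<^sup>+k. \<integral>\<^sup>+h. f (h ** k ** g) \<partial>cv \<mu> n \<partial>cv \<mu> m \<partial>\<mu>)"
    using Suc.IH[OF tr] by simp
  also have "\<dots> = (\<integral>\<^sup>+g. \<integral>\<^sup>+h. f (h ** g) \<partial>cv \<mu> n \<partial>cv \<mu> (Suc m))"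
    using nn_integral_cv_Suc[OF borel_measurable_inner[OF Suc.prems, of n], of m] by (simp add: matrix_mul_assoc)
  finally show ?case .
qed

end

context mat_walk
begin

text \<open>Cauchy--Schwarz in the first \<open>m\<close> factors replaces the last \<open>n\<close> by two independent copies \<open>h\<close>, \<open>h'\<close>.\<close>

lemma decoupling:
  assumes V: "V \<in> sets borel" and \<beta>: "0 \<le> \<beta>" and \<gamma>: "0 \<le> \<gamma>"
    and dec: "\<And>h'. det h' = 1 \<Longrightarrow> \<exists>B \<in> sets borel. measure (cv \<mu> n) B \<le> \<beta>
      \<and> (\<forall>h. det h = 1 \<longrightarrow> h \<notin> B \<longrightarrow> measure (cv \<mu> m) {g. h ** g \<in> V \<and> h' ** g \<in> V} \<le> \<gamma>)"
  shows "(measure (cv \<mu> (n + m)) V)\<^sup>2 \<le> \<beta> + \<gamma>"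
proof -
  interpret A: prob_space "cv \<mu> n" by (rule prob_cv)
  interpret C: prob_space "cv \<mu> m" by (rule prob_cv)
  interpret S: prob_space "cv \<mu> (n + m)" by (rule prob_cv)
  interpret P: pair_sigma_finite "cv \<mu> m" "cv \<mu> n" ..
  define f :: "real^'d^'d \<Rightarrow> ennreal" where "f = indicator V"
  have f: "f \<in> borel_measurable borel" unfolding f_def using V by simp
  define \<Phi> where "\<Phi> = (\<lambda>g. \<integral>\<^sup>+h. f (h ** g) \<partial>cv \<mu> n)"
  have mPhi: "\<Phi> \<in> borel_measurable (cv \<mu> m)"
    unfolding \<Phi>_def using borel_measurable_inner[OF f] by (simp add: measurable_cong_sets[OF sets_cv refl])
  note mt = measurable_translate[OF f]
  have "(emeasure (cv \<mu> (n + m)) V)\<^sup>2 = (\<integral>\<^sup>+g. \<Phi> g * 1 \<partial>cv \<mu> m)\<^sup>2"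
  proof -
    have "emeasure (cv \<mu> (n + m)) V = (\<integral>\<^sup>+x. f x \<partial>cv \<mu> (n + m))"
      unfolding f_def using V by (intro nn_integral_indicator[symmetric]) (simp add: sets_cv)
    then show ?thesis unfolding nn_integral_cv_add[OF f] \<Phi>_def by simp
  qed
  also have "\<dots> \<le> (\<integral>\<^sup>+g. (\<Phi> g)\<^sup>2 \<partial>cv \<mu> m) * (\<integral>\<^sup>+g. 1\<^sup>2 \<partial>cv \<mu> m)"
    by (rule Cauchy_Schwarz_nn_integral) (use mPhi in auto)
  also have "\<dots> = (\<integral>\<^sup>+g. (\<Phi> g)\<^sup>2 \<partial>cv \<mu> m)" by (simp add: C.emeasure_space_1)
  also have "\<dots> = (\<integral>\<^sup>+g. \<integral>\<^sup>+h'. \<Phi> g * f (h' ** g) \<partial>cv \<mu> n \<partial>cv \<mu> m)"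
  proof (rule nn_integral_cong)
    fix g
    have "(\<integral>\<^sup>+h'. \<Phi> g * f (h' ** g) \<partial>cv \<mu> n) = \<Phi> g * \<Phi> g"
      using mt(3) by (subst nn_integral_cmult) (auto simp: \<Phi>_def)
    then show "(\<Phi> g)\<^sup>2 = (\<integral>\<^sup>+h'. \<Phi> g * f (h' ** g) \<partial>cv \<mu> n)" by (simp add: power2_eq_square)
  qed
  also have "\<dots> = (\<integral>\<^sup>+h'. \<integral>\<^sup>+g. \<Phi> g * f (h' ** g) \<partial>cv \<mu> m \<partial>cv \<mu> n)"
  proof (rule P.Fubini'[symmetric])
    have "(\<lambda>x. \<Phi> (fst x)) \<in> borel_measurable (cv \<mu> m \<Otimes>\<^sub>M cv \<mu> n)"
      using measurable_compose[OF measurable_fst mPhi] .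
    moreover have "(\<lambda>x. f (snd x ** fst x)) \<in> borel_measurable (cv \<mu> m \<Otimes>\<^sub>M cv \<mu> n)"
      using mt(2) by (simp add: case_prod_beta)
    ultimately show "(\<lambda>(g, h'). \<Phi> g * f (h' ** g)) \<in> borel_measurable (cv \<mu> m \<Otimes>\<^sub>M cv \<mu> n)"
      by (simp add: case_prod_beta)
  qed
  also have "\<dots> \<le> (\<integral>\<^sup>+h'. ennreal (\<beta> + \<gamma>) \<partial>cv \<mu> n)"
  proof (rule nn_integral_mono_AE)
    have le: "(\<integral>\<^sup>+g. \<Phi> g * f (h' ** g) \<partial>cv \<mu> m) \<le> ennreal (\<beta> + \<gamma>)" if h': "det h' = 1" for h'
    proof -
      obtain B where B: "B \<in> sets borel" "measure (cv \<mu> n) B \<le> \<beta>"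
        "\<And>h. det h = 1 \<Longrightarrow> h \<notin> B \<Longrightarrow> measure (cv \<mu> m) {g. h ** g \<in> V \<and> h' ** g \<in> V} \<le> \<gamma>"
        using dec[OF h'] by blast
      have "(\<integral>\<^sup>+g. \<Phi> g * f (h' ** g) \<partial>cv \<mu> m) = (\<integral>\<^sup>+g. \<integral>\<^sup>+h. f (h ** g) * f (h' ** g) \<partial>cv \<mu> n \<partial>cv \<mu> m)"
        unfolding \<Phi>_def using mt(3) by (intro nn_integral_cong nn_integral_multc[symmetric])
      also have "\<dots> = (\<integral>\<^sup>+h. \<integral>\<^sup>+g. f (h ** g) * f (h' ** g) \<partial>cv \<mu> m \<partial>cv \<mu> n)"
      proof (rule P.Fubini'[symmetric])
        have "(\<lambda>x. f (h' ** fst x)) \<in> borel_measurable (cv \<mu> m \<Otimes>\<^sub>M cv \<mu> n)"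
          using measurable_compose[OF measurable_fst mt(4)] .
        moreover have "(\<lambda>x. f (snd x ** fst x)) \<in> borel_measurable (cv \<mu> m \<Otimes>\<^sub>M cv \<mu> n)"
          using mt(2) by (simp add: case_prod_beta)
        ultimately show "(\<lambda>(g, h). f (h ** g) * f (h' ** g)) \<in> borel_measurable (cv \<mu> m \<Otimes>\<^sub>M cv \<mu> n)"
          by (simp add: case_prod_beta)
      qed
      also have "\<dots> \<le> (\<integral>\<^sup>+h. indicator B h + ennreal \<gamma> \<partial>cv \<mu> n)"
      proof (rule nn_integral_mono_AE)
        have le: "(\<integral>\<^sup>+g. f (h ** g) * f (h' ** g) \<partial>cv \<mu> m) \<le> indicator B h + ennreal \<gamma>" if h: "det h = 1" for h
        proof -
          let ?E = "{g. h ** g \<in> V \<and> h' ** g \<in> V}"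
          have sm: "{g. k ** g \<in> V} \<in> sets borel" for k :: "real^'d^'d"
          proof -
            have "(\<lambda>g. k ** g) \<in> borel_measurable borel"
              unfolding matrix_matrix_mult_def by (intro borel_measurable_continuous_onI continuous_intros)
            from measurable_sets[OF this V] show ?thesis by (simp add: vimage_def)
          qed
          have E: "?E \<in> sets borel"
            using sets.Int[OF sm[of h] sm[of h']] by (simp add: Collect_conj_eq)
          have "(\<integral>\<^sup>+g. f (h ** g) * f (h' ** g) \<partial>cv \<mu> m) = (\<integral>\<^sup>+g. indicator ?E g \<partial>cv \<mu> m)"
            unfolding f_def by (intro nn_integral_cong) (auto simp: indicator_def)
          also have "\<dots> = ennreal (measure (cv \<mu> m) ?E)"
            using E by (subst nn_integral_indicator) (auto simp: sets_cv C.emeasure_eq_measure)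
          \<comment> \<open>On the exceptional set \<open>B\<close> the inner probability is bounded
            by 1 only; its cost is the measure of \<open>B\<close>.\<close>
          also have "\<dots> \<le> indicator B h + ennreal \<gamma>"
          proof (cases "h \<in> B")
            case True
            have "ennreal (measure (cv \<mu> m) ?E) \<le> 1" using C.prob_le_1[of ?E] by simp
            then show ?thesis using True by (simp add: add_increasing2)
          next
            case False
            then show ?thesis using B(3)[OF h False] by (simp add: ennreal_leI)
          qed
          finally show ?thesis .
        qed
        show "AE h in cv \<mu> n. (\<integral>\<^sup>+g. f (h ** g) * f (h' ** g) \<partial>cv \<mu> m) \<le> indicator B h + ennreal \<gamma>"
          using AE_det_cv by eventually_elim (rule le)
      qed
      also have "\<dots> = ennreal (measure (cv \<mu> n) B) + ennreal \<gamma>"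
        using B(1) by (subst nn_integral_add) (auto simp: measurable_cong_sets[OF sets_cv refl] sets_cv A.emeasure_eq_measure A.prob_space)
      also have "\<dots> \<le> ennreal \<beta> + ennreal \<gamma>" using B(2) by (intro add_right_mono ennreal_leI)
      also have "\<dots> = ennreal (\<beta> + \<gamma>)" using \<beta> \<gamma> by simp
      finally show ?thesis .
    qed
    show "AE h' in cv \<mu> n. (\<integral>\<^sup>+g. \<Phi> g * f (h' ** g) \<partial>cv \<mu> m) \<le> ennreal (\<beta> + \<gamma>)"
      using AE_det_cv by eventually_elim (rule le)
  qed
  also have "\<dots> = ennreal (\<beta> + \<gamma>)" by (simp add: A.emeasure_space_1)
  finally have "ennreal ((measure (cv \<mu> (n + m)) V)\<^sup>2) \<le> ennreal (\<beta> + \<gamma>)"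
    by (simp add: S.emeasure_eq_measure ennreal_power)
  then show ?thesis using \<beta> \<gamma> by (subst (asm) ennreal_le_iff) auto
qed

end

section \<open>Exponential decay for zero sets of polynomials on the group\<close>

locale sl_walk = mat_walk \<mu> for \<mu> :: "(real^'d^'d) measure" +
  assumes dens: "\<And>G p a. (\<And>g. g \<in> G \<Longrightarrow> det g = 1) \<Longrightarrow> mat 1 \<in> G
      \<Longrightarrow> (\<And>g h. g \<in> G \<Longrightarrow> h \<in> G \<Longrightarrow> g ** h \<in> G) \<Longrightarrow> (\<And>g. g \<in> G \<Longrightarrow> \<exists>h\<in>G. g ** h = mat 1 \<and> h ** g = mat 1)
      \<Longrightarrow> AE g in \<mu>. g \<in> G \<Longrightarrow> real_polynomial_function p \<Longrightarrow> (\<And>g. g \<in> G \<Longrightarrow> p g = 0) \<Longrightarrow> det a = 1 \<Longrightarrow> p a = 0"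
begin

text \<open>Passing to functions modulo constants enlarges the event to that of carrying one line to
  another, which is closed. This is why the bound is on a Borel superset \<open>B\<close>.\<close>

lemma function_concentration:
  assumes P: "polysp P"
  shows "\<exists>C r. 0 \<le> C \<and> 0 < r \<and> r < 1 \<and> (\<forall>Q\<in>P. \<forall>Q'\<in>P. \<forall>n. dif Q \<noteq> 0 \<longrightarrow>
    (\<exists>B\<in>sets borel. {S. det S = 1 \<and> (\<exists>c. ltr S Q = c *\<^sub>R Q')} \<subseteq> B \<and> measure (cv \<mu> n) B \<le> C * r ^ n))"
proof -
  interpret F: fun_rep act2 "dif ` P" by (rule fun_rep_dif[OF P])
  interpret R: rw_rep act2 "dif ` P" \<mu>
  proof unfold_locales
    fix f assume "f \<in> dif ` P" "f \<noteq> 0"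
    then show "\<exists>x. \<forall>K. \<exists>g. det g = 1 \<and> K < \<bar>f (act2 g x)\<bar>" by (rule dif_unbounded[OF P])
  qed (rule dens)
  obtain \<rho> where \<rho>: "0 \<le> \<rho>" "\<rho> < 1"
    "\<And>n v w. v \<in> F.Om \<Longrightarrow> w \<in> F.Om \<Longrightarrow> measure (cv \<mu> n) (F.St v w) \<le> (2 * real n + 1) * \<rho> ^ n"
    using R.line_concentration by blast
  obtain C r where C: "0 \<le> C" "0 < r" "r < 1" "\<And>n. (2 * real n + 1) * \<rho> ^ n \<le> C * r ^ n"
    using linear_geometric_bound[OF \<rho>(1,2)] by blast
  have "\<exists>B\<in>sets borel. {S. det S = 1 \<and> (\<exists>c. ltr S Q = c *\<^sub>R Q')} \<subseteq> B \<and> measure (cv \<mu> n) B \<le> C * r ^ n"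
    if Q: "Q \<in> P" "dif Q \<noteq> 0" and Q': "Q' \<in> P" for Q Q' n
  proof -
    have trd: "F.tr S (dif Q) = dif (ltr S Q)" if "det S = 1" for S
      using dif_act2[OF that, of Q] by (simp add: F.tr_def ltr_def)
    have nz: "dif (ltr S Q) \<noteq> 0" if "det S = 1" for S
      using F.tr_nonzero[OF Q(2) that] trd[OF that] by simp
    have eq: "dif (ltr S Q) = c *\<^sub>R dif Q'" if "ltr S Q = c *\<^sub>R Q'" for S c
      unfolding that by (rule linear_scale[OF linear_dif])
    show ?thesis
    proof (cases "dif Q' = 0")
      case True
      \<comment> \<open>Translates of a nonconstant function are nonconstant, hence never multiples
        of the constant \<open>Q'\<close>.\<close>
      have "{S. det S = 1 \<and> (\<exists>c. ltr S Q = c *\<^sub>R Q')} = {}"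
      proof -
        have False if "det S = 1" "ltr S Q = c *\<^sub>R Q'" for S c
          using nz[OF that(1)] eq[OF that(2)] True by simp
        then show ?thesis by blast
      qed
      then show ?thesis using C by (intro bexI[of _ "{}"]) auto
    next
      case False
      have Om: "F.line (dif Q) \<in> F.Om" "F.line (dif Q') \<in> F.Om" using Q Q' False by (auto simp: F.Om_def)
      show ?thesis
      proof (intro bexI[of _ "F.St (F.line (dif Q)) (F.line (dif Q'))"] conjI subsetI)
        fix S assume "S \<in> {S. det S = 1 \<and> (\<exists>c. ltr S Q = c *\<^sub>R Q')}"
        then obtain c where S: "det S = 1" "ltr S Q = c *\<^sub>R Q'" by blast
        have "F.line (dif (ltr S Q)) = F.line (dif Q')"
          unfolding F.line_eq_iff[OF nz[OF S(1)] False] unfolding eq[OF S(2)] by simp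
        then show "S \<in> F.St (F.line (dif Q)) (F.line (dif Q'))"
          using S(1) by (simp add: F.St_def F.ta_line trd)
      next
        show "measure (cv \<mu> n) (F.St (F.line (dif Q)) (F.line (dif Q'))) \<le> C * r ^ n"
          using \<rho>(3)[OF Om, of n] C(4)[of n] by linarith
        show "F.St (F.line (dif Q)) (F.line (dif Q')) \<in> sets borel" by (rule R.St_sets[OF Om])
      qed
    qed
  qed
  then show ?thesis using C(1-3) by blast
qed

text \<open>All Pluecker functions of all \<open>j\<close>-dimensional subspaces of \<open>P\<close>
  lie in one space \<open>R\<close>, so one pair of constants serves every \<open>F\<close> and
  \<open>F'\<close>. The points \<open>y\<close> are chosen for \<open>F\<close> and used for
  \<open>F'\<close> as well.\<close>

lemma subspace_concentration:
  assumes P: "polysp P" and one: "rs (\<lambda>_. 1) \<in> P"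
  shows "\<exists>C r. 0 \<le> C \<and> 0 < r \<and> r < 1 \<and> (\<forall>F F' n. F \<subseteq> P \<longrightarrow> subspace F \<longrightarrow> dim F = j \<longrightarrow>
    F' \<subseteq> P \<longrightarrow> subspace F' \<longrightarrow> dim F' = j \<longrightarrow> (\<exists>f\<in>F. \<exists>a. det a = 1 \<and> ltr a f \<notin> F) \<longrightarrow>
    (\<exists>B\<in>sets borel. {S. det S = 1 \<and> ltr S ` F = F'} \<subseteq> B \<and> measure (cv \<mu> n) B \<le> C * r ^ n))"
proof -
  obtain R where R: "polysp R"
    "\<And>F. (\<And>k i. k < j \<Longrightarrow> i < j \<Longrightarrow> F k i \<in> P) \<Longrightarrow> rs (\<lambda>x. ldet j (\<lambda>k i. F k i x)) \<in> R"
    using polysp_ldet[OF P one, of j] by blast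
  obtain C r where C: "0 \<le> C" "0 < r" "r < 1" and
    conc: "\<And>Q Q' n. Q \<in> R \<Longrightarrow> Q' \<in> R \<Longrightarrow> dif Q \<noteq> 0 \<Longrightarrow>
      \<exists>B\<in>sets borel. {S. det S = 1 \<and> (\<exists>c. ltr S Q = c *\<^sub>R Q')} \<subseteq> B \<and> measure (cv \<mu> n) B \<le> C * r ^ n"
    using function_concentration[OF R(1)] by blast
  have "\<exists>B\<in>sets borel. {S. det S = 1 \<and> ltr S ` F = F'} \<subseteq> B \<and> measure (cv \<mu> n) B \<le> C * r ^ n"
    if F: "F \<subseteq> P" "subspace F" "dim F = j" and F': "F' \<subseteq> P" "subspace F'" "dim F' = j"
      and f: "f \<in> F" "det a = 1" "ltr a f \<notin> F" for F F' n f a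
  proof -
    obtain t e where fr: "frame F j t e" using fd_frame[OF fd_subspace[OF polyspD(1)[OF P] F(1,2)]] F(3) by blast
    obtain t' e' where fr': "frame F' j t' e'" using fd_frame[OF fd_subspace[OF polyspD(1)[OF P] F'(1,2)]] F'(3) by blast
    obtain y where y: "\<And>k. k < j \<Longrightarrow> det (y k) = 1" "dif (pl j e y) \<noteq> 0"
      using pluecker_nonconstant[OF P F(1) fr f] by blast
    have plR: "pl j e y \<in> R" if fr: "frame F j t e" and FP: "F \<subseteq> P" for F t e
      unfolding pl_def
    proof (rule R(2))
      fix k i assume ki: "k < j" "i < j"
      have "e i \<in> P" using frameD(2)[OF fr ki(2)] FP by blast
      from polyspD(3)[OF P this, of "mat 1" "y k"] y(1)[OF ki(1)] show "(\<lambda>g. e i (g ** y k)) \<in> P" by simp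
    qed
    obtain B where B: "B \<in> sets borel" "{S. det S = 1 \<and> (\<exists>c. ltr S (pl j e y) = c *\<^sub>R pl j e' y)} \<subseteq> B"
      "measure (cv \<mu> n) B \<le> C * r ^ n"
      using conc[OF plR[OF fr F(1)] plR[OF fr' F'(1)] y(2)] by blast
    have "{S. det S = 1 \<and> ltr S ` F = F'} \<subseteq> B"
      using B(2) pluecker_translate[OF P F(1) F'(1) fr fr'] by blast
    with B show ?thesis by blast
  qed
  then show ?thesis using C by blast
qed

definition zs :: "(real^'d^'d \<Rightarrow> real) set \<Rightarrow> (real^'d^'d) set" where
  "zs F = {g. det g = 1 \<and> (\<forall>f\<in>F. f g = 0)}"

lemma zs_sets:
  assumes P: "polysp P" and F: "F \<subseteq> P"
  shows "zs F \<in> sets borel"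
proof -
  have "\<forall>f\<in>F. \<exists>p. real_polynomial_function p \<and> f = rs p" using polyspD(2)[OF P] F by blast
  from bchoice[OF this] obtain p where p: "\<And>f. f \<in> F \<Longrightarrow> real_polynomial_function (p f)" "\<And>f. f \<in> F \<Longrightarrow> f = rs (p f)"
    by blast
  have "f g = p f g" if "f \<in> F" "det g = 1" for f g using fun_cong[OF p(2)[OF that(1)], of g] that(2) by (simp add: rs_def)
  then have "zs F = {g. det g = 1} \<inter> (\<Inter>f\<in>F. {g. p f g = 0})" by (auto simp: zs_def)
  also have "closed \<dots>"
    using p(1) by (intro closed_Int closed_SL closed_INT ballI closed_Collect_eq continuous_on_poly continuous_on_const)
  finally show ?thesis by (rule borel_closed)
qed

lemma dim_ltr:
  assumes P: "polysp P" and F: "F \<subseteq> P" "subspace F" and h: "det h = 1"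
  shows "dim (ltr h ` F) = dim F"
proof -
  have le: "dim (ltr h ` F) \<le> dim F" if F: "F \<subseteq> P" "subspace F" for F h
  proof -
    obtain B where B: "finite B" "F = span B" "card B = dim F"
      using fd_basis[OF fd_subspace[OF polyspD(1)[OF P] F]] by metis
    have "ltr h ` F = span (ltr h ` B)" unfolding B(2) by (rule linear_span_image[OF linear_ltr, symmetric])
    then have "dim (ltr h ` F) \<le> card (ltr h ` B)" using B(1) by (intro real_vector.dim_le_card) auto
    also have "\<dots> \<le> card B" by (rule card_image_le[OF B(1)])
    finally show ?thesis using B(3) by simp
  qed
  obtain k where k: "h ** k = mat 1" using SL_inverse[OF h] by blast
  have "ltr k ` (ltr h ` F) = F" by (simp add: image_image ltr_mult[symmetric] k ltr_one)
  moreover have "ltr h ` F \<subseteq> P" using ltr_polysp[OF P _ h] F(1) by blast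
  ultimately have "dim F \<le> dim (ltr h ` F)"
    using le[of "ltr h ` F" k] linear_subspace_image[OF linear_ltr F(2)] by simp
  with le[OF F, of h] show ?thesis by simp
qed

text \<open>Downward induction on the dimension of \<open>F\<close>: either two random translates of \<open>F\<close> coincide, which
  is exponentially unlikely, or they span a space of larger dimension.\<close>

lemma zero_set_decay:
  assumes P: "polysp P" and one: "rs (\<lambda>_. 1) \<in> P"
  shows "\<exists>C r. 0 \<le> C \<and> 0 < r \<and> r < 1 \<and> (\<forall>F. subspace F \<longrightarrow> F \<subseteq> P \<longrightarrow> F \<noteq> {0} \<longrightarrow> dim P \<le> dim F + k \<longrightarrow>
    (\<forall>n. measure (cv \<mu> n) (zs F) \<le> C * r ^ n))"
proof (induction k)
  case 0
  have "measure (cv \<mu> n) (zs F) \<le> 0 * (1/2) ^ n" if F: "subspace F" "F \<subseteq> P" "dim P \<le> dim F + 0" for F n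
  proof -
    have "F = P" using fd_dim_eq[OF polyspD(1)[OF P] F(2,1)] F(3) by simp
    have False if "g \<in> zs F" for g
    proof -
      have "rs (\<lambda>_. 1) g = 0" "det g = 1" using that one \<open>F = P\<close> unfolding zs_def by blast+
      then show False by (simp add: rs_def)
    qed
    then have "zs F = {}" by blast
    then show ?thesis by simp
  qed
  then show ?case by (intro exI[of _ 0] exI[of _ "1/2"]) auto
next
  case (Suc k)
  obtain C1 r1 where C1: "0 \<le> C1" "0 < r1" "r1 < 1" and
    IH: "\<And>F n. subspace F \<Longrightarrow> F \<subseteq> P \<Longrightarrow> F \<noteq> {0} \<Longrightarrow> dim P \<le> dim F + k \<Longrightarrow> measure (cv \<mu> n) (zs F) \<le> C1 * r1 ^ n"
  proof -
    from Suc obtain C1 r1 where C1: "0 \<le> C1" "0 < r1" "r1 < 1"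
      and IH: "\<forall>F. subspace F \<longrightarrow> F \<subseteq> P \<longrightarrow> F \<noteq> {0} \<longrightarrow> dim P \<le> dim F + k \<longrightarrow>
        (\<forall>n. measure (cv \<mu> n) (zs F) \<le> C1 * r1 ^ n)" by (elim exE conjE) (rule that)
    show ?thesis by (rule that[OF C1]) (rule IH[rule_format])
  qed
  \<comment> \<open>The only dimension that the induction hypothesis leaves open.\<close>
  define j where "j = dim P - Suc k"
  obtain C2 r2 where C2: "0 \<le> C2" "0 < r2" "r2 < 1" and
    conc: "\<And>F F' n f a. F \<subseteq> P \<Longrightarrow> subspace F \<Longrightarrow> dim F = j \<Longrightarrow> F' \<subseteq> P \<Longrightarrow> subspace F' \<Longrightarrow> dim F' = j \<Longrightarrow>
      f \<in> F \<Longrightarrow> det a = 1 \<Longrightarrow> ltr a f \<notin> F \<Longrightarrow>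
      \<exists>B\<in>sets borel. {S. det S = 1 \<and> ltr S ` F = F'} \<subseteq> B \<and> measure (cv \<mu> n) B \<le> C2 * r2 ^ n"
  proof -
    from subspace_concentration[OF P one, of j] obtain C2 r2 where C2: "0 \<le> C2" "0 < r2" "r2 < 1"
      and conc: "\<forall>F F' n. F \<subseteq> P \<longrightarrow> subspace F \<longrightarrow> dim F = j \<longrightarrow>
        F' \<subseteq> P \<longrightarrow> subspace F' \<longrightarrow> dim F' = j \<longrightarrow> (\<exists>f\<in>F. \<exists>a. det a = 1 \<and> ltr a f \<notin> F) \<longrightarrow>
        (\<exists>B\<in>sets borel. {S. det S = 1 \<and> ltr S ` F = F'} \<subseteq> B \<and> measure (cv \<mu> n) B \<le> C2 * r2 ^ n)"
      by (elim exE conjE) (rule that)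
    show ?thesis by (rule that[OF C2]) (rule conc[rule_format], assumption+, intro bexI exI conjI)
  qed
  define r where "r = max r1 r2"
  have r: "0 < r" "r < 1" "r1 \<le> r" "r2 \<le> r" using C1 C2 by (auto simp: r_def)
  define D where "D = C1 + C2"
  have D: "0 \<le> D" using C1 C2 by (simp add: D_def)
  define r' where "r' = sqrt (sqrt r)"
  have r': "0 < r'" "r' < 1" using r by (auto simp: r'_def)
  define C' where "C' = sqrt (D / sqrt r)"
  have C': "0 \<le> C'" using r D by (simp add: C'_def)
  define \<rho> where "\<rho> = max r1 r'"
  have \<rho>: "0 < \<rho>" "\<rho> < 1" "r1 \<le> \<rho>" "r' \<le> \<rho>" using C1 r' by (auto simp: \<rho>_def)
  have "measure (cv \<mu> n) (zs F) \<le> (C1 + C') * \<rho> ^ n"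
    if F: "subspace F" "F \<subseteq> P" "F \<noteq> {0}" "dim P \<le> dim F + Suc k" for F n
  proof -
    have b1: "C1 * r1 ^ n \<le> (C1 + C') * \<rho> ^ n"
      using C1 C' \<rho> by (intro mult_mono power_mono) auto
    have b2: "C' * r' ^ n \<le> (C1 + C') * \<rho> ^ n"
      using C1 C' \<rho> r' by (intro mult_mono power_mono) auto
    show ?thesis
    proof (cases "dim P \<le> dim F + k")
      case True
      then show ?thesis using IH[OF F(1-3) True, of n] b1 by linarith
    next
      case False
      then have dF: "dim F = j" and dP: "dim P = dim F + Suc k" using F(4) by (auto simp: j_def)
      show ?thesis
      proof (cases "\<exists>f\<in>F. \<exists>a. det a = 1 \<and> ltr a f \<notin> F")
        case False
        \<comment> \<open>The group acts transitively on itself, so one common zero of an invariant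
          \<open>F\<close> would make all its members vanish everywhere.\<close>
        have "zs F = {}"
        proof (rule ccontr)
          assume "zs F \<noteq> {}"
          then obtain g where g: "det g = 1" "\<And>f. f \<in> F \<Longrightarrow> f g = 0" by (auto simp: zs_def)
          obtain g' where g': "det g' = 1" "g' ** g = mat 1" using SL_inverse[OF g(1)] by blast
          have "f = 0" if f: "f \<in> F" for f
          proof
            fix x
            show "f x = 0 x"
            proof (cases "det x = 1")
              case True
              then have "ltr (x ** g') f \<in> F" using False f g' by (simp add: det_mul)
              from g(2)[OF this] show ?thesis by (simp add: ltr_def matrix_mul_assoc[symmetric] g')
            next
              case False
              then show ?thesis using polyspD(4)[OF P] f F(2) by auto
            qed
          qed
          then show False using F(3) subspace_0[OF F(1)] by blast
        qed
        then show ?thesis using C1 C' \<rho> by simp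
      next
        case True
        then obtain f a where fa: "f \<in> F" "det a = 1" "ltr a f \<notin> F" by blast
        \<comment> \<open>The \<open>n1\<close> outer factors decide whether the two translates of
          \<open>F\<close> coincide; the \<open>n2 \<ge> n1\<close> others are left to the larger
          span. Both errors are then bounded through \<open>r ^ n1\<close>.\<close>
        define n1 where "n1 = n div 2"
        define n2 where "n2 = n - n div 2"
        have n12: "n = n1 + n2" "n1 \<le> n2" by (auto simp: n1_def n2_def)
        have "(measure (cv \<mu> (n1 + n2)) (zs F))\<^sup>2 \<le> C2 * r2 ^ n1 + C1 * r1 ^ n2"
        proof (rule decoupling)
          show "zs F \<in> sets borel" by (rule zs_sets[OF P F(2)])
          show "0 \<le> C2 * r2 ^ n1" "0 \<le> C1 * r1 ^ n2" using C1 C2 by auto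
          fix h' :: "real^'d^'d" assume h': "det h' = 1"
          have sub: "subspace (ltr h ` F)" for h by (rule linear_subspace_image[OF linear_ltr F(1)])
          have FP: "ltr h ` F \<subseteq> P" if "det h = 1" for h using ltr_polysp[OF P _ that] F(2) by blast
          have dims: "dim (ltr h ` F) = j" if "det h = 1" for h using dim_ltr[OF P F(2,1) that] dF by simp
          obtain B where B: "B \<in> sets borel" "{S. det S = 1 \<and> ltr S ` F = ltr h' ` F} \<subseteq> B"
            "measure (cv \<mu> n1) B \<le> C2 * r2 ^ n1"
            using conc[OF F(2,1) dF FP[OF h'] sub dims[OF h'] fa] by blast
          have "measure (cv \<mu> n2) {g. h ** g \<in> zs F \<and> h' ** g \<in> zs F} \<le> C1 * r1 ^ n2"
            if h: "det h = 1" "h \<notin> B" for h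
          proof -
            have ne: "ltr h ` F \<noteq> ltr h' ` F" using h B(2) by blast
            \<comment> \<open>Both conditions on \<open>g\<close> say that it is a common zero of
              two translates of \<open>F\<close>, hence of their span, which is larger than either
              as the translates differ but have equal dimension.\<close>
            define E where "E = span (ltr h ` F \<union> ltr h' ` F)"
            have EP: "E \<subseteq> P" unfolding E_def
              using FP[OF h(1)] FP[OF h'] polyspD(1)[OF P] by (intro span_minimal) (auto simp: fd_def)
            have fdE: "fd E" by (rule fd_subspace[OF polyspD(1)[OF P] EP]) (simp add: E_def subspace_span)
            have inc: "ltr h ` F \<subseteq> E" "ltr h' ` F \<subseteq> E" unfolding E_def by (auto intro: span_base)
            have dimE: "j < dim E"
            proof (rule ccontr)
              assume "\<not> j < dim E"
              then have "ltr h ` F = E" "ltr h' ` F = E"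
                using fd_dim_eq[OF fdE inc(1) sub] fd_dim_eq[OF fdE inc(2) sub] dims[OF h(1)] dims[OF h'] by auto
              with ne show False by simp
            qed
            have "dim {0 :: real^'d^'d \<Rightarrow> real} \<le> card ({} :: (real^'d^'d \<Rightarrow> real) set)"
              by (rule real_vector.dim_le_card) auto
            with dimE have "E \<noteq> {0}" by auto
            have "{g. h ** g \<in> zs F \<and> h' ** g \<in> zs F} \<subseteq> zs E"
            proof
              fix g assume "g \<in> {g. h ** g \<in> zs F \<and> h' ** g \<in> zs F}"
              then have g: "h ** g \<in> zs F" "h' ** g \<in> zs F" by auto
              have dg: "det g = 1" using g(1) h(1) by (simp add: zs_def det_mul)
              have "u g = 0" if "u \<in> E" for u
                using that unfolding E_def
              proof (induction u rule: span_induct_alt)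
                case base
                then show ?case by simp
              next
                case (step c x y)
                have "x g = 0" using step(1) g by (auto simp: zs_def ltr_def)
                then show ?case using step(2) by simp
              qed
              then show "g \<in> zs E" using dg by (simp add: zs_def)
            qed
            moreover interpret C: prob_space "cv \<mu> n2" by (rule prob_cv)
            have "zs E \<in> sets (cv \<mu> n2)" using zs_sets[OF P EP] by (simp add: sets_cv)
            ultimately have "measure (cv \<mu> n2) {g. h ** g \<in> zs F \<and> h' ** g \<in> zs F} \<le> measure (cv \<mu> n2) (zs E)"
              by (rule C.finite_measure_mono)
            also have "\<dots> \<le> C1 * r1 ^ n2"
              using dimE dP dF \<open>E \<noteq> {0}\<close> by (intro IH EP) (auto simp: E_def subspace_span)
            finally show ?thesis .
          qed
          with B show "\<exists>B\<in>sets borel. measure (cv \<mu> n1) B \<le> C2 * r2 ^ n1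
            \<and> (\<forall>h. det h = 1 \<longrightarrow> h \<notin> B \<longrightarrow> measure (cv \<mu> n2) {g. h ** g \<in> zs F \<and> h' ** g \<in> zs F} \<le> C1 * r1 ^ n2)"
            by blast
        qed
        also have "\<dots> \<le> C2 * r ^ n1 + C1 * r ^ n1"
        proof (intro add_mono mult_left_mono C1 C2)
          show "r2 ^ n1 \<le> r ^ n1" using C2 r by (intro power_mono) auto
          have "r1 ^ n2 \<le> r ^ n2" using C1 r by (intro power_mono) auto
          also have "\<dots> \<le> r ^ n1" using r n12 by (intro power_decreasing) auto
          finally show "r1 ^ n2 \<le> r ^ n1" .
        qed
        also have "\<dots> = D * r ^ (n div 2)" by (simp add: D_def n1_def algebra_simps)
        finally have "(measure (cv \<mu> n) (zs F))\<^sup>2 \<le> D * r ^ (n div 2)" using n12(1) by simp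
        from sqrt_half_bound[where q = "\<lambda>n. measure (cv \<mu> n) (zs F)", OF r(1,2) D this]
        have "measure (cv \<mu> n) (zs F) \<le> C' * r' ^ n" by (simp add: C'_def r'_def)
        with b2 show ?thesis by linarith
      qed
    qed
  qed
  note main = this
  show ?case
    by (rule exI[of _ "C1 + C'"], rule exI[of _ \<rho>], intro conjI allI impI main) (use C1 C' \<rho> in auto)
qed

text \<open>The case of the space spanned by the single function \<open>rs p\<close>; with
  \<open>k = dim P\<close> the condition on the dimension is satisfied by every space.\<close>

theorem polynomial_zero_decay:
  assumes p: "real_polynomial_function p" "det a = 1" "p a \<noteq> 0"
  shows "\<exists>C r. 0 \<le> C \<and> 0 < r \<and> r < 1 \<and> (\<forall>n. measure (cv \<mu> n) {g. det g = 1 \<and> p g = 0} \<le> C * r ^ n)"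
proof -
  obtain P where P: "polysp P" "rs p \<in> P" "rs (\<lambda>_. 1) \<in> P" using polysp_exists[OF p(1)] by blast
  obtain C r where C: "0 \<le> C" "0 < r" "r < 1" and
    dec: "\<And>F n. subspace F \<Longrightarrow> F \<subseteq> P \<Longrightarrow> F \<noteq> {0} \<Longrightarrow> dim P \<le> dim F + dim P \<Longrightarrow> measure (cv \<mu> n) (zs F) \<le> C * r ^ n"
  proof -
    from zero_set_decay[OF P(1,3), of "dim P"] obtain C r where C: "0 \<le> C" "0 < r" "r < 1"
      and dec: "\<forall>F. subspace F \<longrightarrow> F \<subseteq> P \<longrightarrow> F \<noteq> {0} \<longrightarrow> dim P \<le> dim F + dim P \<longrightarrow>
        (\<forall>n. measure (cv \<mu> n) (zs F) \<le> C * r ^ n)" by (elim exE conjE) (rule that)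
    show ?thesis by (rule that[OF C]) (rule dec[rule_format])
  qed
  let ?F = "span {rs p}"
  have "rs p \<in> ?F" by (simp add: span_base)
  moreover have "rs p \<noteq> 0" using p(2,3) by (auto simp: rs_def fun_eq_iff)
  ultimately have "?F \<noteq> {0}" by blast
  have "?F \<subseteq> P" using P polyspD(1)[OF P(1)] by (intro span_minimal) (auto simp: fd_def)
  have "{g. det g = 1 \<and> p g = 0} = zs ?F"
  proof -
    have "f g = 0" if g: "det g = 1" "p g = 0" and f: "f \<in> ?F" for f g
    proof -
      obtain c where "f = c *\<^sub>R rs p" using f by (auto simp: span_singleton)
      then show ?thesis using g by (simp add: rs_def)
    qed
    moreover have "p g = 0" if "det g = 1" "\<forall>f\<in>?F. f g = 0" for g
      using that \<open>rs p \<in> ?F\<close> by (force simp: rs_def)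
    ultimately show ?thesis unfolding zs_def by blast
  qed
  then have "measure (cv \<mu> n) {g. det g = 1 \<and> p g = 0} \<le> C * r ^ n" for n
    using dec[OF subspace_span \<open>?F \<subseteq> P\<close> \<open>?F \<noteq> {0}\<close>, of n] by simp
  then show ?thesis using C by blast
qed

end

section \<open>Orbits of vectors and the law of the left walk\<close>

lemma SL_transitive:
  fixes x z :: "real^'d"
  assumes d: "2 \<le> CARD('d)" and x: "x \<noteq> 0" and z: "z \<noteq> 0"
  shows "\<exists>a :: real^'d^'d. det a = 1 \<and> a *v x = z"
proof -
  obtain k m :: 'd where km: "k \<noteq> m"
    using d by (metis (full_types) One_nat_def card_1_singleton_iff UNIV_I card_le_Suc0_iff_eq finite numeral_2_eq_2 not_less_eq_eq)
  define s where "s = norm z / norm x"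
  have s: "s \<noteq> 0" using x z by (simp add: s_def)
  define D :: "real^'d^'d" where "D = dg (\<lambda>i. if i = k then s else if i = m then 1 / s else 1)"
  have "D \<in> elem" unfolding D_def by (rule elem_hyperbolic[OF km s])
  then have D: "det D = 1" by (rule elem_det)
  \<comment> \<open>Rotations bring both vectors onto the axis of \<open>k\<close>; the hyperbolic
    \<open>D\<close> adjusts the length there, and its entry at \<open>m\<close> restores
    determinant 1.\<close>
  obtain f where f: "orthogonal_transformation f" "det (matrix f) = 1" "f x = norm x *\<^sub>R axis k 1"
    using rotation_exists[OF d, of x "norm x *\<^sub>R axis k 1"] by auto
  obtain h where h: "orthogonal_transformation h" "det (matrix h) = 1" "h (norm z *\<^sub>R axis k 1) = z"
    using rotation_exists[OF d, of "norm z *\<^sub>R axis k 1" z] by auto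
  have lin: "matrix f *v v = f v" "matrix h *v v = h v" for v
    using f(1) h(1) by (auto intro!: matrix_works[unfolded linear_matrix_vector_mul_eq] simp: orthogonal_transformation_def matrix_works)
  have "D *v (norm x *\<^sub>R axis k 1) = norm z *\<^sub>R axis k 1"
  proof -
    have "(\<Sum>j\<in>UNIV. (if i = j then (if i = k then s else if i = m then 1 / s else 1) else 0) * (norm x * (if k = j then 1 else 0)))
      = norm z * (if k = i then 1 else 0)" for i
      using x by (simp add: s_def if_distrib[of "\<lambda>t. _ * t"] cong: if_cong)
    then show ?thesis by (simp add: D_def dg_def matrix_vector_mult_def vec_eq_iff axis_def eq_commute[of k])
  qed
  then have "(matrix h ** D ** matrix f) *v x = z"
    by (simp add: matrix_vector_mul_assoc[symmetric] lin f h)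
  moreover have "det (matrix h ** D ** matrix f) = 1" by (simp add: det_mul D f h)
  ultimately show ?thesis by blast
qed

text \<open>The orbit of \<open>x\<close> is the set of all nonzero vectors. By continuity a
  polynomial that is not identically zero cannot vanish on all of them, so an equation of
  \<open>V\<close> pulls back to a nontrivial one on the group.\<close>

lemma algebraic_orbit_polynomial:
  fixes V :: "(real^'d) set"
  assumes d: "2 \<le> CARD('d)" and V: "algebraic_set V" "V \<noteq> UNIV" and x: "x \<noteq> 0"
  shows "\<exists>(p :: real^'d^'d \<Rightarrow> real) a. real_polynomial_function p \<and> det a = 1 \<and> p a \<noteq> 0 \<and> (\<forall>g. g *v x \<in> V \<longrightarrow> p g = 0)"
proof -
  obtain q z0 where q: "real_polynomial_function q" "\<And>z. z \<in> V \<Longrightarrow> q z = 0" "q z0 \<noteq> 0"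
    using V unfolding algebraic_set_def by blast
  have "\<exists>z. z \<noteq> 0 \<and> q z \<noteq> 0"
  proof (rule ccontr)
    assume "\<not> ?thesis"
    then have nz: "q z = 0" if "z \<noteq> 0" for z using that by blast
    have z0: "z0 = 0" using nz q(3) by blast
    have "continuous (at 0) q" using continuous_on_poly[OF q(1), of UNIV] by (simp add: continuous_on_eq_continuous_at)
    then have "(q \<longlongrightarrow> q 0) (at 0)" by (simp add: continuous_at)
    moreover have "(q \<longlongrightarrow> 0) (at 0)"
      by (rule tendsto_eventually) (use nz in \<open>simp add: eventually_at_filter\<close>)
    ultimately have "q 0 = 0" using tendsto_unique[OF at_neq_bot] by blast
    then show False using q(3) z0 by simp
  qed
  then obtain z where z: "z \<noteq> 0" "q z \<noteq> 0" by blast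
  obtain a :: "real^'d^'d" where a: "det a = 1" "a *v x = z" using SL_transitive[OF d x z(1)] by blast
  have "bounded_linear (\<lambda>g :: real^'d^'d. g *v x)"
    by (rule linear_conv_bounded_linear[THEN iffD1])
      (auto intro!: linearI simp: matrix_vector_mult_add_rdistrib scaleR_matrix_vector_assoc)
  then have "polynomial_function (\<lambda>g :: real^'d^'d. g *v x)" by (rule polynomial_function_bounded_linear)
  then have "real_polynomial_function (\<lambda>g :: real^'d^'d. q (g *v x))"
    using real_polynomial_function_compose[OF _ q(1)] by (simp add: o_def)
  then show ?thesis using q(2) a z by (intro exI[of _ "\<lambda>g. q (g *v x)"] exI[of _ a]) auto
qed

text \<open>The walk receives its new factor on the left and \<open>cv\<close> on the right. Reading
  the new step as \<open>cv \<mu> 1\<close> and applying \<open>nn_integral_cv_add\<close> to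
  \<open>1 + n\<close> reconciles the two recursions, so the laws agree at each fixed time.\<close>

lemma (in mat_walk) left_walk_law:
  fixes X :: "nat \<Rightarrow> 'w \<Rightarrow> real^'d^'d"
  assumes M: "prob_space M" and ind: "prob_space.indep_vars M (\<lambda>_. borel) X {1..}"
    and law: "\<And>n. 1 \<le> n \<Longrightarrow> distr M borel (X n) = \<mu>"
  shows "left_walk X n \<in> borel_measurable M \<and> distr M borel (left_walk X n) = cv \<mu> n"
proof (induction n)
  interpret M: prob_space M by (rule M)
  case 0
  have "left_walk X 0 = (\<lambda>_. mat 1)" by (simp add: fun_eq_iff)
  moreover have "distr M borel (\<lambda>_. mat 1) = return borel (mat 1)" 
    by (intro measure_eqI) (auto simp: emeasure_distr M.emeasure_space_1 vimage_def split: split_indicator)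
  ultimately show ?case by (simp add: cv_0)
next
  interpret M: prob_space M by (rule M)
  case (Suc n)
  interpret A: prob_space "cv \<mu> n" by (rule prob_cv)
  interpret B: prob_space \<mu> by (rule prob)
  interpret P: pair_sigma_finite \<mu> "cv \<mu> n" ..
  \<comment> \<open>Independence is a statement about the family, so the walk up to time
    \<open>n\<close> is written as a measurable function of the tuple of the first \<open>n\<close>
    variables.\<close>
  let ?W = "left_walk (\<lambda>i h. h i) n :: (nat \<Rightarrow> real^'d^'d) \<Rightarrow> _"
  have W: "left_walk (\<lambda>i h. h i) k \<in> borel_measurable (PiM {1..n} (\<lambda>_. borel :: (real^'d^'d) measure))" if "k \<le> n" for k
    using that
  proof (induction k)
    case 0
    have "left_walk (\<lambda>i h. h i) 0 = (\<lambda>_. mat 1 :: real^'d^'d)" by (simp add: fun_eq_iff)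
    then show ?case by simp
  next
    case (Suc k)
    have "(\<lambda>h. (h (Suc k), left_walk (\<lambda>i h. h i) k h)) \<in> PiM {1..n} (\<lambda>_. borel :: (real^'d^'d) measure) \<rightarrow>\<^sub>M borel \<Otimes>\<^sub>M borel"
      using Suc by (intro measurable_Pair measurable_component_singleton) auto
    from measurable_compose[OF this measurable_matrix_mult] show ?case by simp
  qed
  have eqW: "left_walk (\<lambda>i h. h i) k (restrict (\<lambda>i. X i \<omega>) {1..n}) = left_walk X k \<omega>" if "k \<le> n" for k \<omega>
    using that by (induction k) auto
  have "M.indep_var (PiM {Suc n} (\<lambda>_. borel)) (\<lambda>\<omega>. restrict (\<lambda>i. X i \<omega>) {Suc n})
     (PiM {1..n} (\<lambda>_. borel)) (\<lambda>\<omega>. restrict (\<lambda>i. X i \<omega>) {1..n})"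
    by (rule M.indep_var_restrict[OF ind]) auto
  from M.indep_var_compose[OF this measurable_component_singleton[of "Suc n"] W[of n]]
  have "M.indep_var borel ((\<lambda>h. h (Suc n)) \<circ> (\<lambda>\<omega>. restrict (\<lambda>i. X i \<omega>) {Suc n}))
    borel (?W \<circ> (\<lambda>\<omega>. restrict (\<lambda>i. X i \<omega>) {1..n}))" by simp
  moreover have "(\<lambda>h. h (Suc n)) \<circ> (\<lambda>\<omega>. restrict (\<lambda>i. X i \<omega>) {Suc n}) = X (Suc n)" by (simp add: fun_eq_iff)
  moreover have "?W \<circ> (\<lambda>\<omega>. restrict (\<lambda>i. X i \<omega>) {1..n}) = left_walk X n"
    using eqW[of n] by (simp add: fun_eq_iff)
  ultimately have iv: "M.indep_var borel (X (Suc n)) borel (left_walk X n)" by simp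
  then have rv: "X (Suc n) \<in> borel_measurable M" "left_walk X n \<in> borel_measurable M"
    by (auto dest: M.indep_var_rv1 M.indep_var_rv2)
  have pm: "(\<lambda>\<omega>. (X (Suc n) \<omega>, left_walk X n \<omega>)) \<in> M \<rightarrow>\<^sub>M borel \<Otimes>\<^sub>M borel"
    using rv by (rule measurable_Pair)
  have eqS: "left_walk X (Suc n) = (\<lambda>\<omega>. (\<lambda>(h, g). h ** g) (X (Suc n) \<omega>, left_walk X n \<omega>))"
    by (simp add: fun_eq_iff)
  have m: "left_walk X (Suc n) \<in> borel_measurable M"
    unfolding eqS by (rule measurable_compose[OF pm measurable_matrix_mult])
  have joint: "\<mu> \<Otimes>\<^sub>M cv \<mu> n = distr M (borel \<Otimes>\<^sub>M borel) (\<lambda>\<omega>. (X (Suc n) \<omega>, left_walk X n \<omega>))"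
    using iv law[of "Suc n"] Suc by (simp add: M.indep_var_distribution_eq)
  have "distr M borel (left_walk X (Suc n)) = cv \<mu> (Suc n)"
  proof (rule measure_eqI)
    show "sets (distr M borel (left_walk X (Suc n))) = sets (cv \<mu> (Suc n))" by (simp add: sets_cv)
    fix A assume "A \<in> sets (distr M borel (left_walk X (Suc n)))"
    then have A: "A \<in> sets borel" by simp
    define f :: "real^'d^'d \<Rightarrow> ennreal" where "f = indicator A"
    have f: "f \<in> borel_measurable borel" unfolding f_def using A by simp
    have fm: "(\<lambda>x. f (case x of (h :: real^'d^'d, g) \<Rightarrow> h ** g)) \<in> borel_measurable (borel \<Otimes>\<^sub>M borel)"
      using measurable_compose[OF measurable_matrix_mult f] .
    have sets2: "sets (\<mu> \<Otimes>\<^sub>M cv \<mu> n) = sets (borel \<Otimes>\<^sub>M (borel :: (real^'d^'d) measure))"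
      by (rule sets_pair_measure_cong[OF sets_mu sets_cv])
    have fm': "(\<lambda>(h :: real^'d^'d, g). f (h ** g)) \<in> borel_measurable (\<mu> \<Otimes>\<^sub>M cv \<mu> n)"
      unfolding measurable_cong_sets[OF sets2 refl] using fm by (simp add: split_def)
    have tr: "(\<lambda>h. \<phi> (h ** g)) \<in> borel_measurable borel" if "\<phi> \<in> borel_measurable borel"
      for \<phi> :: "real^'d^'d \<Rightarrow> ennreal" and g :: "real^'d^'d"
      using measurable_translate(3)[OF that] unfolding measurable_cong_sets[OF sets_cv refl] by simp
    have cv1: "(\<integral>\<^sup>+h. \<phi> h \<partial>cv \<mu> 1) = (\<integral>\<^sup>+h. \<phi> h \<partial>\<mu>)" if "\<phi> \<in> borel_measurable borel" for \<phi>
      using nn_integral_cv_Suc[OF that, of 0] tr[OF that] by (simp add: cv_0 nn_integral_return)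
    have "emeasure (distr M borel (left_walk X (Suc n))) A = (\<integral>\<^sup>+x. f x \<partial>distr M borel (left_walk X (Suc n)))"
      unfolding f_def using A by (intro nn_integral_indicator[symmetric]) simp
    also have "\<dots> = (\<integral>\<^sup>+\<omega>. f (left_walk X (Suc n) \<omega>) \<partial>M)" using f by (intro nn_integral_distr m) simp
    also have "\<dots> = (\<integral>\<^sup>+x. f (case x of (h :: real^'d^'d, g) \<Rightarrow> h ** g) \<partial>(\<mu> \<Otimes>\<^sub>M cv \<mu> n))"
      unfolding joint using fm by (subst nn_integral_distr[OF pm]) auto
    also have "\<dots> = (\<integral>\<^sup>+g. \<integral>\<^sup>+h. f (h ** g) \<partial>\<mu> \<partial>cv \<mu> n)"
      using P.nn_integral_snd[OF fm'] by (simp add: split_def)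
    also have "\<dots> = (\<integral>\<^sup>+g. \<integral>\<^sup>+h. f (h ** g) \<partial>cv \<mu> 1 \<partial>cv \<mu> n)"
      by (intro nn_integral_cong cv1[symmetric] tr f)
    also have "\<dots> = (\<integral>\<^sup>+x. f x \<partial>cv \<mu> (1 + n))" by (rule nn_integral_cv_add[OF f, symmetric])
    also have "\<dots> = emeasure (cv \<mu> (Suc n)) A"
      unfolding f_def using A by (subst nn_integral_indicator) (auto simp: sets_cv)
    finally show "emeasure (distr M borel (left_walk X (Suc n))) A = emeasure (cv \<mu> (Suc n)) A" .
  qed
  with m show ?case by blast
qed

lemma limsup_root_less_one:
  assumes C: "0 \<le> C" and r: "0 < r" "r < (1::real)" and q: "\<And>n. 0 \<le> q n" "\<And>n. q n \<le> C * r ^ n"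
  shows "limsup (\<lambda>n. ereal (root n (q n))) < 1"
proof -
  \<comment> \<open>\<open>C + 1\<close> is positive even when \<open>C = 0\<close>, so its roots
    tend to 1.\<close>
  have "(\<lambda>n. root n (C + 1) * r) \<longlonglongrightarrow> 1 * r"
    using C by (intro tendsto_mult LIMSEQ_root_const tendsto_const) auto
  then have lim: "(\<lambda>n. ereal (root n (C + 1) * r)) \<longlonglongrightarrow> ereal r" by simp
  have "\<forall>\<^sub>F n in sequentially. ereal (root n (q n)) \<le> ereal (root n (C + 1) * r)"
    using eventually_gt_at_top[of 0]
  proof eventually_elim
    case (elim n)
    have "0 \<le> r ^ n" using r by simp
    then have "q n \<le> (C + 1) * r ^ n" using q(2)[of n] by (simp add: algebra_simps)
    then have "root n (q n) \<le> root n ((C + 1) * r ^ n)" using elim by simp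
    also have "\<dots> = root n (C + 1) * r" using elim r by (simp add: real_root_mult real_root_power_cancel)
    finally show ?case by simp
  qed
  then have "limsup (\<lambda>n. ereal (root n (q n))) \<le> limsup (\<lambda>n. ereal (root n (C + 1) * r))" by (rule Limsup_mono)
  also have "\<dots> = ereal r" by (rule lim_imp_Limsup[OF _ lim]) simp
  also have "\<dots> < 1" using r by simp
  finally show ?thesis .
qed

theorem theorem1p5:
  fixes \<Gamma> :: "(real^'d^'d) set"
    and \<mu> :: "(real^'d^'d) measure"
    and M :: "'w measure"
    and X :: "nat \<Rightarrow> 'w \<Rightarrow> real^'d^'d"
    and V :: "(real^'d) set"
    and x :: "real^'d"
  assumes "CARD('d) \<ge> 2"
    and "subgroup \<Gamma> SL"
    and "zariski_dense_in \<Gamma> (carrier SL)"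
    and "prob_space \<mu>"
    and "sets \<mu> = sets SL_borel"
    and "exponential_moment \<mu>"
    and "generate SL (measure_support \<mu>) = \<Gamma>"
    and "prob_space M"
    and "prob_space.indep_vars M (\<lambda>_. SL_borel) X {1..}"
    and "\<And>n. n \<ge> 1 \<Longrightarrow> distr M SL_borel (X n) = \<mu>"
    and "algebraic_set V"
    and "V \<noteq> UNIV"
    and "x \<noteq> 0"
  shows "limsup (\<lambda>n. ereal (root n (measure M {\<omega> \<in> space M. left_walk X n \<omega> *v x \<in> V}))) < 1"
proof -
  interpret M: prob_space M by fact
  interpret \<mu>: prob_space \<mu> by fact
  have spSL: "space SL_borel = {g :: real^'d^'d. det g = 1}" by (simp add: SL_borel_def space_restrict_space SL_def)
  have sp: "space \<mu> = {g. det g = 1}" using sets_eq_imp_space_eq[OF assms(5)] spSL by simp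
  have id_SL: "(\<lambda>g. g) \<in> (SL_borel :: (real^'d^'d) measure) \<rightarrow>\<^sub>M borel"
    unfolding SL_borel_def by (rule measurable_restrict_space1) simp
  then have id: "(\<lambda>g. g) \<in> \<mu> \<rightarrow>\<^sub>M borel" using measurable_cong_sets[OF assms(5) refl] by blast
  \<comment> \<open>The step law is pushed forward to the space of all matrices, where products and
    polynomials are Borel; determinant 1 then holds almost surely.\<close>
  define \<nu> where "\<nu> = distr \<mu> borel (\<lambda>g. g)"
  have AE_\<nu>: "AE g in \<mu>. Q g" if "AE g in \<nu>. Q g" for Q
    using AE_distrD[OF id that[unfolded \<nu>_def]] .
  have walk: "mat_walk \<nu>"
  proof (rule mat_walk.intro)
    show "prob_space \<nu>" unfolding \<nu>_def by (rule \<mu>.prob_space_distr[OF id])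
    show "sets \<nu> = sets borel" by (simp add: \<nu>_def)
    have "AE g in \<mu>. det g = 1" using sp by (intro AE_I2) auto
    then show "AE g in \<nu>. det g = 1"
      unfolding \<nu>_def using borel_closed[OF closed_SL] by (subst AE_distr_iff[OF id]) auto
  qed
  interpret W: sl_walk \<nu>
  proof (rule sl_walk.intro[OF walk], rule sl_walk_axioms.intro)
    fix G :: "(real^'d^'d) set" and p and a :: "real^'d^'d"
    assume G: "\<And>g. g \<in> G \<Longrightarrow> det g = 1" "mat 1 \<in> G" "\<And>g h. g \<in> G \<Longrightarrow> h \<in> G \<Longrightarrow> g ** h \<in> G"
      "\<And>g. g \<in> G \<Longrightarrow> \<exists>h\<in>G. g ** h = mat 1 \<and> h ** g = mat 1" "AE g in \<nu>. g \<in> G"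
      and p: "real_polynomial_function p" "\<And>g. g \<in> G \<Longrightarrow> p g = 0" "det a = 1"
    show "p a = 0" by (rule full_measure_dense[OF assms(5,7,3) G(1-4) AE_\<nu>[OF G(5)] p])
  qed
  have ind: "M.indep_vars (\<lambda>_. borel) X {1..}"
    by (rule M.indep_vars_compose2[OF assms(9)]) (rule id_SL)
  have law: "distr M borel (X n) = \<nu>" if "1 \<le> n" for n
  proof -
    have "X n \<in> M \<rightarrow>\<^sub>M SL_borel" using assms(9) that unfolding M.indep_vars_def by auto
    then have "distr M borel (X n) = distr (distr M SL_borel (X n)) borel (\<lambda>g. g)"
      by (subst distr_distr[OF id_SL]) (auto simp: comp_def)
    then show ?thesis by (simp add: assms(10)[OF that] \<nu>_def)
  qed
  obtain p :: "real^'d^'d \<Rightarrow> real" and a where p: "real_polynomial_function p" "det a = 1" "p a \<noteq> 0"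
    "\<And>g. g *v x \<in> V \<Longrightarrow> p g = 0"
    using algebraic_orbit_polynomial[OF assms(1,11,12,13)] by blast
  obtain C r where C: "0 \<le> C" "0 < r" "r < 1"
    "\<And>n. measure (cv \<nu> n) {g. det g = 1 \<and> p g = 0} \<le> C * r ^ n"
    using W.polynomial_zero_decay[OF p(1-3)] by blast
  have "measure M {\<omega> \<in> space M. left_walk X n \<omega> *v x \<in> V} \<le> C * r ^ n" for n
  proof -
    let ?Z = "{g :: real^'d^'d. p g = 0}"
    have Z: "?Z \<in> sets borel"
      by (intro borel_closed closed_Collect_eq continuous_on_poly p(1) continuous_on_const)
    have m: "left_walk X n \<in> borel_measurable M" and d: "distr M borel (left_walk X n) = cv \<nu> n"
      using W.left_walk_law[OF M.prob_space_axioms ind law, of n] by auto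
    have Zd: "{g. det g = 1 \<and> p g = 0} \<in> sets borel"
      using sets.Int[OF borel_closed[OF closed_SL] Z] by (simp add: Collect_conj_eq)
    have "measure M {\<omega> \<in> space M. left_walk X n \<omega> *v x \<in> V} \<le> measure M (left_walk X n -` ?Z \<inter> space M)"
      by (rule M.finite_measure_mono) (use p(4) measurable_sets[OF m Z] in auto)
    also have "\<dots> = measure (cv \<nu> n) ?Z" unfolding d[symmetric] by (rule measure_distr[OF m, symmetric]) (simp add: Z)
    also have "\<dots> = measure (cv \<nu> n) {g. det g = 1 \<and> p g = 0}"
    proof (rule measure_eq_AE)
      show "AE g in cv \<nu> n. (g \<in> ?Z) = (g \<in> {g. det g = 1 \<and> p g = 0})"
        using W.AE_det_cv by eventually_elim simp
    qed (use Z Zd in \<open>simp_all add: sets_cv\<close>)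
    finally show ?thesis using C(4)[of n] by linarith
  qed
  with C(1-3) show ?thesis by (intro limsup_root_less_one) auto
qed

end
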